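(* Let $\mathcal{C}$ be a finite tensor category and let $\mathcal{M}$ be a finite left $\mathcal{C}$-module category. Then $\mathrm{CF}(\mathcal{M})$ is a left module over the algebra $\mathrm{CF}(\mathcal{C})$ by the action $\star:\mathrm{CF}(\mathcal{C})\times\mathrm{CF}(\mathcal{M})\to\mathrm{CF}(\mathcal{M})$, $f\star g=f\circ\mathsf{Z}(g)\circ\delta_{\mathcal{M}}$.
   Context: $k$ is an algebraically closed field. A finite abelian category is a $k$-linear category equivalent to finite-dimensional left modules over a finite-dimensional $k$-algebra. A finite tensor category is a rigid monoidal category $\mathcal{C}$ that is finite abelian, with $k$-linear tensor product in each variable and simple unit $\mathbf{1}$. A finite left $\mathcal{C}$-module category is a left $\mathcal{C}$-module category that is finite abelian with action $\otimes$ $k$-linear and right exact in each variable. Associativity constraints are suppressed. $(X^*,\mathrm{ev}_X:X^*\otimes X\to\mathbf{1},\mathrm{coev}_X:\mathbf{1}\to X\otimes X^* )$ is the left dual of $X$. Write $[M,N]=\underline{\mathrm{Hom}}(M,N)$: $[M,-]$ is right adjoint to $X\mapsto X\otimes M$, with counit $\underline{\mathrm{ev}}_{M,N}:[M,N]\otimes M\to N$. Let $\mathfrak{a}_{X,M,N}:X\otimes[M,N]\to[M,X\otimes N]$ be the isomorphism corresponding to $\mathrm{id}_X\otimes\underline{\mathrm{ev}}_{M,N}$ and $\mathfrak{b}^{\natural}_{X,M,N}:[X\otimes M,N]\otimes X\to[M,N]$ the morphism corresponding to $\underline{\mathrm{ev}}_{X\otimes M,N}$. Let $A_{\mathcal{M}}=\int_{M\in\mathcal{M}}[M,M]$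 be the end (which exists), with universal dinatural transformation $\pi_{\mathcal{M}}(M):A_{\mathcal{M}}\to[M,M]$. It carries a unique half-braiding $\sigma_{\mathcal{M}}(X):A_{\mathcal{M}}\otimes X\to X\otimes A_{\mathcal{M}}$ with $\mathfrak{a}_{X,M,M}\circ(\mathrm{id}_X\otimes\pi_{\mathcal{M}}(M))\circ\sigma_{\mathcal{M}}(X)=\mathfrak{b}^{\natural}_{X,M,X\otimes M}\circ(\pi_{\mathcal{M}}(X\otimes M)\otimes\mathrm{id}_X)$ for all $X\in\mathcal{C}$, $M\in\mathcal{M}$. The space of class functions of $\mathcal{M}$ is $\mathrm{CF}(\mathcal{M})=\mathrm{Hom}_{\mathcal{C}}(A_{\mathcal{M}},\mathbf{1})$. Let $\mathsf{Z}(V)=\int_{X\in\mathcal{C}}X\otimes V\otimes X^*$ ($V\in\mathcal{C}$) with universal dinatural transformation $\pi^{\mathsf{Z}}_V(X):\mathsf{Z}(V)\to X\otimes V\otimes X^*$; $\mathsf{Z}$ is an endofunctor of $\mathcal{C}$. For $\mathcal{M}=\mathcal{C}$ one has $[X,Y]=Y\otimes X^*$, so $A_{\mathcal{C}}=\mathsf{Z}(\mathbf{1})$. The morphism $\delta_{\mathcal{M}}:A_{\mathcal{M}}\to\mathsf{Z}(A_{\mathcal{M}})$ is the unique one with $\pi^{\mathsf{Z}}_{A_{\mathcal{M}}}(X)\circ\delta_{\mathcal{M}}=(\sigma_{\mathcal{M}}(X)\otimes\mathrm{id}_{X^*})\circ(\mathrm{id}_{A_{\mathcal{M}}}\otimes\mathrm{coev}_X)$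 for all $X\in\mathcal{C}$. For $f\in\mathrm{CF}(\mathcal{C})$, $g\in\mathrm{CF}(\mathcal{M})$, put $f\star g=f\circ\mathsf{Z}(g)\circ\delta_{\mathcal{M}}$. For $\mathcal{M}=\mathcal{C}$ this makes $\mathrm{CF}(\mathcal{C})$ an associative unital $k$-algebra, with unit $\pi_{\mathcal{C}}(\mathbf{1}):A_{\mathcal{C}}\to\mathbf{1}$. *)

theory Defs
  imports "HOL-Algebra.Algebraic_Closure"
begin

no_notation var (\<open>X\<index>\<close>)

section \<open>Linear categories\<close>

text \<open>Composition is written in applicative order. The elements of \<open>arr\<close> carry their
  source and target, so distinct hom-sets are disjoint.\<close>

record ('o, 'a, 'k) lin_cat =
  obj   :: "'o set"
  arr   :: "'a set"
  src   :: "'a \<Rightarrow> 'o"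
  tgt   :: "'a \<Rightarrow> 'o"
  idt   :: "'o \<Rightarrow> 'a"
  cmp   :: "'a \<Rightarrow> 'a \<Rightarrow> 'a"  (infixr \<open>\<bullet>\<index>\<close> 55)
  zeroA :: "'o \<Rightarrow> 'o \<Rightarrow> 'a"
  addA  :: "'a \<Rightarrow> 'a \<Rightarrow> 'a"
  scalA :: "'k \<Rightarrow> 'a \<Rightarrow> 'a"

definition Hom :: "('o, 'a, 'k, 'x) lin_cat_scheme \<Rightarrow> 'o \<Rightarrow> 'o \<Rightarrow> 'a set" where
  "Hom C X Y = {f \<in> arr C. src C f = X \<and> tgt C f = Y}"

text \<open>The hom-set as a record of HOL-Algebra; the fields \<open>mult\<close> and \<open>one\<close> play no role in
  the locale \<^locale>\<open>module\<close>.\<close>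

definition hom_space :: "('o, 'a, 'k, 'x) lin_cat_scheme \<Rightarrow> 'o \<Rightarrow> 'o \<Rightarrow> ('k, 'a) module" where
  "hom_space C X Y =
    \<lparr>carrier = Hom C X Y, monoid.mult = undefined, one = undefined,
     ring.zero = zeroA C X Y, add = addA C, smult = scalA C\<rparr>"

locale linear_category =
  fixes K :: "('k, 'r) ring_scheme" and C :: "('o, 'a, 'k, 'x) lin_cat_scheme" (structure)
  assumes src_obj: "f \<in> arr C \<Longrightarrow> src C f \<in> obj C"
    and tgt_obj: "f \<in> arr C \<Longrightarrow> tgt C f \<in> obj C"
    and idt_hom: "X \<in> obj C \<Longrightarrow> idt C X \<in> Hom C X X"
    and cmp_hom: "\<lbrakk>g \<in> Hom C Y Z; f \<in> Hom C X Y\<rbrakk> \<Longrightarrow> g \<bullet> f \<in> Hom C X Z"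
    and cmp_idt: "f \<in> Hom C X Y \<Longrightarrow> f \<bullet> idt C X = f"
    and idt_cmp: "f \<in> Hom C X Y \<Longrightarrow> idt C Y \<bullet> f = f"
    and cmp_assoc: "\<lbrakk>h \<in> Hom C Y Z; g \<in> Hom C X Y; f \<in> Hom C W X\<rbrakk>
      \<Longrightarrow> (h \<bullet> g) \<bullet> f = h \<bullet> (g \<bullet> f)"
    and hom_module: "\<lbrakk>X \<in> obj C; Y \<in> obj C\<rbrakk> \<Longrightarrow> module K (hom_space C X Y)"
    and cmp_add_left: "\<lbrakk>g \<in> Hom C Y Z; g' \<in> Hom C Y Z; f \<in> Hom C X Y\<rbrakk>
      \<Longrightarrow> addA C g g' \<bullet> f = addA C (g \<bullet> f) (g' \<bullet> f)"
    and cmp_add_right: "\<lbrakk>g \<in> Hom C Y Z; f \<in> Hom C X Y; f' \<in> Hom C X Y\<rbrakk>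
      \<Longrightarrow> g \<bullet> addA C f f' = addA C (g \<bullet> f) (g \<bullet> f')"
    and cmp_scal_left: "\<lbrakk>c \<in> carrier K; g \<in> Hom C Y Z; f \<in> Hom C X Y\<rbrakk>
      \<Longrightarrow> scalA C c g \<bullet> f = scalA C c (g \<bullet> f)"
    and cmp_scal_right: "\<lbrakk>c \<in> carrier K; g \<in> Hom C Y Z; f \<in> Hom C X Y\<rbrakk>
      \<Longrightarrow> g \<bullet> scalA C c f = scalA C c (g \<bullet> f)"

definition iso_arr :: "('o, 'a, 'k, 'x) lin_cat_scheme \<Rightarrow> 'a \<Rightarrow> bool" where
  "iso_arr C f \<longleftrightarrow> f \<in> arr C \<and>
    (\<exists>g \<in> Hom C (tgt C f) (src C f).
       g \<bullet>\<^bsub>C\<^esub> f = idt C (src C f) \<and> f \<bullet>\<^bsub>C\<^esub> g = idt C (tgt C f))"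

definition inv_arr :: "('o, 'a, 'k, 'x) lin_cat_scheme \<Rightarrow> 'a \<Rightarrow> 'a" where
  "inv_arr C f = (THE g. g \<in> Hom C (tgt C f) (src C f) \<and>
     g \<bullet>\<^bsub>C\<^esub> f = idt C (src C f) \<and> f \<bullet>\<^bsub>C\<^esub> g = idt C (tgt C f))"

definition monic :: "('o, 'a, 'k, 'x) lin_cat_scheme \<Rightarrow> 'a \<Rightarrow> bool" where
  "monic C m \<longleftrightarrow> m \<in> arr C \<and>
    (\<forall>W \<in> obj C. \<forall>f \<in> Hom C W (src C m). \<forall>g \<in> Hom C W (src C m).
       m \<bullet>\<^bsub>C\<^esub> f = m \<bullet>\<^bsub>C\<^esub> g \<longrightarrow> f = g)"

definition zero_object :: "('o, 'a, 'k, 'x) lin_cat_scheme \<Rightarrow> 'o \<Rightarrow> bool" where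
  "zero_object C X \<longleftrightarrow> X \<in> obj C \<and> idt C X = zeroA C X X"

definition simple_object :: "('o, 'a, 'k, 'x) lin_cat_scheme \<Rightarrow> 'o \<Rightarrow> bool" where
  "simple_object C S \<longleftrightarrow> S \<in> obj C \<and> \<not> zero_object C S \<and>
    (\<forall>m. monic C m \<and> tgt C m = S \<longrightarrow> zero_object C (src C m) \<or> iso_arr C m)"

definition is_cokernel :: "('o, 'a, 'k, 'x) lin_cat_scheme \<Rightarrow> 'a \<Rightarrow> 'a \<Rightarrow> bool" where
  "is_cokernel C f q \<longleftrightarrow> f \<in> arr C \<and> q \<in> arr C \<and> src C q = tgt C f \<and>
    q \<bullet>\<^bsub>C\<^esub> f = zeroA C (src C f) (tgt C q) \<and>
    (\<forall>h \<in> arr C. src C h = tgt C f \<and> h \<bullet>\<^bsub>C\<^esub> f = zeroA C (src C f) (tgt C h) \<longrightarrow>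
       (\<exists>!u. u \<in> Hom C (tgt C q) (tgt C h) \<and> u \<bullet>\<^bsub>C\<^esub> q = h))"

text \<open>For a linear functor between abelian categories, given by its map on morphisms.
  A sequence \<open>X \<rightarrow> Y \<rightarrow> Z \<rightarrow> 0\<close> is exact iff its second map is a cokernel of the first.\<close>

definition right_exact ::
  "('o, 'a, 'k, 'x) lin_cat_scheme \<Rightarrow> ('p, 'b, 'k, 'y) lin_cat_scheme \<Rightarrow> ('a \<Rightarrow> 'b) \<Rightarrow> bool" where
  "right_exact C D FA \<longleftrightarrow> (\<forall>f q. is_cokernel C f q \<longrightarrow> is_cokernel D (FA f) (FA q))"

locale linear_functor =
  fixes K :: "('k, 'r) ring_scheme"
    and C :: "('o, 'a, 'k, 'x) lin_cat_scheme"
    and D :: "('p, 'b, 'k, 'y) lin_cat_scheme"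
    and FO :: "'o \<Rightarrow> 'p" and FA :: "'a \<Rightarrow> 'b"
  assumes map_obj: "X \<in> obj C \<Longrightarrow> FO X \<in> obj D"
    and map_hom: "f \<in> Hom C X Y \<Longrightarrow> FA f \<in> Hom D (FO X) (FO Y)"
    and map_idt: "X \<in> obj C \<Longrightarrow> FA (idt C X) = idt D (FO X)"
    and map_cmp: "\<lbrakk>g \<in> Hom C Y Z; f \<in> Hom C X Y\<rbrakk> \<Longrightarrow> FA (g \<bullet>\<^bsub>C\<^esub> f) = FA g \<bullet>\<^bsub>D\<^esub> FA f"
    and map_add: "\<lbrakk>f \<in> Hom C X Y; g \<in> Hom C X Y\<rbrakk> \<Longrightarrow> FA (addA C f g) = addA D (FA f) (FA g)"
    and map_scal: "\<lbrakk>c \<in> carrier K; f \<in> Hom C X Y\<rbrakk> \<Longrightarrow> FA (scalA C c f) = scalA D c (FA f)"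

definition natural_iso ::
  "('o, 'a, 'k, 'x) lin_cat_scheme \<Rightarrow> ('p, 'b, 'k, 'y) lin_cat_scheme \<Rightarrow>
   ('o \<Rightarrow> 'p) \<Rightarrow> ('a \<Rightarrow> 'b) \<Rightarrow> ('o \<Rightarrow> 'p) \<Rightarrow> ('a \<Rightarrow> 'b) \<Rightarrow> ('o \<Rightarrow> 'b) \<Rightarrow> bool" where
  "natural_iso C D FO FA GO GA t \<longleftrightarrow>
    (\<forall>X \<in> obj C. t X \<in> Hom D (FO X) (GO X) \<and> iso_arr D (t X)) \<and>
    (\<forall>f \<in> arr C. t (tgt C f) \<bullet>\<^bsub>D\<^esub> FA f = GA f \<bullet>\<^bsub>D\<^esub> t (src C f))"

definition linearly_equivalent ::
  "('k, 'r) ring_scheme \<Rightarrow> ('o, 'a, 'k, 'x) lin_cat_scheme \<Rightarrow>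
   ('p, 'b, 'k, 'y) lin_cat_scheme \<Rightarrow> bool" where
  "linearly_equivalent K C D \<longleftrightarrow>
    (\<exists>FO FA GO GA s t.
       linear_functor K C D FO FA \<and> linear_functor K D C GO GA \<and>
       natural_iso C C (\<lambda>X. X) (\<lambda>f. f) (\<lambda>X. GO (FO X)) (\<lambda>f. GA (FA f)) s \<and>
       natural_iso D D (\<lambda>Y. FO (GO Y)) (\<lambda>g. FA (GA g)) (\<lambda>Y. Y) (\<lambda>g. g) t)"


section \<open>Algebras, modules and finite abelian categories\<close>

text \<open>Not necessarily commutative, unlike \<^locale>\<open>algebra\<close>.\<close>

locale unital_algebra = module K A + ring A
  for K :: "('k, 'r) ring_scheme" and A :: "('k, 'a, 'x) module_scheme" (structure) +
  assumes smult_mult_left: "\<lbrakk>c \<in> carrier K; a \<in> carrier A; b \<in> carrier A\<rbrakk>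
      \<Longrightarrow> (c \<odot> a) \<otimes> b = c \<odot> (a \<otimes> b)"
    and smult_mult_right: "\<lbrakk>c \<in> carrier K; a \<in> carrier A; b \<in> carrier A\<rbrakk>
      \<Longrightarrow> a \<otimes> (c \<odot> b) = c \<odot> (a \<otimes> b)"

locale left_module = alg: unital_algebra K A + space: module K V
  for K :: "('k, 'r) ring_scheme" and A :: "('k, 'a, 'x) module_scheme"
    and V :: "('k, 'v, 'y) module_scheme" +
  fixes act :: "'a \<Rightarrow> 'v \<Rightarrow> 'v"
  assumes act_closed: "\<lbrakk>a \<in> carrier A; v \<in> carrier V\<rbrakk> \<Longrightarrow> act a v \<in> carrier V"
    and act_add_left: "\<lbrakk>a \<in> carrier A; b \<in> carrier A; v \<in> carrier V\<rbrakk>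
      \<Longrightarrow> act (a \<oplus>\<^bsub>A\<^esub> b) v = act a v \<oplus>\<^bsub>V\<^esub> act b v"
    and act_add_right: "\<lbrakk>a \<in> carrier A; v \<in> carrier V; w \<in> carrier V\<rbrakk>
      \<Longrightarrow> act a (v \<oplus>\<^bsub>V\<^esub> w) = act a v \<oplus>\<^bsub>V\<^esub> act a w"
    and act_smult_left: "\<lbrakk>c \<in> carrier K; a \<in> carrier A; v \<in> carrier V\<rbrakk>
      \<Longrightarrow> act (c \<odot>\<^bsub>A\<^esub> a) v = c \<odot>\<^bsub>V\<^esub> act a v"
    and act_smult_right: "\<lbrakk>c \<in> carrier K; a \<in> carrier A; v \<in> carrier V\<rbrakk>
      \<Longrightarrow> act a (c \<odot>\<^bsub>V\<^esub> v) = c \<odot>\<^bsub>V\<^esub> act a v"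
    and act_one: "v \<in> carrier V \<Longrightarrow> act \<one>\<^bsub>A\<^esub> v = v"
    and act_mult: "\<lbrakk>a \<in> carrier A; b \<in> carrier A; v \<in> carrier V\<rbrakk>
      \<Longrightarrow> act (a \<otimes>\<^bsub>A\<^esub> b) v = act a (act b v)"

definition fin_dim :: "('k, 'r) ring_scheme \<Rightarrow> ('k, 'v, 'y) module_scheme \<Rightarrow> bool" where
  "fin_dim K V \<longleftrightarrow> (\<exists>S. finite S \<and> S \<subseteq> carrier V \<and>
     (\<forall>v \<in> carrier V. \<exists>c \<in> S \<rightarrow> carrier K. v = (\<Oplus>\<^bsub>V\<^esub>s\<in>S. c s \<odot>\<^bsub>V\<^esub> s)))"

text \<open>The underlying vector spaces live on arbitrary subsets of the type \<open>nat \<Rightarrow> 'k\<close>. This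
  loses nothing up to isomorphism, since \<open>K\<^sup>d\<close> embeds as the functions that vanish from \<open>d\<close> on.
  A module is a pair of a vector space and an action.\<close>

type_synonym 'k vmod = "('k, nat \<Rightarrow> 'k) module \<times> ((nat \<Rightarrow> 'k) \<Rightarrow> (nat \<Rightarrow> 'k) \<Rightarrow> nat \<Rightarrow> 'k)"

definition module_maps :: "('k, 'r) ring_scheme \<Rightarrow> ('k, nat \<Rightarrow> 'k) module \<Rightarrow>
    'k vmod \<Rightarrow> 'k vmod \<Rightarrow> ((nat \<Rightarrow> 'k) \<Rightarrow> nat \<Rightarrow> 'k) set" where
  "module_maps K A M N =
    {f \<in> carrier (fst M) \<rightarrow>\<^sub>E carrier (fst N).
      (\<forall>v \<in> carrier (fst M). \<forall>w \<in> carrier (fst M).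
         f (v \<oplus>\<^bsub>fst M\<^esub> w) = f v \<oplus>\<^bsub>fst N\<^esub> f w) \<and>
      (\<forall>c \<in> carrier K. \<forall>v \<in> carrier (fst M). f (c \<odot>\<^bsub>fst M\<^esub> v) = c \<odot>\<^bsub>fst N\<^esub> f v) \<and>
      (\<forall>a \<in> carrier A. \<forall>v \<in> carrier (fst M). f (snd M a v) = snd N a (f v))}"

definition fdmod_cat :: "('k, 'r) ring_scheme \<Rightarrow> ('k, nat \<Rightarrow> 'k) module \<Rightarrow>
    ('k vmod, 'k vmod \<times> ((nat \<Rightarrow> 'k) \<Rightarrow> nat \<Rightarrow> 'k) \<times> 'k vmod, 'k) lin_cat" where
  "fdmod_cat K A =
    (let Ob = {M. left_module K A (fst M) (snd M) \<and> fin_dim K (fst M)} in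
    \<lparr>obj = Ob,
     arr = {(M, f, N). M \<in> Ob \<and> N \<in> Ob \<and> f \<in> module_maps K A M N},
     src = (\<lambda>(M, f, N). M),
     tgt = (\<lambda>(M, f, N). N),
     idt = (\<lambda>M. (M, \<lambda>v \<in> carrier (fst M). v, M)),
     cmp = (\<lambda>(_, g, P) (M, f, _). (M, compose (carrier (fst M)) g f, P)),
     zeroA = (\<lambda>M N. (M, \<lambda>v \<in> carrier (fst M). \<zero>\<^bsub>fst N\<^esub>, N)),
     addA = (\<lambda>(M, f, N) (_, g, _). (M, \<lambda>v \<in> carrier (fst M). f v \<oplus>\<^bsub>fst N\<^esub> g v, N)),
     scalA = (\<lambda>c (M, f, N). (M, \<lambda>v \<in> carrier (fst M). c \<odot>\<^bsub>fst N\<^esub> f v, N))\<rparr>)"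

locale finite_abelian_category = linear_category K C
  for K :: "('k, 'r) ring_scheme" and C :: "('o, 'a, 'k, 'x) lin_cat_scheme" (structure) +
  assumes equiv_fdmod: "\<exists>A. unital_algebra K A \<and> fin_dim K A \<and>
    linearly_equivalent K C (fdmod_cat K A)"


section \<open>Finite tensor categories\<close>

text \<open>Associativity and unit constraints are explicit and a choice of left duals is part of
  the structure:
    \<open>asc C X Y Z : (X \<otimes> Y) \<otimes> Z \<rightarrow> X \<otimes> (Y \<otimes> Z)\<close>,
    \<open>lun C X : \<one> \<otimes> X \<rightarrow> X\<close>, \<open>run C X : X \<otimes> \<one> \<rightarrow> X\<close>,
    \<open>lev C X : X\<^sup>* \<otimes> X \<rightarrow> \<one>\<close>, \<open>lcoev C X : \<one> \<rightarrow> X \<otimes> X\<^sup>*\<close>.\<close>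

record ('o, 'a, 'k) tensor_cat = "('o, 'a, 'k) lin_cat" +
  tenO  :: "'o \<Rightarrow> 'o \<Rightarrow> 'o"  (infixr \<open>\<otimes>\<^sub>o\<index>\<close> 70)
  tenA  :: "'a \<Rightarrow> 'a \<Rightarrow> 'a"  (infixr \<open>\<otimes>\<^sub>a\<index>\<close> 70)
  unitO :: "'o"  (\<open>\<one>\<^sub>o\<index>\<close>)
  asc   :: "'o \<Rightarrow> 'o \<Rightarrow> 'o \<Rightarrow> 'a"
  lun   :: "'o \<Rightarrow> 'a"
  run   :: "'o \<Rightarrow> 'a"
  ldual :: "'o \<Rightarrow> 'o"
  lev   :: "'o \<Rightarrow> 'a"
  lcoev :: "'o \<Rightarrow> 'a"

locale bilinear_bifunctor =
  fixes K :: "('k, 'r) ring_scheme"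
    and B :: "('n, 'b, 'k, 'z) lin_cat_scheme"
    and C :: "('o, 'a, 'k, 'x) lin_cat_scheme"
    and D :: "('p, 'd, 'k, 'y) lin_cat_scheme"
    and TO :: "'n \<Rightarrow> 'o \<Rightarrow> 'p" and TA :: "'b \<Rightarrow> 'a \<Rightarrow> 'd"
  assumes bi_obj: "\<lbrakk>X \<in> obj B; Y \<in> obj C\<rbrakk> \<Longrightarrow> TO X Y \<in> obj D"
    and bi_hom: "\<lbrakk>f \<in> Hom B X X'; g \<in> Hom C Y Y'\<rbrakk> \<Longrightarrow> TA f g \<in> Hom D (TO X Y) (TO X' Y')"
    and bi_idt: "\<lbrakk>X \<in> obj B; Y \<in> obj C\<rbrakk> \<Longrightarrow> TA (idt B X) (idt C Y) = idt D (TO X Y)"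
    and bi_cmp: "\<lbrakk>f' \<in> Hom B X' X''; f \<in> Hom B X X'; g' \<in> Hom C Y' Y''; g \<in> Hom C Y Y'\<rbrakk>
      \<Longrightarrow> TA (f' \<bullet>\<^bsub>B\<^esub> f) (g' \<bullet>\<^bsub>C\<^esub> g) = TA f' g' \<bullet>\<^bsub>D\<^esub> TA f g"
    and bi_add_left: "\<lbrakk>f \<in> Hom B X X'; f' \<in> Hom B X X'; g \<in> Hom C Y Y'\<rbrakk>
      \<Longrightarrow> TA (addA B f f') g = addA D (TA f g) (TA f' g)"
    and bi_add_right: "\<lbrakk>f \<in> Hom B X X'; g \<in> Hom C Y Y'; g' \<in> Hom C Y Y'\<rbrakk>
      \<Longrightarrow> TA f (addA C g g') = addA D (TA f g) (TA f g')"
    and bi_scal_left: "\<lbrakk>c \<in> carrier K; f \<in> Hom B X X'; g \<in> Hom C Y Y'\<rbrakk>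
      \<Longrightarrow> TA (scalA B c f) g = scalA D c (TA f g)"
    and bi_scal_right: "\<lbrakk>c \<in> carrier K; f \<in> Hom B X X'; g \<in> Hom C Y Y'\<rbrakk>
      \<Longrightarrow> TA f (scalA C c g) = scalA D c (TA f g)"

definition is_left_dual ::
  "('o, 'a, 'k, 'x) tensor_cat_scheme \<Rightarrow> 'o \<Rightarrow> 'o \<Rightarrow> 'a \<Rightarrow> 'a \<Rightarrow> bool" where
  "is_left_dual C X D e c \<longleftrightarrow> D \<in> obj C \<and>
    e \<in> Hom C (D \<otimes>\<^sub>o\<^bsub>C\<^esub> X) \<one>\<^sub>o\<^bsub>C\<^esub> \<and> c \<in> Hom C \<one>\<^sub>o\<^bsub>C\<^esub> (X \<otimes>\<^sub>o\<^bsub>C\<^esub> D) \<and>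
    run C X \<bullet>\<^bsub>C\<^esub> (idt C X \<otimes>\<^sub>a\<^bsub>C\<^esub> e) \<bullet>\<^bsub>C\<^esub> asc C X D X \<bullet>\<^bsub>C\<^esub> (c \<otimes>\<^sub>a\<^bsub>C\<^esub> idt C X)
      \<bullet>\<^bsub>C\<^esub> inv_arr C (lun C X) = idt C X \<and>
    lun C D \<bullet>\<^bsub>C\<^esub> (e \<otimes>\<^sub>a\<^bsub>C\<^esub> idt C D) \<bullet>\<^bsub>C\<^esub> inv_arr C (asc C D X D) \<bullet>\<^bsub>C\<^esub> (idt C D \<otimes>\<^sub>a\<^bsub>C\<^esub> c)
      \<bullet>\<^bsub>C\<^esub> inv_arr C (run C D) = idt C D"

locale finite_tensor_category =
  finite_abelian_category K C + tensor: bilinear_bifunctor K C C C "tenO C" "tenA C"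
  for K :: "('k, 'r) ring_scheme" and C :: "('o, 'a, 'k, 'x) tensor_cat_scheme" (structure) +
  assumes asc_iso: "\<lbrakk>X \<in> obj C; Y \<in> obj C; Z \<in> obj C\<rbrakk>
      \<Longrightarrow> asc C X Y Z \<in> Hom C ((X \<otimes>\<^sub>o Y) \<otimes>\<^sub>o Z) (X \<otimes>\<^sub>o (Y \<otimes>\<^sub>o Z)) \<and> iso_arr C (asc C X Y Z)"
    and asc_natural: "\<lbrakk>f \<in> Hom C X X'; g \<in> Hom C Y Y'; h \<in> Hom C Z Z'\<rbrakk>
      \<Longrightarrow> asc C X' Y' Z' \<bullet> ((f \<otimes>\<^sub>a g) \<otimes>\<^sub>a h) = (f \<otimes>\<^sub>a (g \<otimes>\<^sub>a h)) \<bullet> asc C X Y Z"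
    and unit_obj: "\<one>\<^sub>o \<in> obj C"
    and lun_natural: "natural_iso C C (\<lambda>X. \<one>\<^sub>o \<otimes>\<^sub>o X) (\<lambda>f. idt C \<one>\<^sub>o \<otimes>\<^sub>a f) (\<lambda>X. X) (\<lambda>f. f) (lun C)"
    and run_natural: "natural_iso C C (\<lambda>X. X \<otimes>\<^sub>o \<one>\<^sub>o) (\<lambda>f. f \<otimes>\<^sub>a idt C \<one>\<^sub>o) (\<lambda>X. X) (\<lambda>f. f) (run C)"
    and pentagon: "\<lbrakk>W \<in> obj C; X \<in> obj C; Y \<in> obj C; Z \<in> obj C\<rbrakk>
      \<Longrightarrow> asc C W X (Y \<otimes>\<^sub>o Z) \<bullet> asc C (W \<otimes>\<^sub>o X) Y Z =
          (idt C W \<otimes>\<^sub>a asc C X Y Z) \<bullet> asc C W (X \<otimes>\<^sub>o Y) Z \<bullet> (asc C W X Y \<otimes>\<^sub>a idt C Z)"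
    and triangle: "\<lbrakk>X \<in> obj C; Y \<in> obj C\<rbrakk>
      \<Longrightarrow> (idt C X \<otimes>\<^sub>a lun C Y) \<bullet> asc C X \<one>\<^sub>o Y = run C X \<otimes>\<^sub>a idt C Y"
    and left_dual: "X \<in> obj C \<Longrightarrow> is_left_dual C X (ldual C X) (lev C X) (lcoev C X)"
    \<comment> \<open>\<open>D\<close> is a right dual of \<open>X\<close> iff \<open>X\<close> is a left dual of \<open>D\<close>\<close>
    and right_dual: "X \<in> obj C \<Longrightarrow> \<exists>D \<in> obj C. \<exists>e c. is_left_dual C D X e c"
    and unit_simple: "simple_object C \<one>\<^sub>o"

definition dual_arr :: "('o, 'a, 'k, 'x) tensor_cat_scheme \<Rightarrow> 'a \<Rightarrow> 'a" where
  "dual_arr C f = (let X = src C f; Y = tgt C f; X' = ldual C X; Y' = ldual C Y in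
     lun C X' \<bullet>\<^bsub>C\<^esub> (lev C Y \<otimes>\<^sub>a\<^bsub>C\<^esub> idt C X') \<bullet>\<^bsub>C\<^esub> inv_arr C (asc C Y' Y X')
       \<bullet>\<^bsub>C\<^esub> (idt C Y' \<otimes>\<^sub>a\<^bsub>C\<^esub> (f \<otimes>\<^sub>a\<^bsub>C\<^esub> idt C X'))
       \<bullet>\<^bsub>C\<^esub> (idt C Y' \<otimes>\<^sub>a\<^bsub>C\<^esub> lcoev C X) \<bullet>\<^bsub>C\<^esub> inv_arr C (run C Y'))"


section \<open>Finite module categories\<close>

text \<open>The constraints are \<open>masc M X Y N : (X \<otimes> Y) \<otimes> N \<rightarrow> X \<otimes> (Y \<otimes> N)\<close> and
  \<open>mun M N : \<one> \<otimes> N \<rightarrow> N\<close>, the action being written \<open>\<rhd>\<close>.\<close>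

record ('c, 'e, 'o, 'a, 'k) mod_cat = "('o, 'a, 'k) lin_cat" +
  actO :: "'c \<Rightarrow> 'o \<Rightarrow> 'o"  (infixr \<open>\<rhd>\<^sub>o\<index>\<close> 70)
  actA :: "'e \<Rightarrow> 'a \<Rightarrow> 'a"  (infixr \<open>\<rhd>\<^sub>a\<index>\<close> 70)
  masc :: "'c \<Rightarrow> 'c \<Rightarrow> 'o \<Rightarrow> 'a"
  mun  :: "'o \<Rightarrow> 'a"

locale finite_module_category =
  finite_abelian_category K M + action: bilinear_bifunctor K C M M "actO M" "actA M"
  for K :: "('k, 'r) ring_scheme"
    and C :: "('c, 'e, 'k, 'x) tensor_cat_scheme"
    and M :: "('c, 'e, 'o, 'a, 'k, 'y) mod_cat_scheme" (structure) +
  assumes right_exact_left: "N \<in> obj M \<Longrightarrow> right_exact C M (\<lambda>f. f \<rhd>\<^sub>a idt M N)"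
    and right_exact_right: "X \<in> obj C \<Longrightarrow> right_exact M M (\<lambda>g. idt C X \<rhd>\<^sub>a g)"
    and masc_iso: "\<lbrakk>X \<in> obj C; Y \<in> obj C; N \<in> obj M\<rbrakk>
      \<Longrightarrow> masc M X Y N \<in> Hom M ((X \<otimes>\<^sub>o\<^bsub>C\<^esub> Y) \<rhd>\<^sub>o N) (X \<rhd>\<^sub>o (Y \<rhd>\<^sub>o N)) \<and> iso_arr M (masc M X Y N)"
    and masc_natural: "\<lbrakk>f \<in> Hom C X X'; g \<in> Hom C Y Y'; h \<in> Hom M N N'\<rbrakk>
      \<Longrightarrow> masc M X' Y' N' \<bullet> ((f \<otimes>\<^sub>a\<^bsub>C\<^esub> g) \<rhd>\<^sub>a h) = (f \<rhd>\<^sub>a (g \<rhd>\<^sub>a h)) \<bullet> masc M X Y N"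
    and mun_natural: "natural_iso M M (\<lambda>N. \<one>\<^sub>o\<^bsub>C\<^esub> \<rhd>\<^sub>o N) (\<lambda>g. idt C \<one>\<^sub>o\<^bsub>C\<^esub> \<rhd>\<^sub>a g)
        (\<lambda>N. N) (\<lambda>g. g) (mun M)"
    and module_pentagon: "\<lbrakk>X \<in> obj C; Y \<in> obj C; Z \<in> obj C; N \<in> obj M\<rbrakk>
      \<Longrightarrow> masc M X Y (Z \<rhd>\<^sub>o N) \<bullet> masc M (X \<otimes>\<^sub>o\<^bsub>C\<^esub> Y) Z N =
          (idt C X \<rhd>\<^sub>a masc M Y Z N) \<bullet> masc M X (Y \<otimes>\<^sub>o\<^bsub>C\<^esub> Z) N \<bullet> (asc C X Y Z \<rhd>\<^sub>a idt M N)"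
    and module_triangle: "\<lbrakk>X \<in> obj C; N \<in> obj M\<rbrakk>
      \<Longrightarrow> (idt C X \<rhd>\<^sub>a mun M N) \<bullet> masc M X \<one>\<^sub>o\<^bsub>C\<^esub> N = run C X \<rhd>\<^sub>a idt M N"

definition regular_module :: "('o, 'a, 'k, 'x) tensor_cat_scheme \<Rightarrow> ('o, 'a, 'o, 'a, 'k) mod_cat" where
  "regular_module C =
    \<lparr>obj = obj C, arr = arr C, src = src C, tgt = tgt C, idt = idt C, cmp = cmp C,
     zeroA = zeroA C, addA = addA C, scalA = scalA C,
     actO = tenO C, actA = tenA C, masc = asc C, mun = lun C\<rparr>"


section \<open>Ends\<close>

text \<open>A bifunctor \<open>D\<^sup>o\<^sup>p \<times> D \<rightarrow> C\<close> is given by \<open>TO\<close> on objects and \<open>TA\<close> on morphisms, where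
  \<open>TA f g : TO (tgt f) (src g) \<rightarrow> TO (src f) (tgt g)\<close>.\<close>

definition dinatural_cone ::
  "('o, 'a, 'k, 'x) lin_cat_scheme \<Rightarrow> ('d, 'e, 'k, 'y) lin_cat_scheme \<Rightarrow>
   ('d \<Rightarrow> 'd \<Rightarrow> 'o) \<Rightarrow> ('e \<Rightarrow> 'e \<Rightarrow> 'a) \<Rightarrow> 'o \<Rightarrow> ('d \<Rightarrow> 'a) \<Rightarrow> bool" where
  "dinatural_cone C D TO TA E p \<longleftrightarrow> E \<in> obj C \<and>
    (\<forall>X \<in> obj D. p X \<in> Hom C E (TO X X)) \<and>
    (\<forall>X \<in> obj D. \<forall>Y \<in> obj D. \<forall>h \<in> Hom D X Y.
       TA (idt D X) h \<bullet>\<^bsub>C\<^esub> p X = TA h (idt D Y) \<bullet>\<^bsub>C\<^esub> p Y)"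

definition is_end ::
  "('o, 'a, 'k, 'x) lin_cat_scheme \<Rightarrow> ('d, 'e, 'k, 'y) lin_cat_scheme \<Rightarrow>
   ('d \<Rightarrow> 'd \<Rightarrow> 'o) \<Rightarrow> ('e \<Rightarrow> 'e \<Rightarrow> 'a) \<Rightarrow> 'o \<Rightarrow> ('d \<Rightarrow> 'a) \<Rightarrow> bool" where
  "is_end C D TO TA E p \<longleftrightarrow> dinatural_cone C D TO TA E p \<and>
    (\<forall>E' p'. dinatural_cone C D TO TA E' p' \<longrightarrow>
       (\<exists>!u. u \<in> Hom C E' E \<and> (\<forall>X \<in> obj D. p X \<bullet>\<^bsub>C\<^esub> u = p' X)))"


section \<open>Internal Homs\<close>

text \<open>\<open>ih N P\<close> is \<open>[N, P]\<close> and \<open>ie N P : [N, P] \<rhd> N \<rightarrow> P\<close> is the counit of the adjunction.\<close>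

definition is_internal_hom ::
  "('c, 'e, 'k, 'x) tensor_cat_scheme \<Rightarrow> ('c, 'e, 'o, 'a, 'k, 'y) mod_cat_scheme \<Rightarrow>
   ('o \<Rightarrow> 'o \<Rightarrow> 'c) \<Rightarrow> ('o \<Rightarrow> 'o \<Rightarrow> 'a) \<Rightarrow> bool" where
  "is_internal_hom C M ih ie \<longleftrightarrow>
    (\<forall>N \<in> obj M. \<forall>P \<in> obj M. ih N P \<in> obj C \<and> ie N P \<in> Hom M (ih N P \<rhd>\<^sub>o\<^bsub>M\<^esub> N) P \<and>
      (\<forall>X \<in> obj C. bij_betw (\<lambda>f. ie N P \<bullet>\<^bsub>M\<^esub> (f \<rhd>\<^sub>a\<^bsub>M\<^esub> idt M N))
         (Hom C X (ih N P)) (Hom M (X \<rhd>\<^sub>o\<^bsub>M\<^esub> N) P)))"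

context
  fixes C :: "('c, 'e, 'k, 'x) tensor_cat_scheme" (structure)
    and M :: "('c, 'e, 'o, 'a, 'k, 'y) mod_cat_scheme"
    and ih :: "'o \<Rightarrow> 'o \<Rightarrow> 'c" and ie :: "'o \<Rightarrow> 'o \<Rightarrow> 'a"
begin

text \<open>The morphism \<open>X \<rightarrow> [N, P]\<close> corresponding to \<open>\<phi> : X \<rhd> N \<rightarrow> P\<close>.\<close>

definition transp :: "'c \<Rightarrow> 'o \<Rightarrow> 'o \<Rightarrow> 'a \<Rightarrow> 'e" where
  "transp X N P \<phi> = (THE f. f \<in> Hom C X (ih N P) \<and> ie N P \<bullet>\<^bsub>M\<^esub> (f \<rhd>\<^sub>a\<^bsub>M\<^esub> idt M N) = \<phi>)"

text \<open>\<open>[f, g] : [tgt f, src g] \<rightarrow> [src f, tgt g]\<close>\<close>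

definition ihom_arr :: "'a \<Rightarrow> 'a \<Rightarrow> 'e" where
  "ihom_arr f g = (let H = ih (tgt M f) (src M g) in
     transp H (src M f) (tgt M g)
       (g \<bullet>\<^bsub>M\<^esub> ie (tgt M f) (src M g) \<bullet>\<^bsub>M\<^esub> (idt C H \<rhd>\<^sub>a\<^bsub>M\<^esub> f)))"

definition ihom_a :: "'c \<Rightarrow> 'o \<Rightarrow> 'o \<Rightarrow> 'e" where
  "ihom_a X N P = transp (X \<otimes>\<^sub>o ih N P) N (X \<rhd>\<^sub>o\<^bsub>M\<^esub> P)
     ((idt C X \<rhd>\<^sub>a\<^bsub>M\<^esub> ie N P) \<bullet>\<^bsub>M\<^esub> masc M X (ih N P) N)"

definition ihom_b :: "'c \<Rightarrow> 'o \<Rightarrow> 'o \<Rightarrow> 'e" where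
  "ihom_b X N P = transp (ih (X \<rhd>\<^sub>o\<^bsub>M\<^esub> N) P \<otimes>\<^sub>o X) N P
     (ie (X \<rhd>\<^sub>o\<^bsub>M\<^esub> N) P \<bullet>\<^bsub>M\<^esub> masc M (ih (X \<rhd>\<^sub>o\<^bsub>M\<^esub> N) P) X N)"

end


section \<open>The central Hopf comonad and class functions\<close>

text \<open>\<open>(X, Y) \<mapsto> (Y \<otimes> V) \<otimes> X\<^sup>*\<close>, whose end is \<open>Z V\<close>.\<close>

definition conj_obj :: "('o, 'a, 'k, 'x) tensor_cat_scheme \<Rightarrow> 'o \<Rightarrow> 'o \<Rightarrow> 'o \<Rightarrow> 'o" where
  "conj_obj C V X Y = (Y \<otimes>\<^sub>o\<^bsub>C\<^esub> V) \<otimes>\<^sub>o\<^bsub>C\<^esub> ldual C X"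

definition conj_arr :: "('o, 'a, 'k, 'x) tensor_cat_scheme \<Rightarrow> 'o \<Rightarrow> 'a \<Rightarrow> 'a \<Rightarrow> 'a" where
  "conj_arr C V f g = (g \<otimes>\<^sub>a\<^bsub>C\<^esub> idt C V) \<otimes>\<^sub>a\<^bsub>C\<^esub> dual_arr C f"

definition is_Z :: "('o, 'a, 'k, 'x) tensor_cat_scheme \<Rightarrow> ('o \<Rightarrow> 'o) \<Rightarrow> ('o \<Rightarrow> 'o \<Rightarrow> 'a) \<Rightarrow> bool" where
  "is_Z C Z pz \<longleftrightarrow> (\<forall>V \<in> obj C. is_end C C (conj_obj C V) (conj_arr C V) (Z V) (pz V))"

definition Z_map ::
  "('o, 'a, 'k, 'x) tensor_cat_scheme \<Rightarrow> ('o \<Rightarrow> 'o) \<Rightarrow> ('o \<Rightarrow> 'o \<Rightarrow> 'a) \<Rightarrow> 'a \<Rightarrow> 'a" where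
  "Z_map C Z pz g = (THE u. u \<in> Hom C (Z (src C g)) (Z (tgt C g)) \<and>
     (\<forall>X \<in> obj C. pz (tgt C g) X \<bullet>\<^bsub>C\<^esub> u =
        ((idt C X \<otimes>\<^sub>a\<^bsub>C\<^esub> g) \<otimes>\<^sub>a\<^bsub>C\<^esub> idt C (ldual C X)) \<bullet>\<^bsub>C\<^esub> pz (src C g) X))"

context
  fixes C :: "('c, 'e, 'k, 'x) tensor_cat_scheme" (structure)
    and M :: "('c, 'e, 'o, 'a, 'k, 'y) mod_cat_scheme"
    and ih :: "'o \<Rightarrow> 'o \<Rightarrow> 'c" and ie :: "'o \<Rightarrow> 'o \<Rightarrow> 'a"
    and A :: "'c" and p :: "'o \<Rightarrow> 'e"
begin

definition half_braid :: "'c \<Rightarrow> 'e" where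
  "half_braid X = (THE s. s \<in> Hom C (A \<otimes>\<^sub>o X) (X \<otimes>\<^sub>o A) \<and>
     (\<forall>N \<in> obj M. ihom_a C M ih ie X N N \<bullet> (idt C X \<otimes>\<^sub>a p N) \<bullet> s =
        ihom_b C M ih ie X N (X \<rhd>\<^sub>o\<^bsub>M\<^esub> N) \<bullet> (p (X \<rhd>\<^sub>o\<^bsub>M\<^esub> N) \<otimes>\<^sub>a idt C X)))"

definition delta :: "('c \<Rightarrow> 'c) \<Rightarrow> ('c \<Rightarrow> 'c \<Rightarrow> 'e) \<Rightarrow> 'e" where
  "delta Z pz = (THE d. d \<in> Hom C A (Z A) \<and>
     (\<forall>X \<in> obj C. pz A X \<bullet> d =
        (half_braid X \<otimes>\<^sub>a idt C (ldual C X)) \<bullet> inv_arr C (asc C A X (ldual C X))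
          \<bullet> (idt C A \<otimes>\<^sub>a lcoev C X) \<bullet> inv_arr C (run C A)))"

definition star :: "('c \<Rightarrow> 'c) \<Rightarrow> ('c \<Rightarrow> 'c \<Rightarrow> 'e) \<Rightarrow> 'e \<Rightarrow> 'e \<Rightarrow> 'e" where
  "star Z pz f g = f \<bullet> Z_map C Z pz g \<bullet> delta Z pz"

end

definition CF_space :: "('o, 'a, 'k, 'x) tensor_cat_scheme \<Rightarrow> 'o \<Rightarrow> ('k, 'a) module" where
  "CF_space C A = hom_space C A \<one>\<^sub>o\<^bsub>C\<^esub>"

text \<open>For the regular module category, \<open>[X, Y] = Y \<otimes> X\<^sup>*\<close> and \<open>A = Z \<one>\<close>.\<close>

definition regular_ihom :: "('o, 'a, 'k, 'x) tensor_cat_scheme \<Rightarrow> 'o \<Rightarrow> 'o \<Rightarrow> 'o" where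
  "regular_ihom C X Y = Y \<otimes>\<^sub>o\<^bsub>C\<^esub> ldual C X"

definition regular_iev :: "('o, 'a, 'k, 'x) tensor_cat_scheme \<Rightarrow> 'o \<Rightarrow> 'o \<Rightarrow> 'a" where
  "regular_iev C X Y =
     run C Y \<bullet>\<^bsub>C\<^esub> (idt C Y \<otimes>\<^sub>a\<^bsub>C\<^esub> lev C X) \<bullet>\<^bsub>C\<^esub> asc C Y (ldual C X) X"

definition regular_proj :: "('o, 'a, 'k, 'x) tensor_cat_scheme \<Rightarrow> ('o \<Rightarrow> 'o \<Rightarrow> 'a) \<Rightarrow> 'o \<Rightarrow> 'a" where
  "regular_proj C pz X = (run C X \<otimes>\<^sub>a\<^bsub>C\<^esub> idt C (ldual C X)) \<bullet>\<^bsub>C\<^esub> pz \<one>\<^sub>o\<^bsub>C\<^esub> X"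

text \<open>The unit is the projection \<open>Z \<one> \<rightarrow> \<one> \<otimes> \<one>\<^sup>*\<close> followed by the canonical isomorphism
  \<open>\<one> \<otimes> \<one>\<^sup>* \<rightarrow> \<one>\<^sup>* \<rightarrow> \<one>\<^sup>* \<otimes> \<one> \<rightarrow> \<one>\<close>.\<close>

definition CF_algebra ::
  "('o, 'a, 'k, 'x) tensor_cat_scheme \<Rightarrow> ('o \<Rightarrow> 'o) \<Rightarrow> ('o \<Rightarrow> 'o \<Rightarrow> 'a) \<Rightarrow> ('k, 'a) module" where
  "CF_algebra C Z pz = (CF_space C (Z \<one>\<^sub>o\<^bsub>C\<^esub>))
    \<lparr>monoid.mult := star C (regular_module C) (regular_ihom C) (regular_iev C)
       (Z \<one>\<^sub>o\<^bsub>C\<^esub>) (regular_proj C pz) Z pz,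
     one := lev C \<one>\<^sub>o\<^bsub>C\<^esub> \<bullet>\<^bsub>C\<^esub> inv_arr C (run C (ldual C \<one>\<^sub>o\<^bsub>C\<^esub>)) \<bullet>\<^bsub>C\<^esub> lun C (ldual C \<one>\<^sub>o\<^bsub>C\<^esub>)
       \<bullet>\<^bsub>C\<^esub> regular_proj C pz \<one>\<^sub>o\<^bsub>C\<^esub>\<rparr>"

end

theory Submission
  imports Defs
begin

text \<open>The idea is to replace every morphism into an end by the natural family that represents it.
The family \<open>ev N = ie N N \<circ> (p N \<rhd> N) : A \<rhd> N \<rightarrow> N\<close> is natural in \<open>N\<close>, and the
universal property of \<open>A\<close> becomes: composition with \<open>ev\<close> identifies the morphisms \<open>B \<rightarrow> A\<close>
with the natural families \<open>B \<rhd> N \<rightarrow> N\<close>. Likewise morphisms \<open>B \<rightarrow> Z V\<close> are natural families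
\<open>B \<otimes> X \<rightarrow> X \<otimes> V\<close>, through the universal family \<open>swap V X : Z V \<otimes> X \<rightarrow> X \<otimes> V\<close>
that is the transpose of \<open>pz V X\<close> under the duality of \<open>X\<close> and \<open>X\<^sup>*\<close>. In particular \<open>Z \<one>\<close>, with
\<open>unit_swap X : Z \<one> \<otimes> X \<rightarrow> X\<close>, is the instance of \<open>A\<close> for the regular module category.

In these terms the half-braiding \<open>\<sigma>\<close> of \<open>A\<close> is the morphism for which acting on \<open>N\<close> after
\<open>\<sigma> X\<close> is the action on \<open>X \<rhd> N\<close> (lemma \<open>half_braid_ev\<close>). Since morphisms into \<open>X \<otimes> A\<close>
are again determined by their action on all \<open>N\<close> (\<open>tensor_ev_cancel\<close>, by duality), naturality of
\<open>\<sigma>\<close>, its hexagon and its value at \<open>\<one>\<close> follow by comparing actions.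

A class function \<open>h : A \<rightarrow> \<one>\<close> has a lift \<open>lift h = Z(h) \<circ> \<delta> : A \<rightarrow> Z \<one>\<close>, represented by the
family \<open>X \<mapsto> (X \<otimes> h) \<circ> \<sigma> X\<close>, and \<open>f \<star> h = f \<circ> lift h\<close>. The hexagon makes \<open>lift h\<close> commute
with the half-braidings of \<open>A\<close> and \<open>Z \<one>\<close> (\<open>lift_central\<close>): it is the map induced by \<open>h\<close>
on the Drinfeld center, where \<open>Z \<one>\<close> is cofree on \<open>\<one>\<close>. Hence
\<open>lift (g \<circ> lift h) = lift g \<circ> lift h\<close>, which is associativity of \<open>\<star>\<close>. The unit laws come
from the value of \<open>\<sigma>\<close> at \<open>\<one>\<close> and from the fact that the unit of the algebra lifts to the identity of
\<open>Z \<one>\<close>. The algebra axioms for \<open>CF(C)\<close> are the same statements for the regular module category.\<close>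

section \<open>Calculating with arrows\<close>

text \<open>Typing conditions are phrased with \<open>src\<close> and \<open>tgt\<close> so that the simplifier can discharge them:
composites are normalised to the right, and the equations used for rewriting come in two forms, the
second one (\<open>THEN cmp_extend\<close>) acting inside such a composite.\<close>

context linear_category
begin

lemma HomI: "\<lbrakk>f \<in> arr C; src C f = X; tgt C f = Y\<rbrakk> \<Longrightarrow> f \<in> Hom C X Y"
  by (simp add: Hom_def)

lemma idt_arr [simp]:
  assumes "X \<in> obj C"
  shows "idt C X \<in> arr C" "src C (idt C X) = X" "tgt C (idt C X) = X"
  using idt_hom[OF assms] by (auto simp: Hom_def)

lemma src_tgt_obj [simp]: "f \<in> arr C \<Longrightarrow> src C f \<in> obj C" "f \<in> arr C \<Longrightarrow> tgt C f \<in> obj C"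
  by (auto simp: src_obj tgt_obj)

lemma cmp_arr [simp]:
  assumes "g \<in> arr C" "f \<in> arr C" "src C g = tgt C f"
  shows "g \<bullet> f \<in> arr C" "src C (g \<bullet> f) = src C f" "tgt C (g \<bullet> f) = tgt C g"
  using cmp_hom[of g "tgt C f" "tgt C g" f "src C f"] assms by (auto simp: Hom_def)

lemma cmp_idt_right [simp]: "\<lbrakk>f \<in> arr C; src C f = X\<rbrakk> \<Longrightarrow> f \<bullet> idt C X = f"
  by (rule cmp_idt) (simp add: Hom_def)

lemma cmp_idt_left [simp]: "\<lbrakk>f \<in> arr C; tgt C f = X\<rbrakk> \<Longrightarrow> idt C X \<bullet> f = f"
  by (rule idt_cmp) (simp add: Hom_def)

lemma cmp_assoc_arr [simp]:
  "\<lbrakk>h \<in> arr C; g \<in> arr C; f \<in> arr C; src C h = tgt C g; src C g = tgt C f\<rbrakk>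
   \<Longrightarrow> (h \<bullet> g) \<bullet> f = h \<bullet> g \<bullet> f"
  by (rule cmp_assoc) (auto simp: Hom_def)

lemma cmp_extend:
  "\<lbrakk>g \<bullet> f = k; w \<in> arr C; g \<in> arr C; f \<in> arr C; src C g = tgt C f; src C f = tgt C w\<rbrakk>
   \<Longrightarrow> g \<bullet> f \<bullet> w = k \<bullet> w"
  using cmp_assoc_arr[of g f w] by simp

lemma inv_arr_props:
  assumes "iso_arr C f"
  shows "inv_arr C f \<in> Hom C (tgt C f) (src C f)"
    and "inv_arr C f \<bullet> f = idt C (src C f)"
    and "f \<bullet> inv_arr C f = idt C (tgt C f)"
proof -
  obtain g where g: "f \<in> arr C" "g \<in> Hom C (tgt C f) (src C f)"
      "g \<bullet> f = idt C (src C f)" "f \<bullet> g = idt C (tgt C f)"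
    using assms unfolding iso_arr_def by blast
  have uniq: "h = g" if h: "h \<in> Hom C (tgt C f) (src C f)" "h \<bullet> f = idt C (src C f)" for h
  proof -
    have arrs: "g \<in> arr C" "h \<in> arr C" "src C g = tgt C f" "src C h = tgt C f" "tgt C h = src C f"
      "tgt C g = src C f" using g h by (auto simp: Hom_def)
    have "h = h \<bullet> f \<bullet> g" using arrs by (simp add: g(4))
    also have "\<dots> = (h \<bullet> f) \<bullet> g" using arrs g(1) by simp
    also have "\<dots> = g" using arrs by (simp add: h(2))
    finally show ?thesis .
  qed
  have "inv_arr C f = g"
    unfolding inv_arr_def by (rule the_equality) (use g uniq in blast)+
  then show "inv_arr C f \<in> Hom C (tgt C f) (src C f)"
    and "inv_arr C f \<bullet> f = idt C (src C f)" and "f \<bullet> inv_arr C f = idt C (tgt C f)"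
    by (simp_all only: g)
qed

lemma inv_arr_arr [simp]:
  assumes "iso_arr C f"
  shows "inv_arr C f \<in> arr C" "src C (inv_arr C f) = tgt C f" "tgt C (inv_arr C f) = src C f"
  using inv_arr_props(1)[OF assms] by (auto simp: Hom_def)

lemma iso_in_arr: "iso_arr C f \<Longrightarrow> f \<in> arr C"
  by (simp add: iso_arr_def)

lemma inv_arr_cancel [simp]:
  assumes "iso_arr C f"
  shows "inv_arr C f \<bullet> f = idt C (src C f)"
    and "f \<bullet> inv_arr C f = idt C (tgt C f)"
  by (rule inv_arr_props[OF assms])+

lemma inv_arr_cancel_extend [simp]:
  assumes f: "iso_arr C f" and w: "w \<in> arr C"
  shows "tgt C w = src C f \<Longrightarrow> inv_arr C f \<bullet> f \<bullet> w = w"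
    and "tgt C w = tgt C f \<Longrightarrow> f \<bullet> inv_arr C f \<bullet> w = w"
proof -
  show "inv_arr C f \<bullet> f \<bullet> w = w" if "tgt C w = src C f"
    by (rule trans[OF cmp_extend[OF inv_arr_cancel(1)[OF f] w]])
       (use f w that iso_in_arr[OF f] in simp_all)
  show "f \<bullet> inv_arr C f \<bullet> w = w" if "tgt C w = tgt C f"
    by (rule trans[OF cmp_extend[OF inv_arr_cancel(2)[OF f] w]])
       (use f w that iso_in_arr[OF f] in simp_all)
qed

lemma iso_epi:
  assumes f: "iso_arr C f" and eq: "g \<bullet> f = h \<bullet> f"
    and gh: "g \<in> arr C" "h \<in> arr C" "src C g = tgt C f" "src C h = tgt C f"
  shows "g = h"
proof -
  have "(g \<bullet> f) \<bullet> inv_arr C f = (h \<bullet> f) \<bullet> inv_arr C f" by (simp only: eq)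
  then show ?thesis using f gh iso_in_arr[OF f] by simp
qed

lemma iso_mono:
  assumes f: "iso_arr C f" and eq: "f \<bullet> g = f \<bullet> h"
    and gh: "g \<in> arr C" "h \<in> arr C" "tgt C g = src C f" "tgt C h = src C f"
  shows "g = h"
proof -
  have "inv_arr C f \<bullet> f \<bullet> g = inv_arr C f \<bullet> f \<bullet> h" by (simp only: eq)
  then show ?thesis using f gh iso_in_arr[OF f] by simp
qed

lemma iso_cmp [simp]:
  assumes g: "iso_arr C g" and f: "iso_arr C f" and gf: "src C g = tgt C f"
  shows "iso_arr C (g \<bullet> f)"
proof -
  have arr: "g \<in> arr C" "f \<in> arr C" using g f by (auto dest: iso_in_arr)
  let ?h = "inv_arr C f \<bullet> inv_arr C g"
  have "?h \<in> Hom C (tgt C (g \<bullet> f)) (src C (g \<bullet> f))"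
    by (rule HomI) (use g f gf arr in simp_all)
  moreover have "?h \<bullet> g \<bullet> f = idt C (src C (g \<bullet> f))" "(g \<bullet> f) \<bullet> ?h = idt C (tgt C (g \<bullet> f))"
    using g f gf gf[symmetric] arr by simp_all
  ultimately show ?thesis
    unfolding iso_arr_def using cmp_arr(1)[OF arr gf] by blast
qed

lemma iso_idt [simp]:
  assumes "X \<in> obj C"
  shows "iso_arr C (idt C X)" "inv_arr C (idt C X) = idt C X"
proof -
  show iso: "iso_arr C (idt C X)"
    unfolding iso_arr_def by (auto intro!: bexI[of _ "idt C X"] HomI simp: assms)
  show "inv_arr C (idt C X) = idt C X"
    using inv_arr_cancel(1)[OF iso] assms inv_arr_arr[OF iso] by simp
qed

text \<open>With \<open>f'\<close> or \<open>f\<close> an identity this moves an isomorphism across an equation; with both structural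
isomorphisms it turns naturality of a constraint into naturality of its inverse.\<close>

lemma inv_transpose:
  assumes f: "iso_arr C f" and f': "iso_arr C f'" and eq: "f' \<bullet> g = h \<bullet> f"
    and gh: "g \<in> arr C" "h \<in> arr C"
    "src C g = src C f" "tgt C g = src C f'" "src C h = tgt C f" "tgt C h = tgt C f'"
  shows "g \<bullet> inv_arr C f = inv_arr C f' \<bullet> h"
proof -
  have "inv_arr C f' \<bullet> (f' \<bullet> g) \<bullet> inv_arr C f = inv_arr C f' \<bullet> (h \<bullet> f) \<bullet> inv_arr C f"
    by (simp only: eq)
  then show ?thesis using f f' gh iso_in_arr[OF f] iso_in_arr[OF f'] by simp
qed

end

context bilinear_bifunctor
begin

lemma bi_arr [simp]:
  assumes "f \<in> arr B" "g \<in> arr C"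
  shows "TA f g \<in> arr D" "src D (TA f g) = TO (src B f) (src C g)"
    "tgt D (TA f g) = TO (tgt B f) (tgt C g)"
  using bi_hom[of f "src B f" "tgt B f" g "src C g" "tgt C g"] assms by (auto simp: Hom_def)

lemmas [simp] = bi_obj bi_idt

lemma merge:
  "\<lbrakk>f' \<in> arr B; f \<in> arr B; src B f' = tgt B f; g' \<in> arr C; g \<in> arr C; src C g' = tgt C g\<rbrakk>
   \<Longrightarrow> TA f' g' \<bullet>\<^bsub>D\<^esub> TA f g = TA (f' \<bullet>\<^bsub>B\<^esub> f) (g' \<bullet>\<^bsub>C\<^esub> g)"
  by (rule bi_cmp[symmetric]) (auto simp: Hom_def)

end

text \<open>The rules \<open>merge\<close> and \<open>merge_extend\<close> rewrite a composite of two values of the bifunctor into one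
value. Expressions that differ by functoriality or by the interchange law get the same normal form.\<close>

locale bifunctor = bilinear_bifunctor K B C D TO TA + B: linear_category K B
  + C: linear_category K C + D: linear_category K D
  for K :: "('k, 'r) ring_scheme" 
    and B :: "('n, 'b, 'k, 'x) lin_cat_scheme"
    and C :: "('o, 'a, 'k, 'y) lin_cat_scheme"
    and D :: "('p, 'd, 'k, 'z) lin_cat_scheme"
    and TO :: "'n \<Rightarrow> 'o \<Rightarrow> 'p" and TA :: "'b \<Rightarrow> 'a \<Rightarrow> 'd"
begin

lemma merge_extend:
  "\<lbrakk>f' \<in> arr B; f \<in> arr B; src B f' = tgt B f; g' \<in> arr C; g \<in> arr C; src C g' = tgt C g;
    w \<in> arr D; tgt D w = TO (src B f) (src C g)\<rbrakk>
   \<Longrightarrow> TA f' g' \<bullet>\<^bsub>D\<^esub> TA f g \<bullet>\<^bsub>D\<^esub> w = TA (f' \<bullet>\<^bsub>B\<^esub> f) (g' \<bullet>\<^bsub>C\<^esub> g) \<bullet>\<^bsub>D\<^esub> w"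
  by (rule D.cmp_extend) (auto simp: merge)

lemma iso_bi [simp]:
  assumes f: "iso_arr B f" and g: "iso_arr C g"
  shows "iso_arr D (TA f g)" "inv_arr D (TA f g) = TA (inv_arr B f) (inv_arr C g)"
proof -
  have arr: "f \<in> arr B" "g \<in> arr C" using f g by (auto dest: B.iso_in_arr C.iso_in_arr)
  let ?h = "TA (inv_arr B f) (inv_arr C g)"
  have h: "?h \<bullet>\<^bsub>D\<^esub> TA f g = idt D (src D (TA f g))" "TA f g \<bullet>\<^bsub>D\<^esub> ?h = idt D (tgt D (TA f g))"
    using f g arr by (simp_all add: merge)
  have H: "?h \<in> Hom D (tgt D (TA f g)) (src D (TA f g))"
    by (rule D.HomI) (use f g arr in simp_all)
  show iso: "iso_arr D (TA f g)"
    unfolding iso_arr_def using bi_arr(1)[OF arr] h H by blast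
  have "inv_arr D (TA f g) \<bullet>\<^bsub>D\<^esub> TA f g = ?h \<bullet>\<^bsub>D\<^esub> TA f g"
    using D.inv_arr_cancel(1)[OF iso] h(1) by simp
  then show "inv_arr D (TA f g) = ?h"
    by (rule D.iso_epi[OF iso]) (use D.inv_arr_arr[OF iso] arr f g in simp_all)
qed

end

section \<open>Coherence and duality in a tensor category\<close>

context finite_tensor_category
begin

sublocale tensor: bifunctor K C C C "tenO C" "tenA C" ..

declare unit_obj [simp]

lemma asc_arr [simp]:
  assumes "X \<in> obj C" "Y \<in> obj C" "Z \<in> obj C"
  shows "asc C X Y Z \<in> arr C" "src C (asc C X Y Z) = (X \<otimes>\<^sub>o Y) \<otimes>\<^sub>o Z"
    "tgt C (asc C X Y Z) = X \<otimes>\<^sub>o (Y \<otimes>\<^sub>o Z)" "iso_arr C (asc C X Y Z)"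
  using asc_iso[OF assms] by (auto simp: Hom_def)

lemma lun_arr [simp]:
  assumes "X \<in> obj C"
  shows "lun C X \<in> arr C" "src C (lun C X) = \<one>\<^sub>o \<otimes>\<^sub>o X" "tgt C (lun C X) = X" "iso_arr C (lun C X)"
  using lun_natural assms by (auto simp: Hom_def natural_iso_def)

lemma run_arr [simp]:
  assumes "X \<in> obj C"
  shows "run C X \<in> arr C" "src C (run C X) = X \<otimes>\<^sub>o \<one>\<^sub>o" "tgt C (run C X) = X" "iso_arr C (run C X)"
  using run_natural assms by (auto simp: Hom_def natural_iso_def)

lemma lun_nat: "\<lbrakk>f \<in> arr C; tgt C f = Y\<rbrakk> \<Longrightarrow> lun C Y \<bullet> (idt C \<one>\<^sub>o \<otimes>\<^sub>a f) = f \<bullet> lun C (src C f)"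
  using lun_natural by (auto simp: natural_iso_def)

lemma run_nat: "\<lbrakk>f \<in> arr C; tgt C f = Y\<rbrakk> \<Longrightarrow> run C Y \<bullet> (f \<otimes>\<^sub>a idt C \<one>\<^sub>o) = f \<bullet> run C (src C f)"
  using run_natural by (auto simp: natural_iso_def)

lemma asc_nat:
  "\<lbrakk>f \<in> arr C; g \<in> arr C; h \<in> arr C; tgt C f = X; tgt C g = Y; tgt C h = Z\<rbrakk>
   \<Longrightarrow> asc C X Y Z \<bullet> ((f \<otimes>\<^sub>a g) \<otimes>\<^sub>a h) = (f \<otimes>\<^sub>a (g \<otimes>\<^sub>a h)) \<bullet> asc C (src C f) (src C g) (src C h)"
  by (rule asc_natural) (auto simp: Hom_def)

lemma asc_nat_right:
  "\<lbrakk>X \<in> obj C; Y \<in> obj C; h \<in> arr C; tgt C h = Z\<rbrakk>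
   \<Longrightarrow> asc C X Y Z \<bullet> (idt C (X \<otimes>\<^sub>o Y) \<otimes>\<^sub>a h) = (idt C X \<otimes>\<^sub>a (idt C Y \<otimes>\<^sub>a h)) \<bullet> asc C X Y (src C h)"
  using asc_nat[of "idt C X" "idt C Y" h X Y Z] by simp

lemma lun_inv_nat:
  "\<lbrakk>f \<in> arr C; tgt C f = Y\<rbrakk> \<Longrightarrow> inv_arr C (lun C Y) \<bullet> f = (idt C \<one>\<^sub>o \<otimes>\<^sub>a f) \<bullet> inv_arr C (lun C (src C f))"
  by (rule inv_transpose[symmetric]) (auto simp: lun_nat)

lemma run_inv_nat:
  "\<lbrakk>f \<in> arr C; tgt C f = Y\<rbrakk> \<Longrightarrow> inv_arr C (run C Y) \<bullet> f = (f \<otimes>\<^sub>a idt C \<one>\<^sub>o) \<bullet> inv_arr C (run C (src C f))"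
  by (rule inv_transpose[symmetric]) (auto simp: run_nat)

lemma asc_inv_nat:
  "\<lbrakk>f \<in> arr C; g \<in> arr C; h \<in> arr C; tgt C f = X; tgt C g = Y; tgt C h = Z\<rbrakk>
   \<Longrightarrow> inv_arr C (asc C X Y Z) \<bullet> (f \<otimes>\<^sub>a (g \<otimes>\<^sub>a h)) =
     ((f \<otimes>\<^sub>a g) \<otimes>\<^sub>a h) \<bullet> inv_arr C (asc C (src C f) (src C g) (src C h))"
  by (rule inv_transpose[symmetric]) (auto simp: asc_nat)

lemma asc_inv_nat_left:
  "\<lbrakk>Y \<in> obj C; Z \<in> obj C; f \<in> arr C; tgt C f = X\<rbrakk>
   \<Longrightarrow> inv_arr C (asc C X Y Z) \<bullet> (f \<otimes>\<^sub>a idt C (Y \<otimes>\<^sub>o Z)) =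
      ((f \<otimes>\<^sub>a idt C Y) \<otimes>\<^sub>a idt C Z) \<bullet> inv_arr C (asc C (src C f) Y Z)"
  using asc_inv_nat[of f "idt C Y" "idt C Z" X Y Z] by simp

lemmas nat_tensor = lun_nat lun_nat[THEN cmp_extend] run_nat run_nat[THEN cmp_extend]
  asc_nat asc_nat[THEN cmp_extend] asc_nat_right asc_nat_right[THEN cmp_extend]

lemmas merge_tensor = tensor.merge tensor.merge_extend

lemma run_faithful:
  assumes "f \<otimes>\<^sub>a idt C \<one>\<^sub>o = g \<otimes>\<^sub>a idt C \<one>\<^sub>o" "f \<in> arr C" "g \<in> arr C" "src C f = src C g" "tgt C f = tgt C g"
  shows "f = g"
proof (rule iso_epi)
  show "f \<bullet> run C (src C f) = g \<bullet> run C (src C f)"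
    using run_nat[of f] run_nat[of g] assms by simp
qed (use assms in auto)

text \<open>The mirror image of Kelly's coherence lemma. Tensoring with \<open>\<one>\<close> on the right is faithful, and after
that and after composition with an associator the claim is the pentagon for \<open>X, Y, \<one>, \<one>\<close> combined
with three triangles.\<close>

lemma run_tensor:
  assumes [simp]: "X \<in> obj C" "Y \<in> obj C"
  shows "(idt C X \<otimes>\<^sub>a run C Y) \<bullet> asc C X Y \<one>\<^sub>o = run C (X \<otimes>\<^sub>o Y)"
proof (rule run_faithful)
  show "((idt C X \<otimes>\<^sub>a run C Y) \<bullet> asc C X Y \<one>\<^sub>o) \<otimes>\<^sub>a idt C \<one>\<^sub>o = run C (X \<otimes>\<^sub>o Y) \<otimes>\<^sub>a idt C \<one>\<^sub>o"
  proof (rule iso_mono)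
    have "asc C X Y \<one>\<^sub>o \<bullet> (((idt C X \<otimes>\<^sub>a run C Y) \<bullet> asc C X Y \<one>\<^sub>o) \<otimes>\<^sub>a idt C \<one>\<^sub>o)
      = asc C X Y \<one>\<^sub>o \<bullet> ((idt C X \<otimes>\<^sub>a run C Y) \<otimes>\<^sub>a idt C \<one>\<^sub>o) \<bullet> (asc C X Y \<one>\<^sub>o \<otimes>\<^sub>a idt C \<one>\<^sub>o)"
      by (simp add: merge_tensor)
    also have "\<dots> = (idt C X \<otimes>\<^sub>a (run C Y \<otimes>\<^sub>a idt C \<one>\<^sub>o)) \<bullet> asc C X (Y \<otimes>\<^sub>o \<one>\<^sub>o) \<one>\<^sub>o \<bullet> (asc C X Y \<one>\<^sub>o \<otimes>\<^sub>a idt C \<one>\<^sub>o)"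
      by (simp add: nat_tensor)
    also have "\<dots> = (idt C X \<otimes>\<^sub>a (idt C Y \<otimes>\<^sub>a lun C \<one>\<^sub>o)) \<bullet> (idt C X \<otimes>\<^sub>a asc C Y \<one>\<^sub>o \<one>\<^sub>o)
        \<bullet> asc C X (Y \<otimes>\<^sub>o \<one>\<^sub>o) \<one>\<^sub>o \<bullet> (asc C X Y \<one>\<^sub>o \<otimes>\<^sub>a idt C \<one>\<^sub>o)"
      by (simp add: merge_tensor triangle)
    also have "\<dots> = (idt C X \<otimes>\<^sub>a (idt C Y \<otimes>\<^sub>a lun C \<one>\<^sub>o)) \<bullet> asc C X Y (\<one>\<^sub>o \<otimes>\<^sub>o \<one>\<^sub>o) \<bullet> asc C (X \<otimes>\<^sub>o Y) \<one>\<^sub>o \<one>\<^sub>o"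
      by (simp add: pentagon)
    also have "\<dots> = asc C X Y \<one>\<^sub>o \<bullet> (idt C (X \<otimes>\<^sub>o Y) \<otimes>\<^sub>a lun C \<one>\<^sub>o) \<bullet> asc C (X \<otimes>\<^sub>o Y) \<one>\<^sub>o \<one>\<^sub>o"
      by (simp add: nat_tensor)
    also have "\<dots> = asc C X Y \<one>\<^sub>o \<bullet> (run C (X \<otimes>\<^sub>o Y) \<otimes>\<^sub>a idt C \<one>\<^sub>o)"
      by (simp add: triangle)
    finally show "asc C X Y \<one>\<^sub>o \<bullet> (((idt C X \<otimes>\<^sub>a run C Y) \<bullet> asc C X Y \<one>\<^sub>o) \<otimes>\<^sub>a idt C \<one>\<^sub>o)
      = asc C X Y \<one>\<^sub>o \<bullet> (run C (X \<otimes>\<^sub>o Y) \<otimes>\<^sub>a idt C \<one>\<^sub>o)" .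
  qed simp_all
qed simp_all

lemma dual_obj [simp]: "X \<in> obj C \<Longrightarrow> ldual C X \<in> obj C"
  using left_dual by (simp add: is_left_dual_def)

lemma lev_arr [simp]:
  assumes "X \<in> obj C"
  shows "lev C X \<in> arr C" "src C (lev C X) = ldual C X \<otimes>\<^sub>o X" "tgt C (lev C X) = \<one>\<^sub>o"
  using left_dual[OF assms] by (auto simp: is_left_dual_def Hom_def)

lemma lcoev_arr [simp]:
  assumes "X \<in> obj C"
  shows "lcoev C X \<in> arr C" "src C (lcoev C X) = \<one>\<^sub>o" "tgt C (lcoev C X) = X \<otimes>\<^sub>o ldual C X"
  using left_dual[OF assms] by (auto simp: is_left_dual_def Hom_def)

lemma zigzag:
  assumes "X \<in> obj C"
  shows "run C X \<bullet> (idt C X \<otimes>\<^sub>a lev C X) \<bullet> asc C X (ldual C X) X \<bullet> (lcoev C X \<otimes>\<^sub>a idt C X)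
      \<bullet> inv_arr C (lun C X) = idt C X"
    and "lun C (ldual C X) \<bullet> (lev C X \<otimes>\<^sub>a idt C (ldual C X)) \<bullet> inv_arr C (asc C (ldual C X) X (ldual C X))
      \<bullet> (idt C (ldual C X) \<otimes>\<^sub>a lcoev C X) \<bullet> inv_arr C (run C (ldual C X)) = idt C (ldual C X)"
  using left_dual[OF assms] by (auto simp: is_left_dual_def)

text \<open>The pentagon is needed in two shapes in which some associators stand inverted on the other side; they
are the ones that occur in the two triangle identities below.\<close>

lemma pentagon_inv_left:
  assumes [simp]: "W \<in> obj C" "X \<in> obj C" "Y \<in> obj C" "Z \<in> obj C"
  shows "asc C (W \<otimes>\<^sub>o X) Y Z \<bullet> (inv_arr C (asc C W X Y) \<otimes>\<^sub>a idt C Z) =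
    inv_arr C (asc C W X (Y \<otimes>\<^sub>o Z)) \<bullet> (idt C W \<otimes>\<^sub>a asc C X Y Z) \<bullet> asc C W (X \<otimes>\<^sub>o Y) Z"
proof (rule iso_mono[of "asc C W X (Y \<otimes>\<^sub>o Z)"])
  have "asc C W X (Y \<otimes>\<^sub>o Z) \<bullet> asc C (W \<otimes>\<^sub>o X) Y Z \<bullet> (inv_arr C (asc C W X Y) \<otimes>\<^sub>a idt C Z)
    = (idt C W \<otimes>\<^sub>a asc C X Y Z) \<bullet> asc C W (X \<otimes>\<^sub>o Y) Z \<bullet> (asc C W X Y \<otimes>\<^sub>a idt C Z) \<bullet>
      (inv_arr C (asc C W X Y) \<otimes>\<^sub>a idt C Z)"
    by (simp add: pentagon[THEN cmp_extend])
  then show "asc C W X (Y \<otimes>\<^sub>o Z) \<bullet> asc C (W \<otimes>\<^sub>o X) Y Z \<bullet> (inv_arr C (asc C W X Y) \<otimes>\<^sub>a idt C Z) =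
     asc C W X (Y \<otimes>\<^sub>o Z) \<bullet> inv_arr C (asc C W X (Y \<otimes>\<^sub>o Z)) \<bullet> (idt C W \<otimes>\<^sub>a asc C X Y Z) \<bullet> asc C W (X \<otimes>\<^sub>o Y) Z"
    by (simp add: merge_tensor)
qed simp_all

lemma pentagon_inv_right:
  assumes [simp]: "W \<in> obj C" "X \<in> obj C" "Y \<in> obj C" "Z \<in> obj C"
  shows "(asc C W X Y \<otimes>\<^sub>a idt C Z) \<bullet> inv_arr C (asc C (W \<otimes>\<^sub>o X) Y Z) =
    inv_arr C (asc C W (X \<otimes>\<^sub>o Y) Z) \<bullet> (idt C W \<otimes>\<^sub>a inv_arr C (asc C X Y Z)) \<bullet> asc C W X (Y \<otimes>\<^sub>o Z)"
proof (rule iso_epi[of "asc C (W \<otimes>\<^sub>o X) Y Z"])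
  have "inv_arr C (asc C W (X \<otimes>\<^sub>o Y) Z) \<bullet> (idt C W \<otimes>\<^sub>a inv_arr C (asc C X Y Z)) \<bullet> asc C W X (Y \<otimes>\<^sub>o Z)
      \<bullet> asc C (W \<otimes>\<^sub>o X) Y Z = asc C W X Y \<otimes>\<^sub>a idt C Z"
    by (simp add: pentagon merge_tensor)
  then show "((asc C W X Y \<otimes>\<^sub>a idt C Z) \<bullet> inv_arr C (asc C (W \<otimes>\<^sub>o X) Y Z)) \<bullet> asc C (W \<otimes>\<^sub>o X) Y Z =
    (inv_arr C (asc C W (X \<otimes>\<^sub>o Y) Z) \<bullet> (idt C W \<otimes>\<^sub>a inv_arr C (asc C X Y Z)) \<bullet> asc C W X (Y \<otimes>\<^sub>o Z))
      \<bullet> asc C (W \<otimes>\<^sub>o X) Y Z"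
    by simp
qed simp_all

lemma asc_triangle_inv:
  assumes [simp]: "X \<in> obj C" "Y \<in> obj C"
  shows "(run C X \<otimes>\<^sub>a idt C Y) \<bullet> inv_arr C (asc C X \<one>\<^sub>o Y) = idt C X \<otimes>\<^sub>a lun C Y"
    and "asc C X \<one>\<^sub>o Y \<bullet> (inv_arr C (run C X) \<otimes>\<^sub>a idt C Y) = idt C X \<otimes>\<^sub>a inv_arr C (lun C Y)"
proof -
  show "(run C X \<otimes>\<^sub>a idt C Y) \<bullet> inv_arr C (asc C X \<one>\<^sub>o Y) = idt C X \<otimes>\<^sub>a lun C Y"
    by (simp add: triangle[symmetric])
  show "asc C X \<one>\<^sub>o Y \<bullet> (inv_arr C (run C X) \<otimes>\<^sub>a idt C Y) = idt C X \<otimes>\<^sub>a inv_arr C (lun C Y)"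
    using inv_transpose[of "run C X \<otimes>\<^sub>a idt C Y" "idt C X \<otimes>\<^sub>a lun C Y" "asc C X \<one>\<^sub>o Y" "idt C (X \<otimes>\<^sub>o Y)"]
    by (simp add: triangle)
qed

lemma run_tensor_inv:
  assumes [simp]: "X \<in> obj C" "Y \<in> obj C"
  shows "run C (X \<otimes>\<^sub>o Y) \<bullet> inv_arr C (asc C X Y \<one>\<^sub>o) = idt C X \<otimes>\<^sub>a run C Y"
    and "asc C X Y \<one>\<^sub>o \<bullet> inv_arr C (run C (X \<otimes>\<^sub>o Y)) = idt C X \<otimes>\<^sub>a inv_arr C (run C Y)"
proof -
  show "run C (X \<otimes>\<^sub>o Y) \<bullet> inv_arr C (asc C X Y \<one>\<^sub>o) = idt C X \<otimes>\<^sub>a run C Y"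
    by (simp add: run_tensor[symmetric])
  show "asc C X Y \<one>\<^sub>o \<bullet> inv_arr C (run C (X \<otimes>\<^sub>o Y)) = idt C X \<otimes>\<^sub>a inv_arr C (run C Y)"
    using inv_transpose[of "run C (X \<otimes>\<^sub>o Y)" "idt C X \<otimes>\<^sub>a run C Y" "asc C X Y \<one>\<^sub>o" "idt C (X \<otimes>\<^sub>o Y)"]
    by (simp add: run_tensor)
qed

lemmas nat_tensor_inv = lun_inv_nat lun_inv_nat[THEN cmp_extend] run_inv_nat run_inv_nat[THEN cmp_extend]
  asc_inv_nat asc_inv_nat[THEN cmp_extend] asc_inv_nat_left asc_inv_nat_left[THEN cmp_extend]

text \<open>Unit of the adjunction between \<open>- \<otimes> X\<close> and \<open>- \<otimes> X\<^sup>*\<close>; its counit is \<^const>\<open>regular_iev\<close>. Transposition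
along this adjunction is called bending below, and \<open>delta\<close> is specified by such a transpose.\<close>

definition rcoev :: "'o \<Rightarrow> 'o \<Rightarrow> 'a" where
  "rcoev B X = inv_arr C (asc C B X (ldual C X)) \<bullet> (idt C B \<otimes>\<^sub>a lcoev C X) \<bullet> inv_arr C (run C B)"

lemma rcoev_arr [simp]:
  assumes "B \<in> obj C" "X \<in> obj C"
  shows "rcoev B X \<in> arr C" "src C (rcoev B X) = B" "tgt C (rcoev B X) = (B \<otimes>\<^sub>o X) \<otimes>\<^sub>o ldual C X"
  using assms by (auto simp: rcoev_def)

lemma regular_iev_arr [simp]:
  assumes "X \<in> obj C" "Y \<in> obj C"
  shows "regular_iev C X Y \<in> arr C" "src C (regular_iev C X Y) = (Y \<otimes>\<^sub>o ldual C X) \<otimes>\<^sub>o X"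
    "tgt C (regular_iev C X Y) = Y"
  using assms by (auto simp: regular_iev_def)

lemma rcoev_nat:
  assumes "f \<in> arr C" "X \<in> obj C" "tgt C f = B"
  shows "rcoev B X \<bullet> f = ((f \<otimes>\<^sub>a idt C X) \<otimes>\<^sub>a idt C (ldual C X)) \<bullet> rcoev (src C f) X"
proof -
  have [simp]: "f \<in> arr C" "X \<in> obj C" "tgt C f = B" "B \<in> obj C" using assms by auto
  have "rcoev B X \<bullet> f = inv_arr C (asc C B X (ldual C X)) \<bullet> (idt C B \<otimes>\<^sub>a lcoev C X) \<bullet> (f \<otimes>\<^sub>a idt C \<one>\<^sub>o)
      \<bullet> inv_arr C (run C (src C f))"
    by (simp add: rcoev_def nat_tensor_inv)
  also have "\<dots> = inv_arr C (asc C B X (ldual C X)) \<bullet> (f \<otimes>\<^sub>a idt C (X \<otimes>\<^sub>o ldual C X))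
      \<bullet> (idt C (src C f) \<otimes>\<^sub>a lcoev C X) \<bullet> inv_arr C (run C (src C f))"
    by (simp add: merge_tensor)
  also have "\<dots> = ((f \<otimes>\<^sub>a idt C X) \<otimes>\<^sub>a idt C (ldual C X)) \<bullet> rcoev (src C f) X"
    by (simp add: rcoev_def nat_tensor_inv)
  finally show ?thesis .
qed

lemma regular_iev_nat:
  assumes "f \<in> arr C" "X \<in> obj C" "tgt C f = Y"
  shows "regular_iev C X Y \<bullet> ((f \<otimes>\<^sub>a idt C (ldual C X)) \<otimes>\<^sub>a idt C X) = f \<bullet> regular_iev C X (src C f)"
proof -
  have [simp]: "f \<in> arr C" "X \<in> obj C" "tgt C f = Y" "Y \<in> obj C" using assms by auto
  have "regular_iev C X Y \<bullet> ((f \<otimes>\<^sub>a idt C (ldual C X)) \<otimes>\<^sub>a idt C X)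
    = run C Y \<bullet> (idt C Y \<otimes>\<^sub>a lev C X) \<bullet> (f \<otimes>\<^sub>a idt C (ldual C X \<otimes>\<^sub>o X)) \<bullet> asc C (src C f) (ldual C X) X"
    by (simp add: regular_iev_def nat_tensor)
  also have "\<dots> = run C Y \<bullet> (f \<otimes>\<^sub>a idt C \<one>\<^sub>o) \<bullet> (idt C (src C f) \<otimes>\<^sub>a lev C X) \<bullet> asc C (src C f) (ldual C X) X"
    by (simp add: merge_tensor)
  also have "\<dots> = f \<bullet> regular_iev C X (src C f)"
    by (simp add: regular_iev_def nat_tensor)
  finally show ?thesis .
qed

text \<open>The first triangle identity. The pentagon collects everything under \<open>B \<otimes> -\<close>, where the zigzag of the
left dual remains.\<close>

lemma regular_iev_rcoev:
  assumes [simp]: "B \<in> obj C" "X \<in> obj C"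
  shows "regular_iev C X (B \<otimes>\<^sub>o X) \<bullet> (rcoev B X \<otimes>\<^sub>a idt C X) = idt C (B \<otimes>\<^sub>o X)"
proof -
  let ?D = "ldual C X"
  have "regular_iev C X (B \<otimes>\<^sub>o X) \<bullet> (rcoev B X \<otimes>\<^sub>a idt C X)
    = run C (B \<otimes>\<^sub>o X) \<bullet> (idt C (B \<otimes>\<^sub>o X) \<otimes>\<^sub>a lev C X) \<bullet> asc C (B \<otimes>\<^sub>o X) ?D X
      \<bullet> (inv_arr C (asc C B X ?D) \<otimes>\<^sub>a idt C X) \<bullet> ((idt C B \<otimes>\<^sub>a lcoev C X) \<otimes>\<^sub>a idt C X) \<bullet> (inv_arr C (run C B) \<otimes>\<^sub>a idt C X)"
    by (simp add: regular_iev_def rcoev_def merge_tensor)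
  also have "\<dots> = run C (B \<otimes>\<^sub>o X) \<bullet> (idt C (B \<otimes>\<^sub>o X) \<otimes>\<^sub>a lev C X) \<bullet> inv_arr C (asc C B X (?D \<otimes>\<^sub>o X))
      \<bullet> (idt C B \<otimes>\<^sub>a asc C X ?D X) \<bullet> asc C B (X \<otimes>\<^sub>o ?D) X \<bullet> ((idt C B \<otimes>\<^sub>a lcoev C X) \<otimes>\<^sub>a idt C X)
      \<bullet> (inv_arr C (run C B) \<otimes>\<^sub>a idt C X)"
    by (simp add: pentagon_inv_left[THEN cmp_extend])
  also have "\<dots> = run C (B \<otimes>\<^sub>o X) \<bullet> inv_arr C (asc C B X \<one>\<^sub>o) \<bullet> (idt C B \<otimes>\<^sub>a (idt C X \<otimes>\<^sub>a lev C X))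
      \<bullet> (idt C B \<otimes>\<^sub>a asc C X ?D X) \<bullet> (idt C B \<otimes>\<^sub>a (lcoev C X \<otimes>\<^sub>a idt C X)) \<bullet> asc C B \<one>\<^sub>o X
      \<bullet> (inv_arr C (run C B) \<otimes>\<^sub>a idt C X)"
    by (simp add: nat_tensor nat_tensor_inv)
  also have "\<dots> = (idt C B \<otimes>\<^sub>a run C X) \<bullet> (idt C B \<otimes>\<^sub>a (idt C X \<otimes>\<^sub>a lev C X))
      \<bullet> (idt C B \<otimes>\<^sub>a asc C X ?D X) \<bullet> (idt C B \<otimes>\<^sub>a (lcoev C X \<otimes>\<^sub>a idt C X)) \<bullet> (idt C B \<otimes>\<^sub>a inv_arr C (lun C X))"
    by (simp add: run_tensor_inv[THEN cmp_extend] asc_triangle_inv)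
  also have "\<dots> = idt C B \<otimes>\<^sub>a idt C X"
    by (simp add: merge_tensor zigzag del: tensor.bi_idt)
  finally show ?thesis by simp
qed

text \<open>The second triangle identity, which reduces in the same way to the other zigzag.\<close>

lemma rcoev_regular_iev:
  assumes [simp]: "Y \<in> obj C" "X \<in> obj C"
  shows "(regular_iev C X Y \<otimes>\<^sub>a idt C (ldual C X)) \<bullet> rcoev (Y \<otimes>\<^sub>o ldual C X) X = idt C (Y \<otimes>\<^sub>o ldual C X)"
proof -
  let ?D = "ldual C X"
  have "(regular_iev C X Y \<otimes>\<^sub>a idt C ?D) \<bullet> rcoev (Y \<otimes>\<^sub>o ?D) X
    = (run C Y \<otimes>\<^sub>a idt C ?D) \<bullet> ((idt C Y \<otimes>\<^sub>a lev C X) \<otimes>\<^sub>a idt C ?D) \<bullet> (asc C Y ?D X \<otimes>\<^sub>a idt C ?D)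
      \<bullet> inv_arr C (asc C (Y \<otimes>\<^sub>o ?D) X ?D) \<bullet> (idt C (Y \<otimes>\<^sub>o ?D) \<otimes>\<^sub>a lcoev C X) \<bullet> inv_arr C (run C (Y \<otimes>\<^sub>o ?D))"
    by (simp add: regular_iev_def rcoev_def merge_tensor)
  also have "\<dots> = (run C Y \<otimes>\<^sub>a idt C ?D) \<bullet> ((idt C Y \<otimes>\<^sub>a lev C X) \<otimes>\<^sub>a idt C ?D) \<bullet>
      inv_arr C (asc C Y (?D \<otimes>\<^sub>o X) ?D) \<bullet> (idt C Y \<otimes>\<^sub>a inv_arr C (asc C ?D X ?D)) \<bullet> asc C Y ?D (X \<otimes>\<^sub>o ?D)
      \<bullet> (idt C (Y \<otimes>\<^sub>o ?D) \<otimes>\<^sub>a lcoev C X) \<bullet> inv_arr C (run C (Y \<otimes>\<^sub>o ?D))"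
    by (simp add: pentagon_inv_right[THEN cmp_extend])
  also have "\<dots> = (run C Y \<otimes>\<^sub>a idt C ?D) \<bullet> inv_arr C (asc C Y \<one>\<^sub>o ?D) \<bullet> (idt C Y \<otimes>\<^sub>a (lev C X \<otimes>\<^sub>a idt C ?D)) \<bullet>
      (idt C Y \<otimes>\<^sub>a inv_arr C (asc C ?D X ?D)) 
      \<bullet> (idt C Y \<otimes>\<^sub>a (idt C ?D \<otimes>\<^sub>a lcoev C X)) \<bullet> asc C Y ?D \<one>\<^sub>o \<bullet> inv_arr C (run C (Y \<otimes>\<^sub>o ?D))"
    by (simp add: nat_tensor nat_tensor_inv)
  also have "\<dots> = (idt C Y \<otimes>\<^sub>a lun C ?D) \<bullet> (idt C Y \<otimes>\<^sub>a (lev C X \<otimes>\<^sub>a idt C ?D)) \<bullet>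
      (idt C Y \<otimes>\<^sub>a inv_arr C (asc C ?D X ?D)) 
      \<bullet> (idt C Y \<otimes>\<^sub>a (idt C ?D \<otimes>\<^sub>a lcoev C X)) \<bullet> (idt C Y \<otimes>\<^sub>a inv_arr C (run C ?D))"
    by (simp add: run_tensor_inv asc_triangle_inv[THEN cmp_extend])
  also have "\<dots> = idt C Y \<otimes>\<^sub>a idt C ?D"
    by (simp add: merge_tensor zigzag del: tensor.bi_idt)
  finally show ?thesis by simp
qed

text \<open>Unit and counit of the adjunction between \<open>X\<^sup>* \<otimes> -\<close> and \<open>X \<otimes> -\<close>.\<close>

definition lunit :: "'o \<Rightarrow> 'o \<Rightarrow> 'a" where
  "lunit X B = asc C X (ldual C X) B \<bullet> (lcoev C X \<otimes>\<^sub>a idt C B) \<bullet> inv_arr C (lun C B)"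

definition lcounit :: "'o \<Rightarrow> 'o \<Rightarrow> 'a" where
  "lcounit X B = lun C B \<bullet> (lev C X \<otimes>\<^sub>a idt C B) \<bullet> inv_arr C (asc C (ldual C X) X B)"

lemma lunit_arr [simp]:
  assumes "X \<in> obj C" "B \<in> obj C"
  shows "lunit X B \<in> arr C" "src C (lunit X B) = B" "tgt C (lunit X B) = X \<otimes>\<^sub>o ldual C X \<otimes>\<^sub>o B"
  using assms by (auto simp: lunit_def)

lemma lcounit_arr [simp]:
  assumes "X \<in> obj C" "B \<in> obj C"
  shows "lcounit X B \<in> arr C" "src C (lcounit X B) = ldual C X \<otimes>\<^sub>o X \<otimes>\<^sub>o B" "tgt C (lcounit X B) = B"
  using assms by (auto simp: lcounit_def)

end

section \<open>Module categories\<close>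

text \<open>A module category structure over \<open>C\<close> on a linear category. Finite module categories and the regular
module category are the two instances of interest.\<close>

locale module_category = finite_tensor_category K C + M: linear_category K M
    + action: bilinear_bifunctor K C M M "actO M" "actA M"
  for K :: "('k, 'r) ring_scheme"
    and C :: "('c, 'e, 'k, 'x) tensor_cat_scheme" (structure)
    and M :: "('c, 'e, 'o, 'a, 'k, 'y) mod_cat_scheme" +
  assumes masc_iso: "\<lbrakk>X \<in> obj C; Y \<in> obj C; N \<in> obj M\<rbrakk>
      \<Longrightarrow> masc M X Y N \<in> Hom M ((X \<otimes>\<^sub>o Y) \<rhd>\<^sub>o\<^bsub>M\<^esub> N) (X \<rhd>\<^sub>o\<^bsub>M\<^esub> (Y \<rhd>\<^sub>o\<^bsub>M\<^esub> N)) \<and> iso_arr M (masc M X Y N)"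
    and masc_natural: "\<lbrakk>f \<in> Hom C X X'; g \<in> Hom C Y Y'; h \<in> Hom M N N'\<rbrakk>
      \<Longrightarrow> masc M X' Y' N' \<bullet>\<^bsub>M\<^esub> ((f \<otimes>\<^sub>a g) \<rhd>\<^sub>a\<^bsub>M\<^esub> h) = (f \<rhd>\<^sub>a\<^bsub>M\<^esub> (g \<rhd>\<^sub>a\<^bsub>M\<^esub> h)) \<bullet>\<^bsub>M\<^esub> masc M X Y N"
    and mun_natural: "natural_iso M M (\<lambda>N. \<one>\<^sub>o \<rhd>\<^sub>o\<^bsub>M\<^esub> N) (\<lambda>g. idt C \<one>\<^sub>o \<rhd>\<^sub>a\<^bsub>M\<^esub> g)
        (\<lambda>N. N) (\<lambda>g. g) (mun M)"
    and module_pentagon: "\<lbrakk>X \<in> obj C; Y \<in> obj C; Z \<in> obj C; N \<in> obj M\<rbrakk>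
      \<Longrightarrow> masc M X Y (Z \<rhd>\<^sub>o\<^bsub>M\<^esub> N) \<bullet>\<^bsub>M\<^esub> masc M (X \<otimes>\<^sub>o Y) Z N =
          (idt C X \<rhd>\<^sub>a\<^bsub>M\<^esub> masc M Y Z N) \<bullet>\<^bsub>M\<^esub> masc M X (Y \<otimes>\<^sub>o Z) N \<bullet>\<^bsub>M\<^esub> (asc C X Y Z \<rhd>\<^sub>a\<^bsub>M\<^esub> idt M N)"
    and module_triangle: "\<lbrakk>X \<in> obj C; N \<in> obj M\<rbrakk>
      \<Longrightarrow> (idt C X \<rhd>\<^sub>a\<^bsub>M\<^esub> mun M N) \<bullet>\<^bsub>M\<^esub> masc M X \<one>\<^sub>o N = run C X \<rhd>\<^sub>a\<^bsub>M\<^esub> idt M N"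
begin

sublocale action: bifunctor K C M M "actO M" "actA M" ..

abbreviation cmpM (infixr \<open>\<cdot>\<close> 55) where "g \<cdot> f \<equiv> cmp M g f"
abbreviation actO' (infixr \<open>\<rhd>\<close> 70) where "X \<rhd> N \<equiv> actO M X N"
abbreviation actA' (infixr \<open>\<unrhd>\<close> 70) where "f \<unrhd> g \<equiv> actA M f g"
abbreviation idC (\<open>\<iota>\<close>) where "\<iota> X \<equiv> idt C X"
abbreviation idM (\<open>\<kappa>\<close>) where "\<kappa> N \<equiv> idt M N"

lemma masc_arr [simp]:
  assumes "X \<in> obj C" "Y \<in> obj C" "N \<in> obj M"
  shows "masc M X Y N \<in> arr M" "src M (masc M X Y N) = (X \<otimes>\<^sub>o Y) \<rhd> N"
    "tgt M (masc M X Y N) = X \<rhd> Y \<rhd> N" "iso_arr M (masc M X Y N)"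
  using masc_iso[OF assms] by (auto simp: Hom_def)

lemma mun_arr [simp]:
  assumes "N \<in> obj M"
  shows "mun M N \<in> arr M" "src M (mun M N) = \<one>\<^sub>o \<rhd> N" "tgt M (mun M N) = N" "iso_arr M (mun M N)"
  using mun_natural assms by (auto simp: Hom_def natural_iso_def)

lemma mun_nat: "\<lbrakk>f \<in> arr M; tgt M f = N\<rbrakk> \<Longrightarrow> mun M N \<cdot> (\<iota> \<one>\<^sub>o \<unrhd> f) = f \<cdot> mun M (src M f)"
  using mun_natural by (auto simp: natural_iso_def)

lemma mun_inv_nat:
  "\<lbrakk>f \<in> arr M; tgt M f = N\<rbrakk> \<Longrightarrow> inv_arr M (mun M N) \<cdot> f = (\<iota> \<one>\<^sub>o \<unrhd> f) \<cdot> inv_arr M (mun M (src M f))"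
  by (rule M.inv_transpose[symmetric]) (auto simp: mun_nat)

lemma masc_nat:
  "\<lbrakk>f \<in> arr C; g \<in> arr C; h \<in> arr M; tgt C f = X; tgt C g = Y; tgt M h = N\<rbrakk>
   \<Longrightarrow> masc M X Y N \<cdot> ((f \<otimes>\<^sub>a g) \<unrhd> h) = (f \<unrhd> g \<unrhd> h) \<cdot> masc M (src C f) (src C g) (src M h)"
  by (rule masc_natural) (auto simp: Hom_def)

lemma masc_nat_right:
  "\<lbrakk>X \<in> obj C; Y \<in> obj C; h \<in> arr M; tgt M h = N\<rbrakk>
   \<Longrightarrow> masc M X Y N \<cdot> (\<iota> (X \<otimes>\<^sub>o Y) \<unrhd> h) = (\<iota> X \<unrhd> \<iota> Y \<unrhd> h) \<cdot> masc M X Y (src M h)"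
  using masc_nat[of "\<iota> X" "\<iota> Y" h X Y N] by simp

lemma masc_inv_nat:
  "\<lbrakk>f \<in> arr C; g \<in> arr C; h \<in> arr M; tgt C f = X; tgt C g = Y; tgt M h = N\<rbrakk>
   \<Longrightarrow> inv_arr M (masc M X Y N) \<cdot> (f \<unrhd> g \<unrhd> h) =
     ((f \<otimes>\<^sub>a g) \<unrhd> h) \<cdot> inv_arr M (masc M (src C f) (src C g) (src M h))"
  by (rule M.inv_transpose[symmetric]) (auto simp: masc_nat)

lemma masc_inv_nat_left:
  "\<lbrakk>Y \<in> obj C; N \<in> obj M; f \<in> arr C; tgt C f = X\<rbrakk>
   \<Longrightarrow> inv_arr M (masc M X Y N) \<cdot> (f \<unrhd> \<kappa> (Y \<rhd> N)) =
      ((f \<otimes>\<^sub>a \<iota> Y) \<unrhd> \<kappa> N) \<cdot> inv_arr M (masc M (src C f) Y N)"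
  using masc_inv_nat[of f "\<iota> Y" "\<kappa> N" X Y N] by simp

lemmas nat_action = mun_nat mun_nat[THEN M.cmp_extend]
  masc_nat masc_nat[THEN M.cmp_extend] masc_nat_right masc_nat_right[THEN M.cmp_extend]

lemmas nat_action_inv = mun_inv_nat mun_inv_nat[THEN M.cmp_extend]
  masc_inv_nat masc_inv_nat[THEN M.cmp_extend] masc_inv_nat_left masc_inv_nat_left[THEN M.cmp_extend]

lemmas merge_action = action.merge action.merge_extend

lemma mun_faithful:
  assumes "\<iota> \<one>\<^sub>o \<unrhd> f = \<iota> \<one>\<^sub>o \<unrhd> g" "f \<in> arr M" "g \<in> arr M" "src M f = src M g" "tgt M f = tgt M g"
  shows "f = g"
proof (rule M.iso_epi)
  show "f \<cdot> mun M (src M f) = g \<cdot> mun M (src M f)"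
    using mun_nat[of f] mun_nat[of g] assms by simp
qed (use assms in auto)

text \<open>Kelly's coherence lemma for the action: acting with \<open>\<one>\<close> is faithful, and the pentagon for
\<open>\<one>, \<one>, X, N\<close> together with the two triangle axioms gives the claim after acting with \<open>\<one>\<close>.\<close>

lemma mun_action:
  assumes [simp]: "X \<in> obj C" "N \<in> obj M"
  shows "mun M (X \<rhd> N) \<cdot> masc M \<one>\<^sub>o X N = lun C X \<unrhd> \<kappa> N"
proof (rule mun_faithful)
  show "\<iota> \<one>\<^sub>o \<unrhd> (mun M (X \<rhd> N) \<cdot> masc M \<one>\<^sub>o X N) = \<iota> \<one>\<^sub>o \<unrhd> (lun C X \<unrhd> \<kappa> N)"
  proof (rule M.iso_epi)
    let ?f = "masc M \<one>\<^sub>o (\<one>\<^sub>o \<otimes>\<^sub>o X) N \<cdot> (asc C \<one>\<^sub>o \<one>\<^sub>o X \<unrhd> \<kappa> N)"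
    have "(\<iota> \<one>\<^sub>o \<unrhd> (mun M (X \<rhd> N) \<cdot> masc M \<one>\<^sub>o X N)) \<cdot> ?f
      = (\<iota> \<one>\<^sub>o \<unrhd> mun M (X \<rhd> N)) \<cdot> (\<iota> \<one>\<^sub>o \<unrhd> masc M \<one>\<^sub>o X N) \<cdot> ?f"
      by (simp add: merge_action)
    also have "\<dots> = (\<iota> \<one>\<^sub>o \<unrhd> mun M (X \<rhd> N)) \<cdot> masc M \<one>\<^sub>o \<one>\<^sub>o (X \<rhd> N) \<cdot> masc M (\<one>\<^sub>o \<otimes>\<^sub>o \<one>\<^sub>o) X N"
      by (simp add: module_pentagon)
    also have "\<dots> = (run C \<one>\<^sub>o \<unrhd> \<kappa> (X \<rhd> N)) \<cdot> masc M (\<one>\<^sub>o \<otimes>\<^sub>o \<one>\<^sub>o) X N"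
      by (simp add: module_triangle[THEN M.cmp_extend])
    also have "\<dots> = masc M \<one>\<^sub>o X N \<cdot> ((run C \<one>\<^sub>o \<otimes>\<^sub>a \<iota> X) \<unrhd> \<kappa> N)"
      by (simp add: nat_action)
    also have "\<dots> = masc M \<one>\<^sub>o X N \<cdot> ((\<iota> \<one>\<^sub>o \<otimes>\<^sub>a lun C X) \<unrhd> \<kappa> N) \<cdot> (asc C \<one>\<^sub>o \<one>\<^sub>o X \<unrhd> \<kappa> N)"
      by (simp add: merge_action triangle)
    also have "\<dots> = (\<iota> \<one>\<^sub>o \<unrhd> (lun C X \<unrhd> \<kappa> N)) \<cdot> ?f"
      by (simp add: nat_action)
    finally show "(\<iota> \<one>\<^sub>o \<unrhd> (mun M (X \<rhd> N) \<cdot> masc M \<one>\<^sub>o X N)) \<cdot> ?f = (\<iota> \<one>\<^sub>o \<unrhd> (lun C X \<unrhd> \<kappa> N)) \<cdot> ?f" .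
  qed simp_all
qed simp_all

lemma mun_action_inv:
  assumes [simp]: "X \<in> obj C" "N \<in> obj M"
  shows "masc M \<one>\<^sub>o X N \<cdot> (inv_arr C (lun C X) \<unrhd> \<kappa> N) = inv_arr M (mun M (X \<rhd> N))"
    and "inv_arr M (masc M \<one>\<^sub>o X N) \<cdot> inv_arr M (mun M (X \<rhd> N)) = inv_arr C (lun C X) \<unrhd> \<kappa> N"
proof -
  show 1: "masc M \<one>\<^sub>o X N \<cdot> (inv_arr C (lun C X) \<unrhd> \<kappa> N) = inv_arr M (mun M (X \<rhd> N))"
    using M.inv_transpose[of "lun C X \<unrhd> \<kappa> N" "mun M (X \<rhd> N)" "masc M \<one>\<^sub>o X N" "\<kappa> (X \<rhd> N)"]
    by (simp add: mun_action)
  show "inv_arr M (masc M \<one>\<^sub>o X N) \<cdot> inv_arr M (mun M (X \<rhd> N)) = inv_arr C (lun C X) \<unrhd> \<kappa> N"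
    by (simp add: 1[symmetric])
qed

lemma module_pentagon_inv:
  assumes [simp]: "X \<in> obj C" "Y \<in> obj C" "Z \<in> obj C" "N \<in> obj M"
  shows "(\<iota> X \<unrhd> inv_arr M (masc M Y Z N)) \<cdot> masc M X Y (Z \<rhd> N) =
    masc M X (Y \<otimes>\<^sub>o Z) N \<cdot> (asc C X Y Z \<unrhd> \<kappa> N) \<cdot> inv_arr M (masc M (X \<otimes>\<^sub>o Y) Z N)"
proof (rule M.iso_epi[of "masc M (X \<otimes>\<^sub>o Y) Z N"])
  show "((\<iota> X \<unrhd> inv_arr M (masc M Y Z N)) \<cdot> masc M X Y (Z \<rhd> N)) \<cdot> masc M (X \<otimes>\<^sub>o Y) Z N =
    (masc M X (Y \<otimes>\<^sub>o Z) N \<cdot> (asc C X Y Z \<unrhd> \<kappa> N) \<cdot> inv_arr M (masc M (X \<otimes>\<^sub>o Y) Z N)) \<cdot> masc M (X \<otimes>\<^sub>o Y) Z N"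
    by (simp add: module_pentagon merge_action)
qed simp_all

text \<open>Unit and counit of the adjunction between \<open>X\<^sup>* \<rhd> -\<close> and \<open>X \<rhd> -\<close> on the module category.\<close>

definition acoev :: "'c \<Rightarrow> 'o \<Rightarrow> 'a" where
  "acoev X N = masc M X (ldual C X) N \<cdot> (lcoev C X \<unrhd> \<kappa> N) \<cdot> inv_arr M (mun M N)"

definition aev :: "'c \<Rightarrow> 'o \<Rightarrow> 'a" where
  "aev X N = mun M N \<cdot> (lev C X \<unrhd> \<kappa> N) \<cdot> inv_arr M (masc M (ldual C X) X N)"

lemma acoev_arr [simp]:
  assumes "X \<in> obj C" "N \<in> obj M"
  shows "acoev X N \<in> arr M" "src M (acoev X N) = N" "tgt M (acoev X N) = X \<rhd> ldual C X \<rhd> N"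
  using assms by (auto simp: acoev_def)

lemma aev_arr [simp]:
  assumes "X \<in> obj C" "N \<in> obj M"
  shows "aev X N \<in> arr M" "src M (aev X N) = ldual C X \<rhd> X \<rhd> N" "tgt M (aev X N) = N"
  using assms by (auto simp: aev_def)

lemma acoev_nat:
  assumes "X \<in> obj C" "f \<in> arr M" "tgt M f = N"
  shows "acoev X N \<cdot> f = (\<iota> X \<unrhd> \<iota> (ldual C X) \<unrhd> f) \<cdot> acoev X (src M f)"
proof -
  have [simp]: "X \<in> obj C" "f \<in> arr M" "tgt M f = N" "N \<in> obj M" using assms by auto
  have "acoev X N \<cdot> f = masc M X (ldual C X) N \<cdot> (lcoev C X \<unrhd> \<kappa> N) \<cdot> (\<iota> \<one>\<^sub>o \<unrhd> f) \<cdot> inv_arr M (mun M (src M f))"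
    by (simp add: acoev_def nat_action_inv)
  also have "\<dots> = masc M X (ldual C X) N \<cdot> (\<iota> (X \<otimes>\<^sub>o ldual C X) \<unrhd> f) \<cdot> (lcoev C X \<unrhd> \<kappa> (src M f)) \<cdot> inv_arr M (mun M (src M f))"
    by (simp add: merge_action)
  also have "\<dots> = (\<iota> X \<unrhd> \<iota> (ldual C X) \<unrhd> f) \<cdot> acoev X (src M f)"
    by (simp add: acoev_def nat_action)
  finally show ?thesis .
qed

lemma aev_nat:
  assumes "X \<in> obj C" "f \<in> arr M" "tgt M f = N"
  shows "aev X N \<cdot> (\<iota> (ldual C X) \<unrhd> \<iota> X \<unrhd> f) = f \<cdot> aev X (src M f)"
proof -
  have [simp]: "X \<in> obj C" "f \<in> arr M" "tgt M f = N" "N \<in> obj M" using assms by auto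
  have "aev X N \<cdot> (\<iota> (ldual C X) \<unrhd> \<iota> X \<unrhd> f)
    = mun M N \<cdot> (lev C X \<unrhd> \<kappa> N) \<cdot> (\<iota> (ldual C X \<otimes>\<^sub>o X) \<unrhd> f) \<cdot> inv_arr M (masc M (ldual C X) X (src M f))"
    by (simp add: aev_def nat_action_inv)
  also have "\<dots> = mun M N \<cdot> (\<iota> \<one>\<^sub>o \<unrhd> f) \<cdot> (lev C X \<unrhd> \<kappa> (src M f)) \<cdot> inv_arr M (masc M (ldual C X) X (src M f))"
    by (simp add: merge_action)
  also have "\<dots> = f \<cdot> aev X (src M f)"
    by (simp add: aev_def nat_action)
  finally show ?thesis .
qed

text \<open>One triangle identity. The pentagon turns the two associators in the middle into a single associator of
\<open>C\<close>, so that everything becomes the zigzag of \<open>X\<close> acting on \<open>N\<close>.\<close>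

lemma aev_acoev:
  assumes [simp]: "X \<in> obj C" "N \<in> obj M"
  shows "(\<iota> X \<unrhd> aev X N) \<cdot> acoev X (X \<rhd> N) = \<kappa> (X \<rhd> N)"
proof -
  let ?D = "ldual C X"
  have "(\<iota> X \<unrhd> aev X N) \<cdot> acoev X (X \<rhd> N)
    = (\<iota> X \<unrhd> mun M N) \<cdot> (\<iota> X \<unrhd> (lev C X \<unrhd> \<kappa> N)) \<cdot> (\<iota> X \<unrhd> inv_arr M (masc M ?D X N))
      \<cdot> masc M X ?D (X \<rhd> N) \<cdot> (lcoev C X \<unrhd> \<kappa> (X \<rhd> N)) \<cdot> inv_arr M (mun M (X \<rhd> N))"
    by (simp add: aev_def acoev_def merge_action)
  also have "\<dots> = (\<iota> X \<unrhd> mun M N) \<cdot> (\<iota> X \<unrhd> (lev C X \<unrhd> \<kappa> N)) \<cdot> masc M X (?D \<otimes>\<^sub>o X) N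
      \<cdot> (asc C X ?D X \<unrhd> \<kappa> N) \<cdot> inv_arr M (masc M (X \<otimes>\<^sub>o ?D) X N) \<cdot> (lcoev C X \<unrhd> \<kappa> (X \<rhd> N))
      \<cdot> inv_arr M (mun M (X \<rhd> N))"
    by (simp add: module_pentagon_inv[THEN M.cmp_extend])
  also have "\<dots> = (\<iota> X \<unrhd> mun M N) \<cdot> masc M X \<one>\<^sub>o N \<cdot> ((\<iota> X \<otimes>\<^sub>a lev C X) \<unrhd> \<kappa> N)
      \<cdot> (asc C X ?D X \<unrhd> \<kappa> N) \<cdot> ((lcoev C X \<otimes>\<^sub>a \<iota> X) \<unrhd> \<kappa> N) \<cdot> inv_arr M (masc M \<one>\<^sub>o X N)
      \<cdot> inv_arr M (mun M (X \<rhd> N))"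
    by (simp add: nat_action nat_action_inv)
  also have "\<dots> = (run C X \<unrhd> \<kappa> N) \<cdot> ((\<iota> X \<otimes>\<^sub>a lev C X) \<unrhd> \<kappa> N)
      \<cdot> (asc C X ?D X \<unrhd> \<kappa> N) \<cdot> ((lcoev C X \<otimes>\<^sub>a \<iota> X) \<unrhd> \<kappa> N) \<cdot> (inv_arr C (lun C X) \<unrhd> \<kappa> N)"
    by (simp add: module_triangle[THEN M.cmp_extend] mun_action_inv)
  also have "\<dots> = \<kappa> (X \<rhd> N)"
    by (simp add: merge_action zigzag)
  finally show ?thesis .
qed

lemma aev_injective:
  assumes [simp]: "X \<in> obj C" "N \<in> obj M" and f: "f \<in> arr M" "tgt M f = X \<rhd> N" and g: "g \<in> arr M" "tgt M g = X \<rhd> N"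
    and src: "src M f = src M g"
    and eq: "aev X N \<cdot> (\<iota> (ldual C X) \<unrhd> f) = aev X N \<cdot> (\<iota> (ldual C X) \<unrhd> g)"
  shows "f = g"
proof -
  have *: "h = (\<iota> X \<unrhd> (aev X N \<cdot> (\<iota> (ldual C X) \<unrhd> h))) \<cdot> acoev X (src M h)"
    if [simp]: "h \<in> arr M" "tgt M h = X \<rhd> N" for h
  proof -
    have "h = (\<iota> X \<unrhd> aev X N) \<cdot> acoev X (X \<rhd> N) \<cdot> h"
      using aev_acoev[THEN M.cmp_extend, of X N h] by simp
    also have "\<dots> = (\<iota> X \<unrhd> (aev X N \<cdot> (\<iota> (ldual C X) \<unrhd> h))) \<cdot> acoev X (src M h)"
      by (simp add: acoev_nat merge_action)
    finally show ?thesis .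
  qed
  show ?thesis using *[OF f] *[OF g] eq src by simp
qed

text \<open>The adjunction on the module category is compatible with the one on \<open>C\<close>: the next two lemmas
say that unit and counit at \<open>B \<rhd> N\<close> come from those at \<open>B\<close>. They allow morphisms into \<open>X \<otimes> A\<close>
to be studied through their action.\<close>

lemma acoev_action:
  assumes [simp]: "X \<in> obj C" "B \<in> obj C" "N \<in> obj M"
  shows "(\<iota> X \<unrhd> masc M (ldual C X) B N) \<cdot> masc M X (ldual C X \<otimes>\<^sub>o B) N
    \<cdot> (lunit X B \<unrhd> \<kappa> N) = acoev X (B \<rhd> N)"
proof -
  let ?D = "ldual C X"
  have "(\<iota> X \<unrhd> masc M ?D B N) \<cdot> masc M X (?D \<otimes>\<^sub>o B) N
      \<cdot> (lunit X B \<unrhd> \<kappa> N)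
    = (\<iota> X \<unrhd> masc M ?D B N) \<cdot> masc M X (?D \<otimes>\<^sub>o B) N \<cdot> (asc C X ?D B \<unrhd> \<kappa> N) \<cdot> ((lcoev C X \<otimes>\<^sub>a \<iota> B) \<unrhd> \<kappa> N)
      \<cdot> (inv_arr C (lun C B) \<unrhd> \<kappa> N)"
    by (simp add: lunit_def merge_action)
  also have "\<dots> = masc M X ?D (B \<rhd> N) \<cdot> masc M (X \<otimes>\<^sub>o ?D) B N \<cdot> ((lcoev C X \<otimes>\<^sub>a \<iota> B) \<unrhd> \<kappa> N)
      \<cdot> (inv_arr C (lun C B) \<unrhd> \<kappa> N)"
    by (simp add: module_pentagon[THEN M.cmp_extend])
  also have "\<dots> = masc M X ?D (B \<rhd> N) \<cdot> (lcoev C X \<unrhd> \<kappa> (B \<rhd> N)) \<cdot> masc M \<one>\<^sub>o B N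
      \<cdot> (inv_arr C (lun C B) \<unrhd> \<kappa> N)"
    by (simp add: nat_action)
  also have "\<dots> = acoev X (B \<rhd> N)"
    by (simp add: mun_action_inv acoev_def)
  finally show ?thesis .
qed

lemma aev_action:
  assumes [simp]: "X \<in> obj C" "B \<in> obj C" "N \<in> obj M"
  shows "aev X (B \<rhd> N) \<cdot> (\<iota> (ldual C X) \<unrhd> masc M X B N) \<cdot> masc M (ldual C X) (X \<otimes>\<^sub>o B) N
   = lcounit X B \<unrhd> \<kappa> N"
proof (rule M.iso_epi)
  let ?D = "ldual C X"
  have "(aev X (B \<rhd> N) \<cdot> (\<iota> ?D \<unrhd> masc M X B N) \<cdot> masc M ?D (X \<otimes>\<^sub>o B) N) \<cdot> (asc C ?D X B \<unrhd> \<kappa> N)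
    = aev X (B \<rhd> N) \<cdot> masc M ?D X (B \<rhd> N) \<cdot> masc M (?D \<otimes>\<^sub>o X) B N"
    by (simp add: module_pentagon)
  also have "\<dots> = mun M (B \<rhd> N) \<cdot> (lev C X \<unrhd> \<kappa> (B \<rhd> N)) \<cdot> masc M (?D \<otimes>\<^sub>o X) B N"
    by (simp add: aev_def)
  also have "\<dots> = mun M (B \<rhd> N) \<cdot> masc M \<one>\<^sub>o B N \<cdot> ((lev C X \<otimes>\<^sub>a \<iota> B) \<unrhd> \<kappa> N)"
    by (simp add: nat_action)
  also have "\<dots> = (lun C B \<unrhd> \<kappa> N) \<cdot> ((lev C X \<otimes>\<^sub>a \<iota> B) \<unrhd> \<kappa> N)"
    by (simp add: mun_action[THEN M.cmp_extend])
  also have "\<dots> = (lcounit X B \<unrhd> \<kappa> N) \<cdot> (asc C ?D X B \<unrhd> \<kappa> N)"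
    by (simp add: lcounit_def merge_action)
  finally show "(aev X (B \<rhd> N) \<cdot> (\<iota> ?D \<unrhd> masc M X B N) \<cdot> masc M ?D (X \<otimes>\<^sub>o B) N) \<cdot> (asc C ?D X B \<unrhd> \<kappa> N)
    = (lcounit X B \<unrhd> \<kappa> N) \<cdot> (asc C ?D X B \<unrhd> \<kappa> N)" .
qed simp_all

end

section \<open>The regular module category and bending\<close>

lemma regular_module_simps [simp]:
  "obj (regular_module C) = obj C" "arr (regular_module C) = arr C" "src (regular_module C) = src C"
  "tgt (regular_module C) = tgt C" "idt (regular_module C) = idt C" "cmp (regular_module C) = cmp C"
  "zeroA (regular_module C) = zeroA C" "addA (regular_module C) = addA C"
  "scalA (regular_module C) = scalA C" "actO (regular_module C) = tenO C"
  "actA (regular_module C) = tenA C" "masc (regular_module C) = asc C" "mun (regular_module C) = lun C"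
  by (simp_all add: regular_module_def)

lemma regular_module_derived [simp]:
  "Hom (regular_module C) = Hom C" "iso_arr (regular_module C) = iso_arr C"
  "inv_arr (regular_module C) = inv_arr C" "hom_space (regular_module C) = hom_space C"
  by (simp_all add: fun_eq_iff Hom_def iso_arr_def inv_arr_def hom_space_def)

context finite_tensor_category
begin

lemma regular_module_category: "module_category K C (regular_module C)"
proof -
  have lin: "linear_category K (regular_module C)"
    using linear_category_axioms by (simp add: linear_category_def)
  have bil: "bilinear_bifunctor K C (regular_module C) (regular_module C)
      (actO (regular_module C)) (actA (regular_module C))"
    using tensor.bilinear_bifunctor_axioms by (simp add: bilinear_bifunctor_def)
  show ?thesis
    by (intro module_category.intro module_category_axioms.intro lin bil finite_tensor_category_axioms)
       (use asc_iso asc_natural lun_natural pentagon triangle in \<open>simp_all add: natural_iso_def\<close>)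
qed

interpretation regular: module_category K C "regular_module C"
  rewrites "obj (regular_module C) = obj C" and "arr (regular_module C) = arr C" and "src (regular_module C) = src C" and "tgt (regular_module C) = tgt C" and "idt (regular_module C) = idt C" and "cmp (regular_module C) = cmp C" and "actO (regular_module C) = tenO C" and "actA (regular_module C) = tenA C" and "masc (regular_module C) = asc C" and "mun (regular_module C) = lun C" and "inv_arr (regular_module C) = inv_arr C"
  by (rule regular_module_category) simp_all

lemma lun_tensor: "\<lbrakk>X \<in> obj C; Y \<in> obj C\<rbrakk> \<Longrightarrow> lun C (X \<otimes>\<^sub>o Y) \<bullet> asc C \<one>\<^sub>o X Y = lun C X \<otimes>\<^sub>a idt C Y"
  by (rule regular.mun_action)

lemma lcounit_inject:
  assumes "X \<in> obj C" "B \<in> obj C" "f \<in> arr C" "tgt C f = X \<otimes>\<^sub>o B" "g \<in> arr C" "tgt C g = X \<otimes>\<^sub>o B"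
    and "src C f = src C g"
    and "lcounit X B \<bullet> (idt C (ldual C X) \<otimes>\<^sub>a f) = lcounit X B \<bullet> (idt C (ldual C X) \<otimes>\<^sub>a g)"
  shows "f = g"
  using regular.aev_injective[OF assms(1-7)] assms(8) by (simp only: regular.aev_def lcounit_def)

text \<open>Both unit constraints of \<open>\<one>\<close> agree: \<open>lun (\<one> \<otimes> \<one>) = \<one> \<otimes> lun \<one>\<close> by naturality, after which
the triangle axiom and its left-hand variant \<open>lun_tensor\<close> have the same left-hand side.\<close>

lemma lun_unit: "lun C \<one>\<^sub>o = run C \<one>\<^sub>o"
proof (rule run_faithful)
  have "lun C (\<one>\<^sub>o \<otimes>\<^sub>o \<one>\<^sub>o) = idt C \<one>\<^sub>o \<otimes>\<^sub>a lun C \<one>\<^sub>o"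
    by (rule iso_mono[of "lun C \<one>\<^sub>o"]) (simp_all add: lun_nat)
  then show "lun C \<one>\<^sub>o \<otimes>\<^sub>a idt C \<one>\<^sub>o = run C \<one>\<^sub>o \<otimes>\<^sub>a idt C \<one>\<^sub>o"
    using lun_tensor[of "\<one>\<^sub>o" "\<one>\<^sub>o"] triangle[of "\<one>\<^sub>o" "\<one>\<^sub>o"] by simp
qed simp_all

lemma regular_iev_unit:
  assumes [simp]: "X \<in> obj C"
  shows "regular_iev C X \<one>\<^sub>o = lev C X \<bullet> (lun C (ldual C X) \<otimes>\<^sub>a idt C X)"
proof -
  have "regular_iev C X \<one>\<^sub>o = lun C \<one>\<^sub>o \<bullet> (idt C \<one>\<^sub>o \<otimes>\<^sub>a lev C X) \<bullet> asc C \<one>\<^sub>o (ldual C X) X"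
    by (simp add: regular_iev_def lun_unit)
  also have "\<dots> = lev C X \<bullet> (lun C (ldual C X) \<otimes>\<^sub>a idt C X)"
    by (simp add: lun_nat[THEN cmp_extend] lun_tensor)
  finally show ?thesis .
qed

text \<open>The dual of \<open>h\<close> is the transpose of \<open>lev \<circ> (Y\<^sup>* \<otimes> h) : Y\<^sup>* \<otimes> X \<rightarrow> \<one>\<close> followed by the left
unit constraint, which makes \<open>lev_dual_arr\<close> an instance of a triangle identity.\<close>

lemma dual_arr_eq:
  assumes [simp]: "h \<in> arr C"
  shows "dual_arr C h = lun C (ldual C (src C h)) \<bullet>
    ((lev C (tgt C h) \<bullet> (idt C (ldual C (tgt C h)) \<otimes>\<^sub>a h)) \<otimes>\<^sub>a idt C (ldual C (src C h)))
      \<bullet> rcoev (ldual C (tgt C h)) (src C h)"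
  by (simp add: dual_arr_def Let_def rcoev_def nat_tensor_inv)
     (simp add: merge_tensor)

lemma dual_arr_arr [simp]:
  assumes "h \<in> arr C"
  shows "dual_arr C h \<in> arr C" "src C (dual_arr C h) = ldual C (tgt C h)"
    "tgt C (dual_arr C h) = ldual C (src C h)"
  using assms by (simp_all add: dual_arr_eq)

lemma dual_arr_idt [simp]: "X \<in> obj C \<Longrightarrow> dual_arr C (idt C X) = idt C (ldual C X)"
  by (simp add: dual_arr_def Let_def zigzag)

lemma lev_dual_arr:
  assumes [simp]: "h \<in> arr C"
  shows "lev C (src C h) \<bullet> (dual_arr C h \<otimes>\<^sub>a idt C (src C h)) = lev C (tgt C h) \<bullet> (idt C (ldual C (tgt C h)) \<otimes>\<^sub>a h)"
proof -
  let ?X = "src C h" and ?D = "ldual C (src C h)" and ?E = "ldual C (tgt C h)"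
  let ?k = "lev C (tgt C h) \<bullet> (idt C ?E \<otimes>\<^sub>a h)"
  have "lev C ?X \<bullet> (dual_arr C h \<otimes>\<^sub>a idt C ?X)
    = lev C ?X \<bullet> (lun C ?D \<otimes>\<^sub>a idt C ?X) \<bullet> ((?k \<otimes>\<^sub>a idt C ?D) \<otimes>\<^sub>a idt C ?X) \<bullet> (rcoev ?E ?X \<otimes>\<^sub>a idt C ?X)"
    by (simp add: dual_arr_eq merge_tensor)
  also have "\<dots> = regular_iev C ?X \<one>\<^sub>o \<bullet> ((?k \<otimes>\<^sub>a idt C ?D) \<otimes>\<^sub>a idt C ?X) \<bullet> (rcoev ?E ?X \<otimes>\<^sub>a idt C ?X)"
    by (simp add: regular_iev_unit)
  also have "\<dots> = ?k \<bullet> regular_iev C ?X (?E \<otimes>\<^sub>o ?X) \<bullet> (rcoev ?E ?X \<otimes>\<^sub>a idt C ?X)"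
    using regular_iev_nat[THEN cmp_extend, of ?k ?X "\<one>\<^sub>o" "rcoev ?E ?X \<otimes>\<^sub>a idt C ?X"] by simp
  also have "\<dots> = ?k"
    by (simp add: regular_iev_rcoev)
  finally show ?thesis .
qed

text \<open>Dinaturality of the counit in \<open>X\<close>. It is what translates dinaturality in the ends defining \<open>Z\<close>
into naturality.\<close>

lemma regular_iev_dual_arr:
  assumes [simp]: "h \<in> arr C" "W \<in> obj C"
  shows "regular_iev C (src C h) W \<bullet> ((idt C W \<otimes>\<^sub>a dual_arr C h) \<otimes>\<^sub>a idt C (src C h)) =
    regular_iev C (tgt C h) W \<bullet> (idt C (W \<otimes>\<^sub>o ldual C (tgt C h)) \<otimes>\<^sub>a h)"
  by (simp add: regular_iev_def nat_tensor)
     (simp add: merge_tensor lev_dual_arr)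

text \<open>By the two triangle identities, bending \<open>f \<mapsto> regular_iev \<circ> (f \<otimes> X)\<close> is a bijection from the
morphisms \<open>B \<rightarrow> Y \<otimes> X\<^sup>*\<close> to the morphisms \<open>B \<otimes> X \<rightarrow> Y\<close>, with inverse
\<open>t \<mapsto> (t \<otimes> X\<^sup>*) \<circ> rcoev\<close>.\<close>

lemma bend_back:
  assumes "X \<in> obj C" "f \<in> arr C" "tgt C f = Y \<otimes>\<^sub>o ldual C X" "Y \<in> obj C"
  shows "((regular_iev C X Y \<bullet> (f \<otimes>\<^sub>a idt C X)) \<otimes>\<^sub>a idt C (ldual C X)) \<bullet> rcoev (src C f) X = f"
proof -
  have [simp]: "X \<in> obj C" "f \<in> arr C" "tgt C f = Y \<otimes>\<^sub>o ldual C X" "Y \<in> obj C" using assms by auto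
  have "((regular_iev C X Y \<bullet> (f \<otimes>\<^sub>a idt C X)) \<otimes>\<^sub>a idt C (ldual C X)) \<bullet> rcoev (src C f) X
    = (regular_iev C X Y \<otimes>\<^sub>a idt C (ldual C X)) \<bullet> rcoev (Y \<otimes>\<^sub>o ldual C X) X \<bullet> f"
    by (simp add: rcoev_nat merge_tensor)
  also have "\<dots> = f"
    using rcoev_regular_iev[THEN cmp_extend, of Y X f] by simp
  finally show ?thesis .
qed

lemma bend_inject:
  assumes "X \<in> obj C" "Y \<in> obj C" "f \<in> arr C" "g \<in> arr C" "tgt C f = Y \<otimes>\<^sub>o ldual C X" "tgt C g = Y \<otimes>\<^sub>o ldual C X"
    and "src C f = src C g"
    and eq: "regular_iev C X Y \<bullet> (f \<otimes>\<^sub>a idt C X) = regular_iev C X Y \<bullet> (g \<otimes>\<^sub>a idt C X)"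
  shows "f = g"
proof -
  have "f = ((regular_iev C X Y \<bullet> (f \<otimes>\<^sub>a idt C X)) \<otimes>\<^sub>a idt C (ldual C X)) \<bullet> rcoev (src C f) X"
    by (rule bend_back[symmetric]) fact+
  also have "\<dots> = ((regular_iev C X Y \<bullet> (g \<otimes>\<^sub>a idt C X)) \<otimes>\<^sub>a idt C (ldual C X)) \<bullet> rcoev (src C g) X"
    by (simp only: eq \<open>src C f = src C g\<close>)
  also have "\<dots> = g" by (rule bend_back) fact+
  finally show ?thesis .
qed

lemma bend_unbend:
  assumes "B \<in> obj C" "X \<in> obj C" "t \<in> arr C" "src C t = B \<otimes>\<^sub>o X" "tgt C t = Y"
  shows "regular_iev C X Y \<bullet> (((t \<otimes>\<^sub>a idt C (ldual C X)) \<bullet> rcoev B X) \<otimes>\<^sub>a idt C X) = t"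
proof -
  have [simp]: "B \<in> obj C" "X \<in> obj C" "t \<in> arr C" "src C t = B \<otimes>\<^sub>o X" "tgt C t = Y" "Y \<in> obj C"
    using assms by auto
  have "regular_iev C X Y \<bullet> (((t \<otimes>\<^sub>a idt C (ldual C X)) \<bullet> rcoev B X) \<otimes>\<^sub>a idt C X)
    = regular_iev C X Y \<bullet> ((t \<otimes>\<^sub>a idt C (ldual C X)) \<otimes>\<^sub>a idt C X) \<bullet> (rcoev B X \<otimes>\<^sub>a idt C X)"
    by (simp add: merge_tensor)
  also have "\<dots> = t \<bullet> regular_iev C X (B \<otimes>\<^sub>o X) \<bullet> (rcoev B X \<otimes>\<^sub>a idt C X)"
    by (simp add: regular_iev_nat[THEN cmp_extend])
  also have "\<dots> = t" by (simp add: regular_iev_rcoev)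
  finally show ?thesis .
qed

lemma regular_internal_hom: "is_internal_hom C (regular_module C) (regular_ihom C) (regular_iev C)"
  unfolding is_internal_hom_def
proof (simp, intro ballI conjI)
  fix N P assume [simp]: "N \<in> obj C" "P \<in> obj C"
  show "regular_ihom C N P \<in> obj C" by (simp add: regular_ihom_def)
  show "regular_iev C N P \<in> Hom C (regular_ihom C N P \<otimes>\<^sub>o N) P"
    by (rule HomI) (simp_all add: regular_ihom_def)
  fix X assume [simp]: "X \<in> obj C"
  show "bij_betw (\<lambda>f. regular_iev C N P \<bullet> (f \<otimes>\<^sub>a idt C N)) (Hom C X (regular_ihom C N P)) (Hom C (X \<otimes>\<^sub>o N) P)"
    unfolding bij_betw_def
  proof
    show "inj_on (\<lambda>f. regular_iev C N P \<bullet> (f \<otimes>\<^sub>a idt C N)) (Hom C X (regular_ihom C N P))"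
      by (rule inj_onI, rule bend_inject[of N P]) (auto simp: Hom_def regular_ihom_def)
    show "(\<lambda>f. regular_iev C N P \<bullet> (f \<otimes>\<^sub>a idt C N)) ` Hom C X (regular_ihom C N P) = Hom C (X \<otimes>\<^sub>o N) P"
    proof (intro equalityI subsetI)
      fix t assume "t \<in> Hom C (X \<otimes>\<^sub>o N) P"
      then have t [simp]: "t \<in> arr C" "src C t = X \<otimes>\<^sub>o N" "tgt C t = P" by (auto simp: Hom_def)
      show "t \<in> (\<lambda>f. regular_iev C N P \<bullet> (f \<otimes>\<^sub>a idt C N)) ` Hom C X (regular_ihom C N P)"
        by (rule image_eqI[of _ _ "(t \<otimes>\<^sub>a idt C (ldual C N)) \<bullet> rcoev X N"])
           (auto simp: bend_unbend Hom_def regular_ihom_def)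
    qed (auto simp: Hom_def regular_ihom_def)
  qed
qed

end

section \<open>Internal endomorphisms as universal actions\<close>

locale internal_hom_module = module_category K C M
  for K :: "('k, 'r) ring_scheme"
    and C :: "('c, 'e, 'k, 'x) tensor_cat_scheme" (structure)
    and M :: "('c, 'e, 'o, 'a, 'k, 'y) mod_cat_scheme" +
  fixes ih :: "'o \<Rightarrow> 'o \<Rightarrow> 'c" and ie :: "'o \<Rightarrow> 'o \<Rightarrow> 'a"
  assumes internal_hom: "is_internal_hom C M ih ie"
begin

lemma ih_obj [simp]: "\<lbrakk>N \<in> obj M; P \<in> obj M\<rbrakk> \<Longrightarrow> ih N P \<in> obj C"
  using internal_hom by (simp add: is_internal_hom_def)

lemma ie_arr [simp]:
  assumes "N \<in> obj M" "P \<in> obj M"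
  shows "ie N P \<in> arr M" "src M (ie N P) = ih N P \<rhd> N" "tgt M (ie N P) = P"
  using internal_hom assms by (auto simp: is_internal_hom_def Hom_def)

lemma ie_inject:
  assumes "N \<in> obj M" "P \<in> obj M" "f \<in> arr C" "g \<in> arr C" "src C f = src C g" "tgt C f = ih N P" "tgt C g = ih N P"
    and "ie N P \<cdot> (f \<unrhd> \<kappa> N) = ie N P \<cdot> (g \<unrhd> \<kappa> N)"
  shows "f = g"
proof -
  have "inj_on (\<lambda>f. ie N P \<cdot> (f \<unrhd> \<kappa> N)) (Hom C (src C g) (ih N P))"
    using internal_hom assms(1,2,4) by (auto simp: is_internal_hom_def bij_betw_def)
  then show ?thesis using assms by (auto dest!: inj_onD[where x=f and y=g] simp: Hom_def)
qed

lemma transp_props: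
  assumes X: "X \<in> obj C" "N \<in> obj M" "P \<in> obj M" and phi: "\<phi> \<in> arr M" "src M \<phi> = X \<rhd> N" "tgt M \<phi> = P"
  shows "transp C M ih ie X N P \<phi> \<in> arr C" "src C (transp C M ih ie X N P \<phi>) = X"
    "tgt C (transp C M ih ie X N P \<phi>) = ih N P"
    "ie N P \<cdot> (transp C M ih ie X N P \<phi> \<unrhd> \<kappa> N) = \<phi>"
proof -
  have "\<phi> \<in> Hom M (X \<rhd> N) P" using phi by (simp add: Hom_def)
  moreover have "(\<lambda>f. ie N P \<cdot> (f \<unrhd> \<kappa> N)) ` Hom C X (ih N P) = Hom M (X \<rhd> N) P"
    using internal_hom X by (simp add: is_internal_hom_def bij_betw_def)
  ultimately obtain f where f: "f \<in> Hom C X (ih N P)" "ie N P \<cdot> (f \<unrhd> \<kappa> N) = \<phi>"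
    by (force simp: image_iff)
  have "\<exists>!f. f \<in> Hom C X (ih N P) \<and> ie N P \<cdot> (f \<unrhd> \<kappa> N) = \<phi>"
  proof (rule ex1I[of _ f])
    fix g assume g: "g \<in> Hom C X (ih N P) \<and> ie N P \<cdot> (g \<unrhd> \<kappa> N) = \<phi>"
    show "g = f" by (rule ie_inject[of N P]) (use f g X in \<open>auto simp: Hom_def\<close>)
  qed (use f in auto)
  from theI'[OF this] show "transp C M ih ie X N P \<phi> \<in> arr C" "src C (transp C M ih ie X N P \<phi>) = X"
    "tgt C (transp C M ih ie X N P \<phi>) = ih N P"
    "ie N P \<cdot> (transp C M ih ie X N P \<phi> \<unrhd> \<kappa> N) = \<phi>"
    unfolding transp_def Hom_def by blast+
qed

lemma ihom_arr_props:
  assumes "f \<in> arr M" "g \<in> arr M" "src M f = N" "tgt M f = N'" "src M g = P" "tgt M g = P'"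
  shows "ihom_arr C M ih ie f g \<in> arr C" "src C (ihom_arr C M ih ie f g) = ih N' P"
    "tgt C (ihom_arr C M ih ie f g) = ih N P'"
    "ie N P' \<cdot> (ihom_arr C M ih ie f g \<unrhd> \<kappa> N) = g \<cdot> ie N' P \<cdot> (\<iota> (ih N' P) \<unrhd> f)"
proof -
  have [simp]: "N \<in> obj M" "N' \<in> obj M" "P \<in> obj M" "P' \<in> obj M" using assms by auto
  have phi: "g \<cdot> ie N' P \<cdot> (\<iota> (ih N' P) \<unrhd> f) \<in> arr M" "src M (g \<cdot> ie N' P \<cdot> (\<iota> (ih N' P) \<unrhd> f)) = ih N' P \<rhd> N"
    "tgt M (g \<cdot> ie N' P \<cdot> (\<iota> (ih N' P) \<unrhd> f)) = P'"
    using assms by auto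
  show "ihom_arr C M ih ie f g \<in> arr C" "src C (ihom_arr C M ih ie f g) = ih N' P"
    "tgt C (ihom_arr C M ih ie f g) = ih N P'"
    "ie N P' \<cdot> (ihom_arr C M ih ie f g \<unrhd> \<kappa> N) = g \<cdot> ie N' P \<cdot> (\<iota> (ih N' P) \<unrhd> f)"
    unfolding ihom_arr_def Let_def assms using transp_props[OF _ _ _ phi] by simp_all
qed

text \<open>A family \<open>q N : B \<rightarrow> [N, N]\<close> corresponds to a family \<open>B \<rhd> N \<rightarrow> N\<close>. Transposing both sides of
the dinaturality condition at \<open>h\<close> gives exactly the naturality square of the latter at \<open>h\<close>.\<close>

lemma dinatural_iff:
  assumes B: "B \<in> obj C" and q: "\<And>N. N \<in> obj M \<Longrightarrow> q N \<in> Hom C B (ih N N)"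
  shows "dinatural_cone C M ih (ihom_arr C M ih ie) B q \<longleftrightarrow>
    (\<forall>h \<in> arr M. (ie (tgt M h) (tgt M h) \<cdot> (q (tgt M h) \<unrhd> \<kappa> (tgt M h))) \<cdot> (\<iota> B \<unrhd> h) =
       h \<cdot> ie (src M h) (src M h) \<cdot> (q (src M h) \<unrhd> \<kappa> (src M h)))"
proof -
  have q' [simp]: "q N \<in> arr C" "src C (q N) = B" "tgt C (q N) = ih N N" if "N \<in> obj M" for N
    using q[OF that] by (auto simp: Hom_def)
  note B [simp]
  have *: "ihom_arr C M ih ie (\<kappa> (src M h)) h \<bullet> q (src M h) = ihom_arr C M ih ie h (\<kappa> (tgt M h)) \<bullet> q (tgt M h) \<longleftrightarrow>
     (ie (tgt M h) (tgt M h) \<cdot> (q (tgt M h) \<unrhd> \<kappa> (tgt M h))) \<cdot> (\<iota> B \<unrhd> h) =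
       h \<cdot> ie (src M h) (src M h) \<cdot> (q (src M h) \<unrhd> \<kappa> (src M h))" (is "?l = ?r \<longleftrightarrow> _") if h [simp]: "h \<in> arr M" for h
  proof -
    let ?X = "src M h" and ?Y = "tgt M h"
    note i1 [simp] = ihom_arr_props[of "\<kappa> ?X" h ?X ?X ?X ?Y, simplified]
      and i2 [simp] = ihom_arr_props[of h "\<kappa> ?Y" ?X ?Y ?Y ?Y, simplified]
    have l: "ie ?X ?Y \<cdot> (?l \<unrhd> \<kappa> ?X) = h \<cdot> ie ?X ?X \<cdot> (q ?X \<unrhd> \<kappa> ?X)"
    proof -
      have "ie ?X ?Y \<cdot> (?l \<unrhd> \<kappa> ?X) = ie ?X ?Y \<cdot> (ihom_arr C M ih ie (\<kappa> ?X) h \<unrhd> \<kappa> ?X) \<cdot> (q ?X \<unrhd> \<kappa> ?X)"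
        by (simp add: merge_action del: i1(4))
      then show ?thesis by (simp add: i1(4)[THEN M.cmp_extend])
    qed
    have r: "ie ?X ?Y \<cdot> (?r \<unrhd> \<kappa> ?X) = ie ?Y ?Y \<cdot> (q ?Y \<unrhd> \<kappa> ?Y) \<cdot> (\<iota> B \<unrhd> h)"
    proof -
      have "ie ?X ?Y \<cdot> (?r \<unrhd> \<kappa> ?X) = ie ?X ?Y \<cdot> (ihom_arr C M ih ie h (\<kappa> ?Y) \<unrhd> \<kappa> ?X) \<cdot> (q ?Y \<unrhd> \<kappa> ?X)"
        by (simp add: merge_action del: i2(4))
      then show ?thesis by (simp add: i2(4)[THEN M.cmp_extend]) (simp add: merge_action)
    qed
    have "?l = ?r \<longleftrightarrow> ie ?X ?Y \<cdot> (?l \<unrhd> \<kappa> ?X) = ie ?X ?Y \<cdot> (?r \<unrhd> \<kappa> ?X)"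
    proof
      assume "ie ?X ?Y \<cdot> (?l \<unrhd> \<kappa> ?X) = ie ?X ?Y \<cdot> (?r \<unrhd> \<kappa> ?X)"
      then show "?l = ?r" by (rule ie_inject[rotated -1]) simp_all
    qed simp
    also have "\<dots> \<longleftrightarrow> h \<cdot> ie ?X ?X \<cdot> (q ?X \<unrhd> \<kappa> ?X) = ie ?Y ?Y \<cdot> (q ?Y \<unrhd> \<kappa> ?Y) \<cdot> (\<iota> B \<unrhd> h)"
      by (simp only: l r)
    finally show ?thesis by (auto simp: eq_commute)
  qed
  have "dinatural_cone C M ih (ihom_arr C M ih ie) B q \<longleftrightarrow> (\<forall>h \<in> arr M.
      ihom_arr C M ih ie (\<kappa> (src M h)) h \<bullet> q (src M h) = ihom_arr C M ih ie h (\<kappa> (tgt M h)) \<bullet> q (tgt M h))"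
    using q by (auto simp: dinatural_cone_def Hom_def)
  then show ?thesis using * by simp
qed

end

locale endomorphism_cone = internal_hom_module K C M ih ie
  for K :: "('k, 'r) ring_scheme"
    and C :: "('c, 'e, 'k, 'x) tensor_cat_scheme" (structure)
    and M :: "('c, 'e, 'o, 'a, 'k, 'y) mod_cat_scheme" and ih ie +
  fixes A :: 'c and p :: "'o \<Rightarrow> 'e"
  assumes A_obj [simp]: "A \<in> obj C"
    and p_hom: "N \<in> obj M \<Longrightarrow> p N \<in> Hom C A (ih N N)"
begin

lemma p_arr [simp]:
  assumes "N \<in> obj M"
  shows "p N \<in> arr C" "src C (p N) = A" "tgt C (p N) = ih N N"
  using p_hom[OF assms] by (auto simp: Hom_def)

definition ev :: "'o \<Rightarrow> 'a" where
  "ev N = ie N N \<cdot> (p N \<unrhd> \<kappa> N)"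

lemma ev_arr [simp]:
  assumes "N \<in> obj M"
  shows "ev N \<in> arr M" "src M (ev N) = A \<rhd> N" "tgt M (ev N) = N"
  using assms by (auto simp: ev_def)

end

text \<open>The universal property of the end, stated for actions: \<open>A\<close> represents the functor that sends \<open>B\<close> to
the set of natural families \<open>B \<rhd> N \<rightarrow> N\<close>. In this form it can be verified for the regular module
category directly from the universal property of \<open>Z \<one>\<close>.\<close>

locale universal_action = endomorphism_cone K C M ih ie A p
  for K :: "('k, 'r) ring_scheme"
    and C :: "('c, 'e, 'k, 'x) tensor_cat_scheme" (structure)
    and M :: "('c, 'e, 'o, 'a, 'k, 'y) mod_cat_scheme" and ih ie A p +
  assumes ev_nat: "\<lbrakk>g \<in> arr M; tgt M g = N\<rbrakk> \<Longrightarrow> ev N \<cdot> (\<iota> A \<unrhd> g) = g \<cdot> ev (src M g)"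
    and ev_universal: "\<lbrakk>B \<in> obj C; \<And>N. N \<in> obj M \<Longrightarrow> t N \<in> Hom M (B \<rhd> N) N;
        \<And>g. g \<in> arr M \<Longrightarrow> t (tgt M g) \<cdot> (\<iota> B \<unrhd> g) = g \<cdot> t (src M g)\<rbrakk>
      \<Longrightarrow> \<exists>!u. u \<in> Hom C B A \<and> (\<forall>N \<in> obj M. ev N \<cdot> (u \<unrhd> \<kappa> N) = t N)"

lemma (in internal_hom_module) universal_action_of_end:
  assumes end_A: "is_end C M ih (ihom_arr C M ih ie) A p"
  shows "universal_action K C M ih ie A p"
proof -
  have cone: "dinatural_cone C M ih (ihom_arr C M ih ie) A p" using end_A by (simp add: is_end_def)
  interpret endomorphism_cone K C M ih ie A p
    by unfold_locales (use cone in \<open>auto simp: dinatural_cone_def\<close>)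
  show ?thesis
  proof
    fix g N assume [simp]: "g \<in> arr M" and "tgt M g = N"
    then show "ev N \<cdot> (\<iota> A \<unrhd> g) = g \<cdot> ev (src M g)"
      using cone dinatural_iff[OF A_obj p_hom] unfolding ev_def by blast
  next
    fix B t assume B [simp]: "B \<in> obj C" and t: "\<And>N. N \<in> obj M \<Longrightarrow> t N \<in> Hom M (B \<rhd> N) N"
      and nat: "\<And>g. g \<in> arr M \<Longrightarrow> t (tgt M g) \<cdot> (\<iota> B \<unrhd> g) = g \<cdot> t (src M g)"
    let ?q = "\<lambda>N. transp C M ih ie B N N (t N)"
    have q: "?q N \<in> Hom C B (ih N N)" "ie N N \<cdot> (?q N \<unrhd> \<kappa> N) = t N" if "N \<in> obj M" for N
      using transp_props[OF B that that, of "t N"] t[OF that] by (auto simp: Hom_def)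
    have "dinatural_cone C M ih (ihom_arr C M ih ie) B ?q"
      using dinatural_iff[OF B q(1)] nat by (simp add: q(2))
    then have *: "\<exists>!u. u \<in> Hom C B A \<and> (\<forall>N \<in> obj M. p N \<bullet> u = ?q N)"
      using end_A unfolding is_end_def by blast
    have eq: "p N \<bullet> u = ?q N \<longleftrightarrow> ev N \<cdot> (u \<unrhd> \<kappa> N) = t N" if [simp]: "N \<in> obj M" and u: "u \<in> Hom C B A" for u N
    proof -
      have [simp]: "u \<in> arr C" "src C u = B" "tgt C u = A" using u by (auto simp: Hom_def)
      have [simp]: "?q N \<in> arr C" "src C (?q N) = B" "tgt C (?q N) = ih N N"
        using q(1)[of N] by (auto simp: Hom_def)
      have e: "ie N N \<cdot> ((p N \<bullet> u) \<unrhd> \<kappa> N) = ev N \<cdot> (u \<unrhd> \<kappa> N)"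
        by (simp add: ev_def merge_action)
      show ?thesis
      proof
        assume "p N \<bullet> u = ?q N"
        then show "ev N \<cdot> (u \<unrhd> \<kappa> N) = t N" using q(2)[of N] e by simp
      next
        assume "ev N \<cdot> (u \<unrhd> \<kappa> N) = t N"
        then have "ie N N \<cdot> ((p N \<bullet> u) \<unrhd> \<kappa> N) = ie N N \<cdot> (?q N \<unrhd> \<kappa> N)" using q(2)[of N] e by simp
        then show "p N \<bullet> u = ?q N" by (rule ie_inject[rotated -1]) simp_all
      qed
    qed
    show "\<exists>!u. u \<in> Hom C B A \<and> (\<forall>N \<in> obj M. ev N \<cdot> (u \<unrhd> \<kappa> N) = t N)"
      using * eq by (smt (verit) Ball_def)
  qed
qed

context universal_action
begin

lemma ev_cancel:
  assumes "u \<in> arr C" "v \<in> arr C" "src C u = src C v" "tgt C u = A" "tgt C v = A"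
    and eq: "\<And>N. N \<in> obj M \<Longrightarrow> ev N \<cdot> (u \<unrhd> \<kappa> N) = ev N \<cdot> (v \<unrhd> \<kappa> N)"
  shows "u = v"
proof -
  have [simp]: "u \<in> arr C" "v \<in> arr C" "src C u = src C v" "tgt C u = A" "tgt C v = A" using assms by auto
  have "\<exists>!w. w \<in> Hom C (src C v) A \<and> (\<forall>N \<in> obj M. ev N \<cdot> (w \<unrhd> \<kappa> N) = ev N \<cdot> (v \<unrhd> \<kappa> N))"
  proof (rule ev_universal)
    fix g assume [simp]: "g \<in> arr M"
    have "(ev (tgt M g) \<cdot> (v \<unrhd> \<kappa> (tgt M g))) \<cdot> (\<iota> (src C v) \<unrhd> g)
      = ev (tgt M g) \<cdot> (\<iota> A \<unrhd> g) \<cdot> (v \<unrhd> \<kappa> (src M g))"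
      by (simp add: merge_action)
    also have "\<dots> = g \<cdot> ev (src M g) \<cdot> (v \<unrhd> \<kappa> (src M g))"
      by (simp add: ev_nat[THEN M.cmp_extend])
    finally show "(ev (tgt M g) \<cdot> (v \<unrhd> \<kappa> (tgt M g))) \<cdot> (\<iota> (src C v) \<unrhd> g)
      = g \<cdot> ev (src M g) \<cdot> (v \<unrhd> \<kappa> (src M g))" .
  qed (auto simp: Hom_def)
  moreover have "u \<in> Hom C (src C v) A \<and> (\<forall>N \<in> obj M. ev N \<cdot> (u \<unrhd> \<kappa> N) = ev N \<cdot> (v \<unrhd> \<kappa> N))"
    "v \<in> Hom C (src C v) A \<and> (\<forall>N \<in> obj M. ev N \<cdot> (v \<unrhd> \<kappa> N) = ev N \<cdot> (v \<unrhd> \<kappa> N))"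
    using eq by (auto simp: Hom_def)
  ultimately show ?thesis by blast
qed

text \<open>A morphism \<open>s : B \<rightarrow> X \<otimes> A\<close> acts as \<open>B \<rhd> N \<rightarrow> X \<rhd> N\<close>. Its transpose \<open>X\<^sup>* \<otimes> B \<rightarrow> A\<close> under
duality acts on \<open>N\<close> by the transpose of that family. As transposition is injective, the
universal property of \<open>A\<close> carries over to \<open>X \<otimes> A\<close>: this is done in the next two lemmas.\<close>

lemma tensor_ev_bend:
  assumes "X \<in> obj C" "N \<in> obj M" "s \<in> arr C" "tgt C s = X \<otimes>\<^sub>o A"
  shows "ev N \<cdot> ((lcounit X A \<bullet> (\<iota> (ldual C X) \<otimes>\<^sub>a s)) \<unrhd> \<kappa> N) =
    aev X N \<cdot> (\<iota> (ldual C X) \<unrhd> ((\<iota> X \<unrhd> ev N) \<cdot> masc M X A N \<cdot> (s \<unrhd> \<kappa> N))) \<cdot> masc M (ldual C X) (src C s) N"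
proof -
  let ?D = "ldual C X"
  have [simp]: "X \<in> obj C" "N \<in> obj M" "s \<in> arr C" "tgt C s = X \<otimes>\<^sub>o A" using assms by auto
  have "ev N \<cdot> ((lcounit X A \<bullet> (\<iota> ?D \<otimes>\<^sub>a s)) \<unrhd> \<kappa> N)
    = ev N \<cdot> (lcounit X A \<unrhd> \<kappa> N) \<cdot> ((\<iota> ?D \<otimes>\<^sub>a s) \<unrhd> \<kappa> N)"
    by (simp add: merge_action)
  also have "lcounit X A \<unrhd> \<kappa> N = aev X (A \<rhd> N) \<cdot> (\<iota> ?D \<unrhd> masc M X A N) \<cdot> masc M ?D (X \<otimes>\<^sub>o A) N"
    by (simp add: aev_action)
  also have "ev N \<cdot> (aev X (A \<rhd> N) \<cdot> (\<iota> ?D \<unrhd> masc M X A N) \<cdot> masc M ?D (X \<otimes>\<^sub>o A) N) \<cdot> ((\<iota> ?D \<otimes>\<^sub>a s) \<unrhd> \<kappa> N)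
    = (ev N \<cdot> aev X (A \<rhd> N)) \<cdot> (\<iota> ?D \<unrhd> masc M X A N) \<cdot> (\<iota> ?D \<unrhd> (s \<unrhd> \<kappa> N)) \<cdot> masc M ?D (src C s) N"
    by (simp add: nat_action)
  also have "ev N \<cdot> aev X (A \<rhd> N) = aev X N \<cdot> (\<iota> ?D \<unrhd> \<iota> X \<unrhd> ev N)"
    by (simp add: aev_nat)
  also have "(aev X N \<cdot> (\<iota> ?D \<unrhd> \<iota> X \<unrhd> ev N)) \<cdot> (\<iota> ?D \<unrhd> masc M X A N) \<cdot> (\<iota> ?D \<unrhd> (s \<unrhd> \<kappa> N)) \<cdot> masc M ?D (src C s) N
    = aev X N \<cdot> (\<iota> ?D \<unrhd> ((\<iota> X \<unrhd> ev N) \<cdot> masc M X A N \<cdot> (s \<unrhd> \<kappa> N))) \<cdot> masc M ?D (src C s) N"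
    by (simp add: merge_action)
  finally show ?thesis .
qed

lemma tensor_ev_cancel:
  assumes "X \<in> obj C" "s \<in> arr C" "s' \<in> arr C" "src C s = src C s'" "tgt C s = X \<otimes>\<^sub>o A" "tgt C s' = X \<otimes>\<^sub>o A"
    and eq: "\<And>N. N \<in> obj M \<Longrightarrow> (\<iota> X \<unrhd> ev N) \<cdot> masc M X A N \<cdot> (s \<unrhd> \<kappa> N) = (\<iota> X \<unrhd> ev N) \<cdot> masc M X A N \<cdot> (s' \<unrhd> \<kappa> N)"
  shows "s = s'"
proof (rule lcounit_inject[of X A])
  show "lcounit X A \<bullet> (\<iota> (ldual C X) \<otimes>\<^sub>a s) = lcounit X A \<bullet> (\<iota> (ldual C X) \<otimes>\<^sub>a s')"
  proof (rule ev_cancel)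
    fix N assume N: "N \<in> obj M"
    show "ev N \<cdot> ((lcounit X A \<bullet> (\<iota> (ldual C X) \<otimes>\<^sub>a s)) \<unrhd> \<kappa> N) =
      ev N \<cdot> ((lcounit X A \<bullet> (\<iota> (ldual C X) \<otimes>\<^sub>a s')) \<unrhd> \<kappa> N)"
      using tensor_ev_bend[OF \<open>X \<in> obj C\<close> N \<open>s \<in> arr C\<close> \<open>tgt C s = X \<otimes>\<^sub>o A\<close>]
        tensor_ev_bend[OF \<open>X \<in> obj C\<close> N \<open>s' \<in> arr C\<close> \<open>tgt C s' = X \<otimes>\<^sub>o A\<close>]
        eq[OF N] \<open>src C s = src C s'\<close> by simp
  qed (use assms in simp_all)
qed (use assms in simp_all)

lemma tensor_ev_universal:
  assumes X: "X \<in> obj C" and B: "B \<in> obj C" and t: "\<And>N. N \<in> obj M \<Longrightarrow> t N \<in> Hom M (B \<rhd> N) (X \<rhd> N)"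
    and nat: "\<And>g. g \<in> arr M \<Longrightarrow> t (tgt M g) \<cdot> (\<iota> B \<unrhd> g) = (\<iota> X \<unrhd> g) \<cdot> t (src M g)"
  obtains s where "s \<in> Hom C B (X \<otimes>\<^sub>o A)" "\<And>N. N \<in> obj M \<Longrightarrow> (\<iota> X \<unrhd> ev N) \<cdot> masc M X A N \<cdot> (s \<unrhd> \<kappa> N) = t N"
proof -
  let ?D = "ldual C X"
  note X [simp] B [simp]
  have [simp]: "t N \<in> arr M" "src M (t N) = B \<rhd> N" "tgt M (t N) = X \<rhd> N" if "N \<in> obj M" for N
    using t[OF that] by (auto simp: Hom_def)
  let ?t = "\<lambda>N. aev X N \<cdot> (\<iota> ?D \<unrhd> t N) \<cdot> masc M ?D B N"
  have "\<exists>!u. u \<in> Hom C (?D \<otimes>\<^sub>o B) A \<and> (\<forall>N \<in> obj M. ev N \<cdot> (u \<unrhd> \<kappa> N) = ?t N)"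
  proof (rule ev_universal)
    fix g assume [simp]: "g \<in> arr M"
    have "?t (tgt M g) \<cdot> (\<iota> (?D \<otimes>\<^sub>o B) \<unrhd> g)
      = aev X (tgt M g) \<cdot> (\<iota> ?D \<unrhd> t (tgt M g)) \<cdot> (\<iota> ?D \<unrhd> \<iota> B \<unrhd> g) \<cdot> masc M ?D B (src M g)"
      by (simp add: nat_action)
    also have "\<dots> = aev X (tgt M g) \<cdot> (\<iota> ?D \<unrhd> \<iota> X \<unrhd> g) \<cdot> (\<iota> ?D \<unrhd> t (src M g)) \<cdot> masc M ?D B (src M g)"
      by (simp add: merge_action nat)
    also have "\<dots> = g \<cdot> ?t (src M g)"
      by (simp add: aev_nat[THEN M.cmp_extend])
    finally show "?t (tgt M g) \<cdot> (\<iota> (?D \<otimes>\<^sub>o B) \<unrhd> g) = g \<cdot> ?t (src M g)" .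
  qed (auto simp: Hom_def)
  then obtain u where u: "u \<in> Hom C (?D \<otimes>\<^sub>o B) A" and ev_u: "\<And>N. N \<in> obj M \<Longrightarrow> ev N \<cdot> (u \<unrhd> \<kappa> N) = ?t N" by blast
  have [simp]: "u \<in> arr C" "src C u = ?D \<otimes>\<^sub>o B" "tgt C u = A" using u by (auto simp: Hom_def)
  \<comment> \<open>The transpose of \<open>u\<close> back to a morphism into \<open>X \<otimes> A\<close>.\<close>
  let ?s = "(\<iota> X \<otimes>\<^sub>a u) \<bullet> lunit X B"
  show ?thesis
  proof
    show "?s \<in> Hom C B (X \<otimes>\<^sub>o A)" by (rule HomI) simp_all
    fix N assume [simp]: "N \<in> obj M"
    have "(\<iota> X \<unrhd> ev N) \<cdot> masc M X A N \<cdot> (?s \<unrhd> \<kappa> N)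
      = (\<iota> X \<unrhd> ev N) \<cdot> masc M X A N \<cdot> ((\<iota> X \<otimes>\<^sub>a u) \<unrhd> \<kappa> N) \<cdot> (lunit X B \<unrhd> \<kappa> N)"
      by (simp add: merge_action)
    also have "\<dots> = (\<iota> X \<unrhd> ev N) \<cdot> (\<iota> X \<unrhd> (u \<unrhd> \<kappa> N)) \<cdot> masc M X (?D \<otimes>\<^sub>o B) N \<cdot> (lunit X B \<unrhd> \<kappa> N)"
      by (simp add: nat_action)
    also have "\<dots> = (\<iota> X \<unrhd> ?t N) \<cdot> masc M X (?D \<otimes>\<^sub>o B) N \<cdot> (lunit X B \<unrhd> \<kappa> N)"
      by (simp add: merge_action ev_u)
    also have "\<dots> = (\<iota> X \<unrhd> (aev X N \<cdot> (\<iota> ?D \<unrhd> t N))) \<cdot> (\<iota> X \<unrhd> masc M ?D B N)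
        \<cdot> masc M X (?D \<otimes>\<^sub>o B) N \<cdot> (lunit X B \<unrhd> \<kappa> N)"
      by (simp add: merge_action)
    also have "\<dots> = (\<iota> X \<unrhd> (aev X N \<cdot> (\<iota> ?D \<unrhd> t N))) \<cdot> acoev X (B \<rhd> N)"
      by (simp add: acoev_action)
    also have "\<dots> = (\<iota> X \<unrhd> aev X N) \<cdot> acoev X (X \<rhd> N) \<cdot> t N"
      by (simp add: acoev_nat merge_action)
    also have "\<dots> = t N"
      by (simp add: aev_acoev[THEN M.cmp_extend])
    finally show "(\<iota> X \<unrhd> ev N) \<cdot> masc M X A N \<cdot> (?s \<unrhd> \<kappa> N) = t N" .
  qed
qed

end

section \<open>The half-braiding\<close>

context universal_action
begin

text \<open>Transposing the defining condition of the half-braiding along \<open>[N, X \<rhd> N]\<close> removes the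
internal Homs: acting on \<open>N\<close> after \<open>s\<close> has to be the action of \<open>A\<close> on \<open>X \<rhd> N\<close>.\<close>

lemma half_braid_condition_iff:
  assumes "X \<in> obj C" "N \<in> obj M" "s \<in> Hom C (A \<otimes>\<^sub>o X) (X \<otimes>\<^sub>o A)"
  shows "ihom_a C M ih ie X N N \<bullet> (\<iota> X \<otimes>\<^sub>a p N) \<bullet> s = ihom_b C M ih ie X N (X \<rhd> N) \<bullet> (p (X \<rhd> N) \<otimes>\<^sub>a \<iota> X)
    \<longleftrightarrow> (\<iota> X \<unrhd> ev N) \<cdot> masc M X A N \<cdot> (s \<unrhd> \<kappa> N) = ev (X \<rhd> N) \<cdot> masc M A X N"
    (is "?l = ?r \<longleftrightarrow> ?L = ?R")
proof -
  have [simp]: "X \<in> obj C" "N \<in> obj M" "s \<in> arr C" "src C s = A \<otimes>\<^sub>o X" "tgt C s = X \<otimes>\<^sub>o A"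
    using assms by (auto simp: Hom_def)
  let ?a = "(\<iota> X \<unrhd> ie N N) \<cdot> masc M X (ih N N) N"
  let ?b = "ie (X \<rhd> N) (X \<rhd> N) \<cdot> masc M (ih (X \<rhd> N) (X \<rhd> N)) X N"
  have a [simp]: "ihom_a C M ih ie X N N \<in> arr C" "src C (ihom_a C M ih ie X N N) = X \<otimes>\<^sub>o ih N N"
      "tgt C (ihom_a C M ih ie X N N) = ih N (X \<rhd> N)"
    and a_eq: "ie N (X \<rhd> N) \<cdot> (ihom_a C M ih ie X N N \<unrhd> \<kappa> N) = ?a"
    using transp_props[of "X \<otimes>\<^sub>o ih N N" N "X \<rhd> N" ?a] by (simp_all add: ihom_a_def)
  have b [simp]: "ihom_b C M ih ie X N (X \<rhd> N) \<in> arr C"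
      "src C (ihom_b C M ih ie X N (X \<rhd> N)) = ih (X \<rhd> N) (X \<rhd> N) \<otimes>\<^sub>o X"
      "tgt C (ihom_b C M ih ie X N (X \<rhd> N)) = ih N (X \<rhd> N)"
    and b_eq: "ie N (X \<rhd> N) \<cdot> (ihom_b C M ih ie X N (X \<rhd> N) \<unrhd> \<kappa> N) = ?b"
    using transp_props[of "ih (X \<rhd> N) (X \<rhd> N) \<otimes>\<^sub>o X" N "X \<rhd> N" ?b] by (simp_all add: ihom_b_def)
  have l: "ie N (X \<rhd> N) \<cdot> (?l \<unrhd> \<kappa> N) = ?L"
  proof -
    have "ie N (X \<rhd> N) \<cdot> (?l \<unrhd> \<kappa> N)
      = ie N (X \<rhd> N) \<cdot> (ihom_a C M ih ie X N N \<unrhd> \<kappa> N) \<cdot> ((\<iota> X \<otimes>\<^sub>a p N) \<unrhd> \<kappa> N) \<cdot> (s \<unrhd> \<kappa> N)"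
      by (simp add: merge_action)
    also have "\<dots> = (\<iota> X \<unrhd> ie N N) \<cdot> (\<iota> X \<unrhd> (p N \<unrhd> \<kappa> N)) \<cdot> masc M X A N \<cdot> (s \<unrhd> \<kappa> N)"
      by (simp add: a_eq[THEN M.cmp_extend] nat_action)
    also have "\<dots> = ?L" by (simp add: ev_def merge_action)
    finally show ?thesis .
  qed
  have r: "ie N (X \<rhd> N) \<cdot> (?r \<unrhd> \<kappa> N) = ?R"
  proof -
    have "ie N (X \<rhd> N) \<cdot> (?r \<unrhd> \<kappa> N)
      = ie N (X \<rhd> N) \<cdot> (ihom_b C M ih ie X N (X \<rhd> N) \<unrhd> \<kappa> N) \<cdot> ((p (X \<rhd> N) \<otimes>\<^sub>a \<iota> X) \<unrhd> \<kappa> N)"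
      by (simp add: merge_action)
    also have "\<dots> = ?R"
      by (simp add: b_eq[THEN M.cmp_extend] nat_action ev_def)
    finally show ?thesis .
  qed
  show ?thesis
  proof
    assume "?l = ?r"
    then show "?L = ?R" using l r by metis
  next
    assume "?L = ?R"
    then have "ie N (X \<rhd> N) \<cdot> (?l \<unrhd> \<kappa> N) = ie N (X \<rhd> N) \<cdot> (?r \<unrhd> \<kappa> N)" by (simp only: l r)
    then show "?l = ?r" by (rule ie_inject[rotated -1]) simp_all
  qed
qed

abbreviation \<sigma> where "\<sigma> \<equiv> half_braid C M ih ie A p"

text \<open>Existence: \<open>N \<mapsto> ev (X \<rhd> N)\<close>, preceded by an associator, is natural in \<open>N\<close> and so is the action of
a unique morphism into \<open>X \<otimes> A\<close>.\<close>

lemma half_braid_props: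
  assumes X: "X \<in> obj C"
  shows "\<sigma> X \<in> Hom C (A \<otimes>\<^sub>o X) (X \<otimes>\<^sub>o A)"
    and "N \<in> obj M \<Longrightarrow> (\<iota> X \<unrhd> ev N) \<cdot> masc M X A N \<cdot> (\<sigma> X \<unrhd> \<kappa> N) = ev (X \<rhd> N) \<cdot> masc M A X N"
proof -
  note X [simp]
  obtain s where s: "s \<in> Hom C (A \<otimes>\<^sub>o X) (X \<otimes>\<^sub>o A)"
    "\<And>N. N \<in> obj M \<Longrightarrow> (\<iota> X \<unrhd> ev N) \<cdot> masc M X A N \<cdot> (s \<unrhd> \<kappa> N) = ev (X \<rhd> N) \<cdot> masc M A X N"
  proof (rule tensor_ev_universal[of X "A \<otimes>\<^sub>o X" "\<lambda>N. ev (X \<rhd> N) \<cdot> masc M A X N"])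
    fix g assume [simp]: "g \<in> arr M"
    show "(ev (X \<rhd> tgt M g) \<cdot> masc M A X (tgt M g)) \<cdot> (\<iota> (A \<otimes>\<^sub>o X) \<unrhd> g) = (\<iota> X \<unrhd> g) \<cdot> ev (X \<rhd> src M g) \<cdot> masc M A X (src M g)"
      by (simp add: nat_action ev_nat ev_nat[THEN M.cmp_extend])
  qed (auto simp: Hom_def)
  let ?P = "\<lambda>s. s \<in> Hom C (A \<otimes>\<^sub>o X) (X \<otimes>\<^sub>o A) \<and> (\<forall>N \<in> obj M.
     ihom_a C M ih ie X N N \<bullet> (\<iota> X \<otimes>\<^sub>a p N) \<bullet> s = ihom_b C M ih ie X N (X \<rhd> N) \<bullet> (p (X \<rhd> N) \<otimes>\<^sub>a \<iota> X))"
  have P: "?P s' \<longleftrightarrow> s' \<in> Hom C (A \<otimes>\<^sub>o X) (X \<otimes>\<^sub>o A) \<and>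
      (\<forall>N \<in> obj M. (\<iota> X \<unrhd> ev N) \<cdot> masc M X A N \<cdot> (s' \<unrhd> \<kappa> N) = ev (X \<rhd> N) \<cdot> masc M A X N)" for s'
    using half_braid_condition_iff[OF X] by blast
  have "\<sigma> X = s"
    unfolding half_braid_def
  proof (rule the_equality)
    show "?P s" using P s by blast
    fix s' assume "?P s'"
    then have s': "s' \<in> Hom C (A \<otimes>\<^sub>o X) (X \<otimes>\<^sub>o A)"
      "\<And>N. N \<in> obj M \<Longrightarrow> (\<iota> X \<unrhd> ev N) \<cdot> masc M X A N \<cdot> (s' \<unrhd> \<kappa> N) = ev (X \<rhd> N) \<cdot> masc M A X N"
      using P by blast+
    show "s' = s"
      by (rule tensor_ev_cancel[of X]) (use s s' in \<open>auto simp: Hom_def\<close>)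
  qed
  then show "\<sigma> X \<in> Hom C (A \<otimes>\<^sub>o X) (X \<otimes>\<^sub>o A)"
    and "N \<in> obj M \<Longrightarrow> (\<iota> X \<unrhd> ev N) \<cdot> masc M X A N \<cdot> (\<sigma> X \<unrhd> \<kappa> N) = ev (X \<rhd> N) \<cdot> masc M A X N"
    using s by auto
qed

lemma half_braid_arr [simp]:
  assumes "X \<in> obj C"
  shows "\<sigma> X \<in> arr C" "src C (\<sigma> X) = A \<otimes>\<^sub>o X" "tgt C (\<sigma> X) = X \<otimes>\<^sub>o A"
  using half_braid_props(1)[OF assms] by (auto simp: Hom_def)

lemma half_braid_ev:
  assumes "X \<in> obj C" "N \<in> obj M"
  shows "(\<iota> X \<unrhd> ev N) \<cdot> masc M X A N \<cdot> (\<sigma> X \<unrhd> \<kappa> N) = ev (X \<rhd> N) \<cdot> masc M A X N"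
  using half_braid_props(2) assms by simp

lemma half_braid_ev_extend:
  assumes "X \<in> obj C" "N \<in> obj M" "w \<in> arr M" "tgt M w = (A \<otimes>\<^sub>o X) \<rhd> N"
  shows "(\<iota> X \<unrhd> ev N) \<cdot> masc M X A N \<cdot> (\<sigma> X \<unrhd> \<kappa> N) \<cdot> w = ev (X \<rhd> N) \<cdot> masc M A X N \<cdot> w"
proof -
  have "((\<iota> X \<unrhd> ev N) \<cdot> masc M X A N \<cdot> (\<sigma> X \<unrhd> \<kappa> N)) \<cdot> w = (ev (X \<rhd> N) \<cdot> masc M A X N) \<cdot> w"
    by (simp only: half_braid_ev[OF assms(1,2)])
  then show ?thesis using assms by simp
qed

text \<open>Both sides act on \<open>N\<close> as \<open>(h \<rhd> N) \<circ> ev (X \<rhd> N)\<close>, where \<open>X\<close> is the source of \<open>h\<close>.\<close>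

lemma half_braid_nat:
  assumes "h \<in> arr C" "tgt C h = Y"
  shows "\<sigma> Y \<bullet> (\<iota> A \<otimes>\<^sub>a h) = (h \<otimes>\<^sub>a \<iota> A) \<bullet> \<sigma> (src C h)"
proof (rule tensor_ev_cancel[of Y])
  have [simp]: "h \<in> arr C" "tgt C h = Y" "Y \<in> obj C" using assms by auto
  fix N assume [simp]: "N \<in> obj M"
  have "(\<iota> Y \<unrhd> ev N) \<cdot> masc M Y A N \<cdot> ((\<sigma> Y \<bullet> (\<iota> A \<otimes>\<^sub>a h)) \<unrhd> \<kappa> N)
    = (\<iota> Y \<unrhd> ev N) \<cdot> masc M Y A N \<cdot> (\<sigma> Y \<unrhd> \<kappa> N) \<cdot> ((\<iota> A \<otimes>\<^sub>a h) \<unrhd> \<kappa> N)"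
    by (simp add: merge_action)
  also have "\<dots> = ev (Y \<rhd> N) \<cdot> (\<iota> A \<unrhd> (h \<unrhd> \<kappa> N)) \<cdot> masc M A (src C h) N"
    by (simp add: half_braid_ev_extend nat_action)
  also have "\<dots> = (h \<unrhd> \<kappa> N) \<cdot> (\<iota> (src C h) \<unrhd> ev N) \<cdot> masc M (src C h) A N \<cdot> (\<sigma> (src C h) \<unrhd> \<kappa> N)"
    by (simp add: ev_nat[THEN M.cmp_extend] half_braid_ev)
  also have "\<dots> = (\<iota> Y \<unrhd> ev N) \<cdot> (h \<unrhd> \<kappa> (A \<rhd> N)) \<cdot> masc M (src C h) A N \<cdot> (\<sigma> (src C h) \<unrhd> \<kappa> N)"
    by (simp add: merge_action)
  also have "\<dots> = (\<iota> Y \<unrhd> ev N) \<cdot> masc M Y A N \<cdot> ((h \<otimes>\<^sub>a \<iota> A) \<unrhd> \<kappa> N) \<cdot> (\<sigma> (src C h) \<unrhd> \<kappa> N)"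
    by (simp add: nat_action)
  also have "\<dots> = (\<iota> Y \<unrhd> ev N) \<cdot> masc M Y A N \<cdot> (((h \<otimes>\<^sub>a \<iota> A) \<bullet> \<sigma> (src C h)) \<unrhd> \<kappa> N)"
    by (simp add: merge_action)
  finally show "(\<iota> Y \<unrhd> ev N) \<cdot> masc M Y A N \<cdot> ((\<sigma> Y \<bullet> (\<iota> A \<otimes>\<^sub>a h)) \<unrhd> \<kappa> N)
    = (\<iota> Y \<unrhd> ev N) \<cdot> masc M Y A N \<cdot> (((h \<otimes>\<^sub>a \<iota> A) \<bullet> \<sigma> (src C h)) \<unrhd> \<kappa> N)" .
qed (use assms in auto)

text \<open>The hexagon. After rebracketing, both sides act on \<open>N\<close> as \<open>A\<close> acts on \<open>X \<rhd> Y \<rhd> N\<close>: the left one by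
naturality of \<open>ev\<close> along the associator, the right one by applying \<open>half_braid_ev\<close> first on \<open>N\<close>
and then on \<open>Y \<rhd> N\<close>.\<close>

lemma half_braid_tensor:
  assumes [simp]: "X \<in> obj C" "Y \<in> obj C"
  shows "\<sigma> (X \<otimes>\<^sub>o Y) \<bullet> asc C A X Y
    = inv_arr C (asc C X Y A) \<bullet> (\<iota> X \<otimes>\<^sub>a \<sigma> Y) \<bullet> asc C X A Y \<bullet> (\<sigma> X \<otimes>\<^sub>a \<iota> Y)" (is "?l = ?r")
proof (rule tensor_ev_cancel[of "X \<otimes>\<^sub>o Y"])
  fix N assume [simp]: "N \<in> obj M"
  show "(\<iota> (X \<otimes>\<^sub>o Y) \<unrhd> ev N) \<cdot> masc M (X \<otimes>\<^sub>o Y) A N \<cdot> (?l \<unrhd> \<kappa> N)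
    = (\<iota> (X \<otimes>\<^sub>o Y) \<unrhd> ev N) \<cdot> masc M (X \<otimes>\<^sub>o Y) A N \<cdot> (?r \<unrhd> \<kappa> N)"
  proof (rule M.iso_mono[of "masc M X Y N"])
    have "masc M X Y N \<cdot> (\<iota> (X \<otimes>\<^sub>o Y) \<unrhd> ev N) \<cdot> masc M (X \<otimes>\<^sub>o Y) A N \<cdot> (?l \<unrhd> \<kappa> N)
      = masc M X Y N \<cdot> (\<iota> (X \<otimes>\<^sub>o Y) \<unrhd> ev N) \<cdot> masc M (X \<otimes>\<^sub>o Y) A N \<cdot> (\<sigma> (X \<otimes>\<^sub>o Y) \<unrhd> \<kappa> N) \<cdot> (asc C A X Y \<unrhd> \<kappa> N)"
      by (simp add: merge_action)
    also have "\<dots> = masc M X Y N \<cdot> ev ((X \<otimes>\<^sub>o Y) \<rhd> N) \<cdot> masc M A (X \<otimes>\<^sub>o Y) N \<cdot> (asc C A X Y \<unrhd> \<kappa> N)"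
      by (simp add: half_braid_ev_extend)
    also have "\<dots> = ev (X \<rhd> Y \<rhd> N) \<cdot> (\<iota> A \<unrhd> masc M X Y N) \<cdot> masc M A (X \<otimes>\<^sub>o Y) N \<cdot> (asc C A X Y \<unrhd> \<kappa> N)"
      by (simp add: ev_nat[THEN M.cmp_extend])
    also have l: "\<dots> = ev (X \<rhd> Y \<rhd> N) \<cdot> masc M A X (Y \<rhd> N) \<cdot> masc M (A \<otimes>\<^sub>o X) Y N"
      by (simp add: module_pentagon)
    finally have l: "masc M X Y N \<cdot> (\<iota> (X \<otimes>\<^sub>o Y) \<unrhd> ev N) \<cdot> masc M (X \<otimes>\<^sub>o Y) A N \<cdot> (?l \<unrhd> \<kappa> N)
      = ev (X \<rhd> Y \<rhd> N) \<cdot> masc M A X (Y \<rhd> N) \<cdot> masc M (A \<otimes>\<^sub>o X) Y N" .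
    let ?w = "(\<iota> X \<otimes>\<^sub>a \<sigma> Y) \<bullet> asc C X A Y \<bullet> (\<sigma> X \<otimes>\<^sub>a \<iota> Y)"
    have "masc M X Y N \<cdot> (\<iota> (X \<otimes>\<^sub>o Y) \<unrhd> ev N) \<cdot> masc M (X \<otimes>\<^sub>o Y) A N \<cdot> (?r \<unrhd> \<kappa> N)
      = (\<iota> X \<unrhd> \<iota> Y \<unrhd> ev N) \<cdot> masc M X Y (A \<rhd> N) \<cdot> masc M (X \<otimes>\<^sub>o Y) A N \<cdot> (?r \<unrhd> \<kappa> N)"
      by (simp add: nat_action)
    also have "\<dots> = (\<iota> X \<unrhd> \<iota> Y \<unrhd> ev N) \<cdot> (\<iota> X \<unrhd> masc M Y A N) \<cdot> masc M X (Y \<otimes>\<^sub>o A) N \<cdot> (asc C X Y A \<unrhd> \<kappa> N)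
        \<cdot> (?r \<unrhd> \<kappa> N)"
      by (simp add: module_pentagon[THEN M.cmp_extend])
    also have "\<dots> = (\<iota> X \<unrhd> \<iota> Y \<unrhd> ev N) \<cdot> (\<iota> X \<unrhd> masc M Y A N) \<cdot> masc M X (Y \<otimes>\<^sub>o A) N
        \<cdot> ((\<iota> X \<otimes>\<^sub>a \<sigma> Y) \<unrhd> \<kappa> N) \<cdot> (asc C X A Y \<unrhd> \<kappa> N) \<cdot> ((\<sigma> X \<otimes>\<^sub>a \<iota> Y) \<unrhd> \<kappa> N)"
      by (simp add: merge_action)
    also have "\<dots> = (\<iota> X \<unrhd> \<iota> Y \<unrhd> ev N) \<cdot> (\<iota> X \<unrhd> masc M Y A N) \<cdot> (\<iota> X \<unrhd> (\<sigma> Y \<unrhd> \<kappa> N)) \<cdot> masc M X (A \<otimes>\<^sub>o Y) N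
        \<cdot> (asc C X A Y \<unrhd> \<kappa> N) \<cdot> ((\<sigma> X \<otimes>\<^sub>a \<iota> Y) \<unrhd> \<kappa> N)"
      by (simp add: nat_action)
    also have "\<dots> = (\<iota> X \<unrhd> (ev (Y \<rhd> N) \<cdot> masc M A Y N)) \<cdot> masc M X (A \<otimes>\<^sub>o Y) N
        \<cdot> (asc C X A Y \<unrhd> \<kappa> N) \<cdot> ((\<sigma> X \<otimes>\<^sub>a \<iota> Y) \<unrhd> \<kappa> N)"
      by (simp add: half_braid_ev[symmetric]) (simp add: merge_action)
    also have "\<dots> = (\<iota> X \<unrhd> ev (Y \<rhd> N)) \<cdot> (\<iota> X \<unrhd> masc M A Y N) \<cdot> masc M X (A \<otimes>\<^sub>o Y) N
        \<cdot> (asc C X A Y \<unrhd> \<kappa> N) \<cdot> ((\<sigma> X \<otimes>\<^sub>a \<iota> Y) \<unrhd> \<kappa> N)"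
      by (simp add: merge_action)
    also have "\<dots> = (\<iota> X \<unrhd> ev (Y \<rhd> N)) \<cdot> masc M X A (Y \<rhd> N) \<cdot> masc M (X \<otimes>\<^sub>o A) Y N \<cdot> ((\<sigma> X \<otimes>\<^sub>a \<iota> Y) \<unrhd> \<kappa> N)"
      by (simp add: module_pentagon[THEN M.cmp_extend])
    also have "\<dots> = ev (X \<rhd> Y \<rhd> N) \<cdot> masc M A X (Y \<rhd> N) \<cdot> masc M (A \<otimes>\<^sub>o X) Y N"
      by (simp add: nat_action half_braid_ev_extend)
    finally show "masc M X Y N \<cdot> (\<iota> (X \<otimes>\<^sub>o Y) \<unrhd> ev N) \<cdot> masc M (X \<otimes>\<^sub>o Y) A N \<cdot> (?l \<unrhd> \<kappa> N)
      = masc M X Y N \<cdot> (\<iota> (X \<otimes>\<^sub>o Y) \<unrhd> ev N) \<cdot> masc M (X \<otimes>\<^sub>o Y) A N \<cdot> (?r \<unrhd> \<kappa> N)"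
      by (simp only: l)
  qed simp_all
qed simp_all

text \<open>By naturality of \<open>ev\<close> along \<open>mun N\<close>, the canonical isomorphism acts as required of \<open>\<sigma> \<one>\<close>.\<close>

lemma half_braid_unit: "\<sigma> \<one>\<^sub>o = inv_arr C (lun C A) \<bullet> run C A"
proof (rule tensor_ev_cancel[of "\<one>\<^sub>o"])
  fix N assume [simp]: "N \<in> obj M"
  have "(\<iota> \<one>\<^sub>o \<unrhd> ev N) \<cdot> masc M \<one>\<^sub>o A N \<cdot> ((inv_arr C (lun C A) \<bullet> run C A) \<unrhd> \<kappa> N)
    = (\<iota> \<one>\<^sub>o \<unrhd> ev N) \<cdot> masc M \<one>\<^sub>o A N \<cdot> (inv_arr C (lun C A) \<unrhd> \<kappa> N) \<cdot> (run C A \<unrhd> \<kappa> N)"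
    by (simp add: merge_action)
  also have "\<dots> = (\<iota> \<one>\<^sub>o \<unrhd> ev N) \<cdot> inv_arr M (mun M (A \<rhd> N)) \<cdot> (run C A \<unrhd> \<kappa> N)"
    by (simp add: mun_action_inv[THEN M.cmp_extend])
  also have "\<dots> = inv_arr M (mun M N) \<cdot> ev N \<cdot> (run C A \<unrhd> \<kappa> N)"
    by (simp add: mun_inv_nat[of "ev N" N, THEN M.cmp_extend])
  also have "\<dots> = inv_arr M (mun M N) \<cdot> ev N \<cdot> (\<iota> A \<unrhd> mun M N) \<cdot> masc M A \<one>\<^sub>o N"
    by (simp add: module_triangle)
  also have "\<dots> = ev (\<one>\<^sub>o \<rhd> N) \<cdot> masc M A \<one>\<^sub>o N"
    by (simp add: ev_nat[THEN M.cmp_extend])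
  finally show "(\<iota> \<one>\<^sub>o \<unrhd> ev N) \<cdot> masc M \<one>\<^sub>o A N \<cdot> (\<sigma> \<one>\<^sub>o \<unrhd> \<kappa> N)
    = (\<iota> \<one>\<^sub>o \<unrhd> ev N) \<cdot> masc M \<one>\<^sub>o A N \<cdot> ((inv_arr C (lun C A) \<bullet> run C A) \<unrhd> \<kappa> N)"
    by (simp only: half_braid_ev[OF unit_obj \<open>N \<in> obj M\<close>])
qed simp_all

end

section \<open>The central Hopf comonad\<close>

locale central_comonad = finite_tensor_category K C
  for K :: "('k, 'r) ring_scheme" and C :: "('c, 'e, 'k, 'x) tensor_cat_scheme" (structure) +
  fixes Z :: "'c \<Rightarrow> 'c" and pz :: "'c \<Rightarrow> 'c \<Rightarrow> 'e"
  assumes Z_end: "is_Z C Z pz"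
begin

lemma Z_cone: "V \<in> obj C \<Longrightarrow> dinatural_cone C C (conj_obj C V) (conj_arr C V) (Z V) (pz V)"
  using Z_end by (simp add: is_Z_def is_end_def)

lemma Z_obj [simp]: "V \<in> obj C \<Longrightarrow> Z V \<in> obj C"
  using Z_cone by (simp add: dinatural_cone_def)

lemma pz_arr [simp]:
  assumes "V \<in> obj C" "X \<in> obj C"
  shows "pz V X \<in> arr C" "src C (pz V X) = Z V" "tgt C (pz V X) = (X \<otimes>\<^sub>o V) \<otimes>\<^sub>o ldual C X"
  using Z_cone[OF assms(1)] assms(2) by (auto simp: dinatural_cone_def conj_obj_def Hom_def)

text \<open>Bending the dinaturality condition at \<open>h\<close> gives the naturality square at \<open>h\<close> of the bent family
\<open>B \<otimes> X \<rightarrow> X \<otimes> V\<close>.\<close>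

lemma conj_dinatural_iff:
  assumes V: "V \<in> obj C" and B: "B \<in> obj C"
    and r: "\<And>X. X \<in> obj C \<Longrightarrow> r X \<in> Hom C B ((X \<otimes>\<^sub>o V) \<otimes>\<^sub>o ldual C X)"
  shows "dinatural_cone C C (conj_obj C V) (conj_arr C V) B r \<longleftrightarrow>
    (\<forall>h \<in> arr C. (h \<otimes>\<^sub>a idt C V) \<bullet> regular_iev C (src C h) (src C h \<otimes>\<^sub>o V) \<bullet> (r (src C h) \<otimes>\<^sub>a idt C (src C h)) =
      regular_iev C (tgt C h) (tgt C h \<otimes>\<^sub>o V) \<bullet> (r (tgt C h) \<otimes>\<^sub>a idt C (tgt C h)) \<bullet> (idt C B \<otimes>\<^sub>a h))"
proof -
  note V [simp] B [simp]
  have [simp]: "r X \<in> arr C" "src C (r X) = B" "tgt C (r X) = (X \<otimes>\<^sub>o V) \<otimes>\<^sub>o ldual C X" if "X \<in> obj C" for X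
    using r[OF that] by (auto simp: Hom_def)
  have *: "conj_arr C V (idt C (src C h)) h \<bullet> r (src C h) = conj_arr C V h (idt C (tgt C h)) \<bullet> r (tgt C h) \<longleftrightarrow>
     (h \<otimes>\<^sub>a idt C V) \<bullet> regular_iev C (src C h) (src C h \<otimes>\<^sub>o V) \<bullet> (r (src C h) \<otimes>\<^sub>a idt C (src C h)) =
      regular_iev C (tgt C h) (tgt C h \<otimes>\<^sub>o V) \<bullet> (r (tgt C h) \<otimes>\<^sub>a idt C (tgt C h)) \<bullet> (idt C B \<otimes>\<^sub>a h)"
    (is "?l = ?r \<longleftrightarrow> ?L = ?R") if [simp]: "h \<in> arr C" for h
  proof -
    let ?X = "src C h" and ?Y = "tgt C h"
    have l: "regular_iev C ?X (?Y \<otimes>\<^sub>o V) \<bullet> (?l \<otimes>\<^sub>a idt C ?X) = ?L"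
    proof -
      have "regular_iev C ?X (?Y \<otimes>\<^sub>o V) \<bullet> (?l \<otimes>\<^sub>a idt C ?X)
        = regular_iev C ?X (?Y \<otimes>\<^sub>o V) \<bullet> (((h \<otimes>\<^sub>a idt C V) \<otimes>\<^sub>a idt C (ldual C ?X)) \<otimes>\<^sub>a idt C ?X) \<bullet> (r ?X \<otimes>\<^sub>a idt C ?X)"
        by (simp add: conj_arr_def merge_tensor)
      then show ?thesis by (simp add: regular_iev_nat[THEN cmp_extend])
    qed
    have r: "regular_iev C ?X (?Y \<otimes>\<^sub>o V) \<bullet> (?r \<otimes>\<^sub>a idt C ?X) = ?R"
    proof -
      have "regular_iev C ?X (?Y \<otimes>\<^sub>o V) \<bullet> (?r \<otimes>\<^sub>a idt C ?X)
        = regular_iev C ?X (?Y \<otimes>\<^sub>o V) \<bullet> ((idt C (?Y \<otimes>\<^sub>o V) \<otimes>\<^sub>a dual_arr C h) \<otimes>\<^sub>a idt C ?X) \<bullet> (r ?Y \<otimes>\<^sub>a idt C ?X)"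
        by (simp add: conj_arr_def merge_tensor)
      also have "\<dots> = regular_iev C ?Y (?Y \<otimes>\<^sub>o V) \<bullet> (idt C ((?Y \<otimes>\<^sub>o V) \<otimes>\<^sub>o ldual C ?Y) \<otimes>\<^sub>a h) \<bullet> (r ?Y \<otimes>\<^sub>a idt C ?X)"
        by (simp add: regular_iev_dual_arr[THEN cmp_extend])
      also have "\<dots> = ?R" by (simp add: merge_tensor)
      finally show ?thesis .
    qed
    have types: "?l \<in> arr C" "?r \<in> arr C" "src C ?l = src C ?r" "tgt C ?l = (?Y \<otimes>\<^sub>o V) \<otimes>\<^sub>o ldual C ?X"
      "tgt C ?r = (?Y \<otimes>\<^sub>o V) \<otimes>\<^sub>o ldual C ?X"
      by (simp_all add: conj_arr_def)
    show ?thesis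
    proof
      assume "?l = ?r"
      then show "?L = ?R" using l r by metis
    next
      assume "?L = ?R"
      then have "regular_iev C ?X (?Y \<otimes>\<^sub>o V) \<bullet> (?l \<otimes>\<^sub>a idt C ?X) = regular_iev C ?X (?Y \<otimes>\<^sub>o V) \<bullet> (?r \<otimes>\<^sub>a idt C ?X)"
        by (simp only: l r)
      then show "?l = ?r" by (rule bend_inject[rotated -1]) (use types in simp_all)
    qed
  qed
  have "dinatural_cone C C (conj_obj C V) (conj_arr C V) B r \<longleftrightarrow> (\<forall>h \<in> arr C.
      conj_arr C V (idt C (src C h)) h \<bullet> r (src C h) = conj_arr C V h (idt C (tgt C h)) \<bullet> r (tgt C h))"
    using r by (auto simp: dinatural_cone_def Hom_def conj_obj_def)
  then show ?thesis using * by simp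
qed

text \<open>The bent projection \<open>Z V \<otimes> X \<rightarrow> X \<otimes> V\<close>, the universal natural family of this shape.\<close>

definition swap :: "'c \<Rightarrow> 'c \<Rightarrow> 'e" where
  "swap V X = regular_iev C X (X \<otimes>\<^sub>o V) \<bullet> (pz V X \<otimes>\<^sub>a idt C X)"

lemma swap_arr [simp]:
  assumes "V \<in> obj C" "X \<in> obj C"
  shows "swap V X \<in> arr C" "src C (swap V X) = Z V \<otimes>\<^sub>o X" "tgt C (swap V X) = X \<otimes>\<^sub>o V"
  using assms by (auto simp: swap_def)

lemma swap_nat:
  assumes V: "V \<in> obj C" and "h \<in> arr C" "tgt C h = Y"
  shows "swap V Y \<bullet> (idt C (Z V) \<otimes>\<^sub>a h) = (h \<otimes>\<^sub>a idt C V) \<bullet> swap V (src C h)"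
proof -
  have "dinatural_cone C C (conj_obj C V) (conj_arr C V) (Z V) (pz V) \<longleftrightarrow>
    (\<forall>h \<in> arr C. (h \<otimes>\<^sub>a idt C V) \<bullet> regular_iev C (src C h) (src C h \<otimes>\<^sub>o V) \<bullet> (pz V (src C h) \<otimes>\<^sub>a idt C (src C h)) =
      regular_iev C (tgt C h) (tgt C h \<otimes>\<^sub>o V) \<bullet> (pz V (tgt C h) \<otimes>\<^sub>a idt C (tgt C h)) \<bullet> (idt C (Z V) \<otimes>\<^sub>a h))"
    by (rule conj_dinatural_iff) (use V in \<open>auto simp: Hom_def\<close>)
  then have "(h \<otimes>\<^sub>a idt C V) \<bullet> regular_iev C (src C h) (src C h \<otimes>\<^sub>o V) \<bullet> (pz V (src C h) \<otimes>\<^sub>a idt C (src C h)) =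
      regular_iev C (tgt C h) (tgt C h \<otimes>\<^sub>o V) \<bullet> (pz V (tgt C h) \<otimes>\<^sub>a idt C (tgt C h)) \<bullet> (idt C (Z V) \<otimes>\<^sub>a h)"
    using Z_cone[OF V] \<open>h \<in> arr C\<close> by blast
  then show ?thesis using assms src_tgt_obj(2)[of h] by (simp add: swap_def)
qed

lemma pz_swap_iff:
  assumes "V \<in> obj C" "X \<in> obj C" "u \<in> arr C" "tgt C u = Z V" "r \<in> arr C" "src C r = src C u"
    "tgt C r = (X \<otimes>\<^sub>o V) \<otimes>\<^sub>o ldual C X"
  shows "pz V X \<bullet> u = r \<longleftrightarrow> swap V X \<bullet> (u \<otimes>\<^sub>a idt C X) = regular_iev C X (X \<otimes>\<^sub>o V) \<bullet> (r \<otimes>\<^sub>a idt C X)"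
proof -
  have [simp]: "V \<in> obj C" "X \<in> obj C" "u \<in> arr C" "tgt C u = Z V" "r \<in> arr C" "src C r = src C u"
    "tgt C r = (X \<otimes>\<^sub>o V) \<otimes>\<^sub>o ldual C X" using assms by auto
  have e: "regular_iev C X (X \<otimes>\<^sub>o V) \<bullet> ((pz V X \<bullet> u) \<otimes>\<^sub>a idt C X) = swap V X \<bullet> (u \<otimes>\<^sub>a idt C X)"
    by (simp add: swap_def merge_tensor)
  show ?thesis
  proof
    assume "swap V X \<bullet> (u \<otimes>\<^sub>a idt C X) = regular_iev C X (X \<otimes>\<^sub>o V) \<bullet> (r \<otimes>\<^sub>a idt C X)"
    then have "regular_iev C X (X \<otimes>\<^sub>o V) \<bullet> ((pz V X \<bullet> u) \<otimes>\<^sub>a idt C X) = regular_iev C X (X \<otimes>\<^sub>o V) \<bullet> (r \<otimes>\<^sub>a idt C X)"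
      by (simp only: e)
    then show "pz V X \<bullet> u = r" by (rule bend_inject[rotated -1]) simp_all
  qed (use e in auto)
qed

lemma Z_universal:
  assumes V: "V \<in> obj C" and B: "B \<in> obj C" and t: "\<And>X. X \<in> obj C \<Longrightarrow> t X \<in> Hom C (B \<otimes>\<^sub>o X) (X \<otimes>\<^sub>o V)"
    and nat: "\<And>h. h \<in> arr C \<Longrightarrow> t (tgt C h) \<bullet> (idt C B \<otimes>\<^sub>a h) = (h \<otimes>\<^sub>a idt C V) \<bullet> t (src C h)"
  shows "\<exists>!u. u \<in> Hom C B (Z V) \<and> (\<forall>X \<in> obj C. swap V X \<bullet> (u \<otimes>\<^sub>a idt C X) = t X)"
proof -
  note V [simp] B [simp]
  have [simp]: "t X \<in> arr C" "src C (t X) = B \<otimes>\<^sub>o X" "tgt C (t X) = X \<otimes>\<^sub>o V" if "X \<in> obj C" for X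
    using t[OF that] by (auto simp: Hom_def)
  let ?r = "\<lambda>X. (t X \<otimes>\<^sub>a idt C (ldual C X)) \<bullet> rcoev B X"
  have r: "?r X \<in> Hom C B ((X \<otimes>\<^sub>o V) \<otimes>\<^sub>o ldual C X)" if "X \<in> obj C" for X
    by (rule HomI) (use that in simp_all)
  have bend: "regular_iev C X (X \<otimes>\<^sub>o V) \<bullet> (?r X \<otimes>\<^sub>a idt C X) = t X" if "X \<in> obj C" for X
    by (rule bend_unbend) (use that in simp_all)
  have "dinatural_cone C C (conj_obj C V) (conj_arr C V) B ?r"
  proof (rule iffD2[OF conj_dinatural_iff[OF V B, of ?r, OF r]], assumption, intro ballI)
    fix h assume [simp]: "h \<in> arr C"
    let ?X = "src C h" and ?Y = "tgt C h"
    have "(h \<otimes>\<^sub>a idt C V) \<bullet> regular_iev C ?X (?X \<otimes>\<^sub>o V) \<bullet> (?r ?X \<otimes>\<^sub>a idt C ?X) = (h \<otimes>\<^sub>a idt C V) \<bullet> t ?X"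
      by (simp only: bend src_tgt_obj \<open>h \<in> arr C\<close>)
    also have "\<dots> = (regular_iev C ?Y (?Y \<otimes>\<^sub>o V) \<bullet> (?r ?Y \<otimes>\<^sub>a idt C ?Y)) \<bullet> (idt C B \<otimes>\<^sub>a h)"
      by (simp only: bend src_tgt_obj \<open>h \<in> arr C\<close> nat)
    also have "\<dots> = regular_iev C ?Y (?Y \<otimes>\<^sub>o V) \<bullet> (?r ?Y \<otimes>\<^sub>a idt C ?Y) \<bullet> (idt C B \<otimes>\<^sub>a h)"
      by simp
    finally show "(h \<otimes>\<^sub>a idt C V) \<bullet> regular_iev C ?X (?X \<otimes>\<^sub>o V) \<bullet> (?r ?X \<otimes>\<^sub>a idt C ?X) =
      regular_iev C ?Y (?Y \<otimes>\<^sub>o V) \<bullet> (?r ?Y \<otimes>\<^sub>a idt C ?Y) \<bullet> (idt C B \<otimes>\<^sub>a h)" .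
  qed
  then have *: "\<exists>!u. u \<in> Hom C B (Z V) \<and> (\<forall>X \<in> obj C. pz V X \<bullet> u = ?r X)"
    using Z_end V unfolding is_Z_def is_end_def by blast
  have "pz V X \<bullet> u = ?r X \<longleftrightarrow> swap V X \<bullet> (u \<otimes>\<^sub>a idt C X) = t X"
    if u: "u \<in> Hom C B (Z V)" and [simp]: "X \<in> obj C" for u X
  proof -
    have [simp]: "u \<in> arr C" "src C u = B" "tgt C u = Z V" using u by (auto simp: Hom_def)
    have "pz V X \<bullet> u = ?r X \<longleftrightarrow> swap V X \<bullet> (u \<otimes>\<^sub>a idt C X) = regular_iev C X (X \<otimes>\<^sub>o V) \<bullet> (?r X \<otimes>\<^sub>a idt C X)"
      by (rule pz_swap_iff) simp_all
    then show ?thesis by (simp only: bend \<open>X \<in> obj C\<close>)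
  qed
  then have "(u \<in> Hom C B (Z V) \<and> (\<forall>X \<in> obj C. pz V X \<bullet> u = ?r X)) \<longleftrightarrow>
    (u \<in> Hom C B (Z V) \<and> (\<forall>X \<in> obj C. swap V X \<bullet> (u \<otimes>\<^sub>a idt C X) = t X))" for u
    by blast
  then show ?thesis using * by simp
qed

lemma Z_map_props:
  assumes g: "g \<in> arr C" "src C g = V" "tgt C g = W"
  shows "Z_map C Z pz g \<in> Hom C (Z V) (Z W)"
    and "X \<in> obj C \<Longrightarrow> swap W X \<bullet> (Z_map C Z pz g \<otimes>\<^sub>a idt C X) = (idt C X \<otimes>\<^sub>a g) \<bullet> swap V X"
proof -
  have [simp]: "g \<in> arr C" "src C g = V" "tgt C g = W" "V \<in> obj C" "W \<in> obj C" using g by auto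
  let ?Q = "\<lambda>u. u \<in> Hom C (Z V) (Z W) \<and> (\<forall>X \<in> obj C. swap W X \<bullet> (u \<otimes>\<^sub>a idt C X) = (idt C X \<otimes>\<^sub>a g) \<bullet> swap V X)"
  let ?P = "\<lambda>u. u \<in> Hom C (Z V) (Z W) \<and>
     (\<forall>X \<in> obj C. pz W X \<bullet> u = ((idt C X \<otimes>\<^sub>a g) \<otimes>\<^sub>a idt C (ldual C X)) \<bullet> pz V X)"
  have ex: "\<exists>!u. ?Q u"
  proof (rule Z_universal)
    fix h assume [simp]: "h \<in> arr C"
    have "((idt C (tgt C h) \<otimes>\<^sub>a g) \<bullet> swap V (tgt C h)) \<bullet> (idt C (Z V) \<otimes>\<^sub>a h)
      = (idt C (tgt C h) \<otimes>\<^sub>a g) \<bullet> (h \<otimes>\<^sub>a idt C V) \<bullet> swap V (src C h)"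
      by (simp add: swap_nat)
    also have "\<dots> = (h \<otimes>\<^sub>a idt C W) \<bullet> (idt C (src C h) \<otimes>\<^sub>a g) \<bullet> swap V (src C h)"
      by (simp add: merge_tensor)
    finally show "((idt C (tgt C h) \<otimes>\<^sub>a g) \<bullet> swap V (tgt C h)) \<bullet> (idt C (Z V) \<otimes>\<^sub>a h)
      = (h \<otimes>\<^sub>a idt C W) \<bullet> (idt C (src C h) \<otimes>\<^sub>a g) \<bullet> swap V (src C h)" .
  qed (auto simp: Hom_def)
  have "pz W X \<bullet> u = ((idt C X \<otimes>\<^sub>a g) \<otimes>\<^sub>a idt C (ldual C X)) \<bullet> pz V X \<longleftrightarrow>
      swap W X \<bullet> (u \<otimes>\<^sub>a idt C X) = (idt C X \<otimes>\<^sub>a g) \<bullet> swap V X"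
    if u: "u \<in> Hom C (Z V) (Z W)" and [simp]: "X \<in> obj C" for u X
  proof -
    have [simp]: "u \<in> arr C" "src C u = Z V" "tgt C u = Z W" using u by (auto simp: Hom_def)
    let ?r = "((idt C X \<otimes>\<^sub>a g) \<otimes>\<^sub>a idt C (ldual C X)) \<bullet> pz V X"
    have "regular_iev C X (X \<otimes>\<^sub>o W) \<bullet> (?r \<otimes>\<^sub>a idt C X) = regular_iev C X (X \<otimes>\<^sub>o W) \<bullet>
        (((idt C X \<otimes>\<^sub>a g) \<otimes>\<^sub>a idt C (ldual C X)) \<otimes>\<^sub>a idt C X) \<bullet> (pz V X \<otimes>\<^sub>a idt C X)"
      by (simp add: merge_tensor)
    also have "\<dots> = (idt C X \<otimes>\<^sub>a g) \<bullet> swap V X"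
      by (simp add: regular_iev_nat[THEN cmp_extend] swap_def)
    finally have e: "regular_iev C X (X \<otimes>\<^sub>o W) \<bullet> (?r \<otimes>\<^sub>a idt C X) = (idt C X \<otimes>\<^sub>a g) \<bullet> swap V X" .
    have "pz W X \<bullet> u = ?r \<longleftrightarrow> swap W X \<bullet> (u \<otimes>\<^sub>a idt C X) = regular_iev C X (X \<otimes>\<^sub>o W) \<bullet> (?r \<otimes>\<^sub>a idt C X)"
      by (rule pz_swap_iff) simp_all
    then show ?thesis by (simp only: e)
  qed
  then have "?P u \<longleftrightarrow> ?Q u" for u by blast
  then have "Z_map C Z pz g = (THE u. ?Q u)" by (simp add: Z_map_def)
  then have "?Q (Z_map C Z pz g)" using theI'[OF ex] by simp
  then show "Z_map C Z pz g \<in> Hom C (Z V) (Z W)"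
    and "X \<in> obj C \<Longrightarrow> swap W X \<bullet> (Z_map C Z pz g \<otimes>\<^sub>a idt C X) = (idt C X \<otimes>\<^sub>a g) \<bullet> swap V X"
    by auto
qed

lemma Z_map_arr [simp]:
  assumes "g \<in> arr C"
  shows "Z_map C Z pz g \<in> arr C" "src C (Z_map C Z pz g) = Z (src C g)" "tgt C (Z_map C Z pz g) = Z (tgt C g)"
  using Z_map_props(1)[OF assms refl refl] by (auto simp: Hom_def)

text \<open>The universal action \<open>Z \<one> \<otimes> X \<rightarrow> X\<close>, which by \<open>regular_proj_bend\<close> is the action \<open>ev\<close> of the
regular module category.\<close>

definition unit_swap :: "'c \<Rightarrow> 'e" where
  "unit_swap X = run C X \<bullet> swap \<one>\<^sub>o X"

lemma unit_swap_arr [simp]: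
  assumes "X \<in> obj C"
  shows "unit_swap X \<in> arr C" "src C (unit_swap X) = Z \<one>\<^sub>o \<otimes>\<^sub>o X" "tgt C (unit_swap X) = X"
  using assms by (auto simp: unit_swap_def)

lemma regular_proj_arr [simp]:
  assumes "X \<in> obj C"
  shows "regular_proj C pz X \<in> arr C" "src C (regular_proj C pz X) = Z \<one>\<^sub>o"
    "tgt C (regular_proj C pz X) = X \<otimes>\<^sub>o ldual C X"
  using assms by (auto simp: regular_proj_def)

lemma regular_proj_bend:
  assumes [simp]: "X \<in> obj C"
  shows "regular_iev C X X \<bullet> (regular_proj C pz X \<otimes>\<^sub>a idt C X) = unit_swap X"
proof -
  have "regular_iev C X X \<bullet> (regular_proj C pz X \<otimes>\<^sub>a idt C X)
    = regular_iev C X X \<bullet> ((run C X \<otimes>\<^sub>a idt C (ldual C X)) \<otimes>\<^sub>a idt C X) \<bullet> (pz \<one>\<^sub>o X \<otimes>\<^sub>a idt C X)"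
    by (simp add: regular_proj_def merge_tensor)
  also have "\<dots> = unit_swap X"
    by (simp add: regular_iev_nat[THEN cmp_extend] unit_swap_def swap_def)
  finally show ?thesis .
qed

lemma unit_swap_nat:
  assumes "h \<in> arr C" "tgt C h = Y"
  shows "unit_swap Y \<bullet> (idt C (Z \<one>\<^sub>o) \<otimes>\<^sub>a h) = h \<bullet> unit_swap (src C h)"
  using assms src_tgt_obj(2)[OF assms(1)]
  by (simp add: unit_swap_def swap_nat run_nat[THEN cmp_extend])

text \<open>Natural families \<open>B \<otimes> X \<rightarrow> X\<close> and \<open>B \<otimes> X \<rightarrow> X \<otimes> \<one>\<close> are the same up to the right unit constraint,
so the universal property of \<open>Z \<one>\<close> is that of the regular instance of \<open>A\<close>.\<close>

lemma regular_universal_action: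
  "universal_action K C (regular_module C) (regular_ihom C) (regular_iev C) (Z \<one>\<^sub>o) (regular_proj C pz)"
proof -
  interpret regular: module_category K C "regular_module C" by (rule regular_module_category)
  interpret regular: internal_hom_module K C "regular_module C" "regular_ihom C" "regular_iev C"
    by unfold_locales (rule regular_internal_hom)
  interpret regular: endomorphism_cone K C "regular_module C" "regular_ihom C" "regular_iev C" "Z \<one>\<^sub>o" "regular_proj C pz"
    by unfold_locales (simp_all add: Hom_def regular_ihom_def)
  have ev: "regular.ev X = unit_swap X" if "X \<in> obj C" for X
    using that by (simp add: regular.ev_def regular_proj_bend)
  show ?thesis
  proof
    fix g N assume "g \<in> arr (regular_module C)" "tgt (regular_module C) g = N"
    then show "cmp (regular_module C) (regular.ev N) (actA (regular_module C) (idt C (Z \<one>\<^sub>o)) g) =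
        cmp (regular_module C) g (regular.ev (src (regular_module C) g))"
      using src_tgt_obj[of g] by (simp add: ev unit_swap_nat)
  next
    fix B t assume B: "B \<in> obj C"
      and "\<And>N. N \<in> obj (regular_module C) \<Longrightarrow> t N \<in> Hom (regular_module C) (actO (regular_module C) B N) N"
      and "\<And>g. g \<in> arr (regular_module C) \<Longrightarrow>
        cmp (regular_module C) (t (tgt (regular_module C) g)) (actA (regular_module C) (idt C B) g) =
        cmp (regular_module C) g (t (src (regular_module C) g))"
    then have t: "\<And>N. N \<in> obj C \<Longrightarrow> t N \<in> Hom C (B \<otimes>\<^sub>o N) N"
      and nat: "\<And>g. g \<in> arr C \<Longrightarrow> t (tgt C g) \<bullet> (idt C B \<otimes>\<^sub>a g) = g \<bullet> t (src C g)"
      by simp_all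
    note B [simp]
    have [simp]: "t X \<in> arr C" "src C (t X) = B \<otimes>\<^sub>o X" "tgt C (t X) = X" if "X \<in> obj C" for X
      using t[OF that] by (auto simp: Hom_def)
    have *: "\<exists>!u. u \<in> Hom C B (Z \<one>\<^sub>o) \<and> (\<forall>X \<in> obj C. swap \<one>\<^sub>o X \<bullet> (u \<otimes>\<^sub>a idt C X) = inv_arr C (run C X) \<bullet> t X)"
    proof (rule Z_universal)
      fix h assume [simp]: "h \<in> arr C"
      show "(inv_arr C (run C (tgt C h)) \<bullet> t (tgt C h)) \<bullet> (idt C B \<otimes>\<^sub>a h) =
         (h \<otimes>\<^sub>a idt C \<one>\<^sub>o) \<bullet> inv_arr C (run C (src C h)) \<bullet> t (src C h)"
        by (simp add: nat run_inv_nat[of h, THEN cmp_extend])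
    qed (auto simp: Hom_def)
    have iff: "swap \<one>\<^sub>o X \<bullet> (u \<otimes>\<^sub>a idt C X) = inv_arr C (run C X) \<bullet> t X \<longleftrightarrow> unit_swap X \<bullet> (u \<otimes>\<^sub>a idt C X) = t X"
      if u: "u \<in> Hom C B (Z \<one>\<^sub>o)" and [simp]: "X \<in> obj C" for u X
    proof -
      have [simp]: "u \<in> arr C" "src C u = B" "tgt C u = Z \<one>\<^sub>o" using u by (auto simp: Hom_def)
      show ?thesis
      proof
        assume "swap \<one>\<^sub>o X \<bullet> (u \<otimes>\<^sub>a idt C X) = inv_arr C (run C X) \<bullet> t X"
        then show "unit_swap X \<bullet> (u \<otimes>\<^sub>a idt C X) = t X" by (simp add: unit_swap_def)
      next
        assume e: "unit_swap X \<bullet> (u \<otimes>\<^sub>a idt C X) = t X"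
        have "inv_arr C (run C X) \<bullet> unit_swap X \<bullet> (u \<otimes>\<^sub>a idt C X) = inv_arr C (run C X) \<bullet> t X"
          by (simp only: e)
        then show "swap \<one>\<^sub>o X \<bullet> (u \<otimes>\<^sub>a idt C X) = inv_arr C (run C X) \<bullet> t X"
          by (simp add: unit_swap_def)
      qed
    qed
    then have "(u \<in> Hom C B (Z \<one>\<^sub>o) \<and> (\<forall>X \<in> obj C. swap \<one>\<^sub>o X \<bullet> (u \<otimes>\<^sub>a idt C X) = inv_arr C (run C X) \<bullet> t X)) \<longleftrightarrow>
      (u \<in> Hom C B (Z \<one>\<^sub>o) \<and> (\<forall>X \<in> obj C. regular.ev X \<bullet> (u \<otimes>\<^sub>a idt C X) = t X))" for u
      by (auto simp: ev)
    then show "\<exists>!u. u \<in> Hom C B (Z \<one>\<^sub>o) \<and> (\<forall>N \<in> obj (regular_module C).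
        cmp (regular_module C) (regular.ev N) (actA (regular_module C) u (idt (regular_module C) N)) = t N)"
      using * by simp
  qed
qed

end

section \<open>Class functions\<close>

context linear_category
begin

lemma hom_space_simps [simp]:
  "carrier (hom_space C X Y) = Hom C X Y" "add (hom_space C X Y) = addA C"
  "smult (hom_space C X Y) = scalA C" "ring.zero (hom_space C X Y) = zeroA C X Y"
  by (simp_all add: hom_space_def)

lemma Hom_obj:
  assumes "f \<in> Hom C X Y"
  shows "X \<in> obj C" "Y \<in> obj C"
  using assms by (auto simp: Hom_def)

lemma add_hom:
  assumes "f \<in> Hom C X Y" "g \<in> Hom C X Y"
  shows "addA C f g \<in> Hom C X Y"
proof -
  interpret module K "hom_space C X Y" using hom_module Hom_obj[OF assms(1)] by blast
  show ?thesis using M.a_closed[of f g] assms by simp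
qed

lemma scal_hom:
  assumes "c \<in> carrier K" "f \<in> Hom C X Y"
  shows "scalA C c f \<in> Hom C X Y"
proof -
  interpret module K "hom_space C X Y" using hom_module Hom_obj[OF assms(2)] by blast
  show ?thesis using smult_closed[of c f] assms by simp
qed

end

text \<open>The facts about the regular instance that are used below, restated in terms of \<open>C\<close> and \<open>unit_swap\<close>.\<close>

context central_comonad
begin

abbreviation \<tau> where
  "\<tau> \<equiv> half_braid C (regular_module C) (regular_ihom C) (regular_iev C) (Z \<one>\<^sub>o) (regular_proj C pz)"

lemma regular_ev:
  assumes "X \<in> obj C"
  shows "endomorphism_cone.ev (regular_module C) (regular_iev C) (regular_proj C pz) X = unit_swap X"
proof -
  interpret regular: universal_action K C "regular_module C" "regular_ihom C" "regular_iev C" "Z \<one>\<^sub>o" "regular_proj C pz"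
    by (rule regular_universal_action)
  show ?thesis
    using assms by (simp add: regular.ev_def regular_proj_bend)
qed

lemma unit_swap_cancel:
  assumes "u \<in> arr C" "v \<in> arr C" "src C u = src C v" "tgt C u = Z \<one>\<^sub>o" "tgt C v = Z \<one>\<^sub>o"
    and "\<And>X. X \<in> obj C \<Longrightarrow> unit_swap X \<bullet> (u \<otimes>\<^sub>a idt C X) = unit_swap X \<bullet> (v \<otimes>\<^sub>a idt C X)"
  shows "u = v"
proof -
  interpret regular: universal_action K C "regular_module C" "regular_ihom C" "regular_iev C" "Z \<one>\<^sub>o" "regular_proj C pz"
    by (rule regular_universal_action)
  show ?thesis
    by (rule regular.ev_cancel) (use assms in \<open>simp_all add: regular_ev\<close>)
qed

lemma tensor_unit_swap_cancel:
  assumes "X \<in> obj C" "s \<in> arr C" "s' \<in> arr C" "src C s = src C s'"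
    "tgt C s = X \<otimes>\<^sub>o Z \<one>\<^sub>o" "tgt C s' = X \<otimes>\<^sub>o Z \<one>\<^sub>o"
    and "\<And>Y. Y \<in> obj C \<Longrightarrow> (idt C X \<otimes>\<^sub>a unit_swap Y) \<bullet> asc C X (Z \<one>\<^sub>o) Y \<bullet> (s \<otimes>\<^sub>a idt C Y) =
      (idt C X \<otimes>\<^sub>a unit_swap Y) \<bullet> asc C X (Z \<one>\<^sub>o) Y \<bullet> (s' \<otimes>\<^sub>a idt C Y)"
  shows "s = s'"
proof -
  interpret regular: universal_action K C "regular_module C" "regular_ihom C" "regular_iev C" "Z \<one>\<^sub>o" "regular_proj C pz"
    by (rule regular_universal_action)
  show ?thesis
    by (rule regular.tensor_ev_cancel[of X]) (use assms in \<open>simp_all add: regular_ev\<close>)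
qed

lemma unit_half_braid_arr [simp]:
  assumes "X \<in> obj C"
  shows "\<tau> X \<in> arr C" "src C (\<tau> X) = Z \<one>\<^sub>o \<otimes>\<^sub>o X" "tgt C (\<tau> X) = X \<otimes>\<^sub>o Z \<one>\<^sub>o"
proof -
  interpret regular: universal_action K C "regular_module C" "regular_ihom C" "regular_iev C" "Z \<one>\<^sub>o" "regular_proj C pz"
    by (rule regular_universal_action)
  show "\<tau> X \<in> arr C" "src C (\<tau> X) = Z \<one>\<^sub>o \<otimes>\<^sub>o X" "tgt C (\<tau> X) = X \<otimes>\<^sub>o Z \<one>\<^sub>o"
    using regular.half_braid_arr assms by auto
qed

lemma unit_half_braid_swap:
  assumes [simp]: "X \<in> obj C" "Y \<in> obj C"
  shows "(idt C X \<otimes>\<^sub>a unit_swap Y) \<bullet> asc C X (Z \<one>\<^sub>o) Y \<bullet> (\<tau> X \<otimes>\<^sub>a idt C Y) = unit_swap (X \<otimes>\<^sub>o Y) \<bullet> asc C (Z \<one>\<^sub>o) X Y"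
proof -
  interpret regular: universal_action K C "regular_module C" "regular_ihom C" "regular_iev C" "Z \<one>\<^sub>o" "regular_proj C pz"
    by (rule regular_universal_action)
  show ?thesis
    using regular.half_braid_ev[of X Y] by (simp add: regular_ev)
qed

end

locale class_functions = universal_action K C M ih ie A p + central_comonad K C Z pz
  for K :: "('k, 'r) ring_scheme"
    and C :: "('c, 'e, 'k, 'x) tensor_cat_scheme" (structure)
    and M :: "('c, 'e, 'o, 'a, 'k, 'y) mod_cat_scheme" and ih ie A p Z pz
begin

abbreviation \<delta> where "\<delta> \<equiv> delta C M ih ie A p Z pz"

text \<open>The prescribed value of \<open>pz A X \<circ> \<delta>\<close> is the morphism whose bending is \<open>\<sigma> X\<close>. So \<open>\<delta>\<close> is the
morphism into \<open>Z A\<close> that represents the half-braiding, which exists because \<open>\<sigma>\<close> is natural.\<close>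

lemma delta_props:
  shows "\<delta> \<in> Hom C A (Z A)" and "X \<in> obj C \<Longrightarrow> swap A X \<bullet> (\<delta> \<otimes>\<^sub>a \<iota> X) = \<sigma> X"
proof -
  let ?Q = "\<lambda>d. d \<in> Hom C A (Z A) \<and> (\<forall>X \<in> obj C. swap A X \<bullet> (d \<otimes>\<^sub>a \<iota> X) = \<sigma> X)"
  let ?r = "\<lambda>X. (\<sigma> X \<otimes>\<^sub>a \<iota> (ldual C X)) \<bullet> inv_arr C (asc C A X (ldual C X)) \<bullet> (\<iota> A \<otimes>\<^sub>a lcoev C X) \<bullet> inv_arr C (run C A)"
  let ?P = "\<lambda>d. d \<in> Hom C A (Z A) \<and> (\<forall>X \<in> obj C. pz A X \<bullet> d = ?r X)"
  have ex: "\<exists>!d. ?Q d"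
    by (rule Z_universal) (auto simp: half_braid_props half_braid_nat)
  have "pz A X \<bullet> d = ?r X \<longleftrightarrow> swap A X \<bullet> (d \<otimes>\<^sub>a \<iota> X) = \<sigma> X" if "d \<in> Hom C A (Z A)" and [simp]: "X \<in> obj C" for d X
  proof -
    have [simp]: "d \<in> arr C" "src C d = A" "tgt C d = Z A" using that by (auto simp: Hom_def)
    have "pz A X \<bullet> d = ?r X \<longleftrightarrow> swap A X \<bullet> (d \<otimes>\<^sub>a \<iota> X) = regular_iev C X (X \<otimes>\<^sub>o A) \<bullet> (?r X \<otimes>\<^sub>a \<iota> X)"
      by (rule pz_swap_iff) simp_all
    also have "regular_iev C X (X \<otimes>\<^sub>o A) \<bullet> (?r X \<otimes>\<^sub>a \<iota> X) = \<sigma> X"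
      using bend_unbend[of A X "\<sigma> X" "X \<otimes>\<^sub>o A"] by (simp add: rcoev_def)
    finally show ?thesis .
  qed
  then have "?P d \<longleftrightarrow> ?Q d" for d by blast
  then have "\<delta> = (THE d. ?Q d)" by (simp add: delta_def)
  then have "?Q \<delta>" using theI'[OF ex] by simp
  then show "\<delta> \<in> Hom C A (Z A)" and "X \<in> obj C \<Longrightarrow> swap A X \<bullet> (\<delta> \<otimes>\<^sub>a \<iota> X) = \<sigma> X" by auto
qed

lemma delta_arr [simp]: "\<delta> \<in> arr C" "src C \<delta> = A" "tgt C \<delta> = Z A"
  using delta_props(1) by (auto simp: Hom_def)

text \<open>The morphism \<open>A \<rightarrow> Z \<one>\<close> of the Drinfeld center that corresponds to \<open>h : A \<rightarrow> \<one>\<close>.\<close>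

definition lift :: "'e \<Rightarrow> 'e" where
  "lift h = Z_map C Z pz h \<bullet> \<delta>"

lemma lift_arr [simp]:
  assumes "h \<in> arr C" "src C h = A"
  shows "lift h \<in> arr C" "src C (lift h) = A" "tgt C (lift h) = Z (tgt C h)"
  using assms by (auto simp: lift_def)

lemma lift_swap:
  assumes "h \<in> arr C" "src C h = A" "tgt C h = \<one>\<^sub>o" "X \<in> obj C"
  shows "unit_swap X \<bullet> (lift h \<otimes>\<^sub>a \<iota> X) = run C X \<bullet> (\<iota> X \<otimes>\<^sub>a h) \<bullet> \<sigma> X"
proof -
  have [simp]: "h \<in> arr C" "src C h = A" "tgt C h = \<one>\<^sub>o" "X \<in> obj C" using assms by auto
  have "unit_swap X \<bullet> (lift h \<otimes>\<^sub>a \<iota> X) = run C X \<bullet> swap \<one>\<^sub>o X \<bullet> (Z_map C Z pz h \<otimes>\<^sub>a \<iota> X) \<bullet> (\<delta> \<otimes>\<^sub>a \<iota> X)"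
    by (simp add: unit_swap_def lift_def merge_tensor)
  also have "\<dots> = run C X \<bullet> (\<iota> X \<otimes>\<^sub>a h) \<bullet> swap A X \<bullet> (\<delta> \<otimes>\<^sub>a \<iota> X)"
    by (simp add: Z_map_props(2)[of h A "\<one>\<^sub>o", THEN cmp_extend])
  also have "\<dots> = run C X \<bullet> (\<iota> X \<otimes>\<^sub>a h) \<bullet> \<sigma> X"
    by (simp add: delta_props(2))
  finally show ?thesis .
qed

text \<open>Compatibility with the half-braidings, tested by letting both sides act on \<open>Y\<close>. The left-hand side is
\<open>h\<close> after braiding \<open>A\<close> past \<open>X\<close> and then past \<open>Y\<close>, the right-hand side is \<open>h\<close> after braiding \<open>A\<close>
past \<open>X \<otimes> Y\<close>; the hexagon identifies them.\<close>

lemma lift_central: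
  assumes "h \<in> arr C" "src C h = A" "tgt C h = \<one>\<^sub>o" "X \<in> obj C"
  shows "(\<iota> X \<otimes>\<^sub>a lift h) \<bullet> \<sigma> X = \<tau> X \<bullet> (lift h \<otimes>\<^sub>a \<iota> X)"
proof (rule tensor_unit_swap_cancel[of X])
  have [simp]: "h \<in> arr C" "src C h = A" "tgt C h = \<one>\<^sub>o" "X \<in> obj C" using assms by auto
  fix Y assume [simp]: "Y \<in> obj C"
  let ?e = "\<lambda>s. (\<iota> X \<otimes>\<^sub>a unit_swap Y) \<bullet> asc C X (Z \<one>\<^sub>o) Y \<bullet> (s \<otimes>\<^sub>a \<iota> Y)"
  have "?e ((\<iota> X \<otimes>\<^sub>a lift h) \<bullet> \<sigma> X)
    = (\<iota> X \<otimes>\<^sub>a unit_swap Y) \<bullet> asc C X (Z \<one>\<^sub>o) Y \<bullet> ((\<iota> X \<otimes>\<^sub>a lift h) \<otimes>\<^sub>a \<iota> Y) \<bullet> (\<sigma> X \<otimes>\<^sub>a \<iota> Y)"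
    by (simp add: merge_tensor)
  also have "\<dots> = (\<iota> X \<otimes>\<^sub>a unit_swap Y) \<bullet> (\<iota> X \<otimes>\<^sub>a (lift h \<otimes>\<^sub>a \<iota> Y)) \<bullet> asc C X A Y \<bullet> (\<sigma> X \<otimes>\<^sub>a \<iota> Y)"
    by (simp add: nat_tensor)
  also have "\<dots> = (\<iota> X \<otimes>\<^sub>a (unit_swap Y \<bullet> (lift h \<otimes>\<^sub>a \<iota> Y))) \<bullet> asc C X A Y \<bullet> (\<sigma> X \<otimes>\<^sub>a \<iota> Y)"
    by (simp add: merge_tensor)
  also have "\<dots> = (\<iota> X \<otimes>\<^sub>a (run C Y \<bullet> (\<iota> Y \<otimes>\<^sub>a h) \<bullet> \<sigma> Y)) \<bullet> asc C X A Y \<bullet> (\<sigma> X \<otimes>\<^sub>a \<iota> Y)"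
    by (simp add: lift_swap)
  also have "\<dots> = (\<iota> X \<otimes>\<^sub>a run C Y) \<bullet> (\<iota> X \<otimes>\<^sub>a (\<iota> Y \<otimes>\<^sub>a h)) \<bullet> (\<iota> X \<otimes>\<^sub>a \<sigma> Y) \<bullet> asc C X A Y \<bullet> (\<sigma> X \<otimes>\<^sub>a \<iota> Y)"
    by (simp add: merge_tensor)
  finally have l: "?e ((\<iota> X \<otimes>\<^sub>a lift h) \<bullet> \<sigma> X) = \<dots>" .
  have "?e (\<tau> X \<bullet> (lift h \<otimes>\<^sub>a \<iota> X))
    = (\<iota> X \<otimes>\<^sub>a unit_swap Y) \<bullet> asc C X (Z \<one>\<^sub>o) Y \<bullet> (\<tau> X \<otimes>\<^sub>a \<iota> Y) \<bullet> ((lift h \<otimes>\<^sub>a \<iota> X) \<otimes>\<^sub>a \<iota> Y)"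
    by (simp add: merge_tensor)
  also have "\<dots> = ((\<iota> X \<otimes>\<^sub>a unit_swap Y) \<bullet> asc C X (Z \<one>\<^sub>o) Y \<bullet> (\<tau> X \<otimes>\<^sub>a \<iota> Y)) \<bullet> ((lift h \<otimes>\<^sub>a \<iota> X) \<otimes>\<^sub>a \<iota> Y)"
    by simp
  also have "\<dots> = unit_swap (X \<otimes>\<^sub>o Y) \<bullet> asc C (Z \<one>\<^sub>o) X Y \<bullet> ((lift h \<otimes>\<^sub>a \<iota> X) \<otimes>\<^sub>a \<iota> Y)"
    by (subst unit_half_braid_swap) simp_all
  also have "\<dots> = unit_swap (X \<otimes>\<^sub>o Y) \<bullet> (lift h \<otimes>\<^sub>a \<iota> (X \<otimes>\<^sub>o Y)) \<bullet> asc C A X Y"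
    by (simp add: nat_tensor)
  also have "\<dots> = run C (X \<otimes>\<^sub>o Y) \<bullet> (\<iota> (X \<otimes>\<^sub>o Y) \<otimes>\<^sub>a h) \<bullet> \<sigma> (X \<otimes>\<^sub>o Y) \<bullet> asc C A X Y"
    by (simp add: lift_swap[THEN cmp_extend])
  also have "\<dots> = run C (X \<otimes>\<^sub>o Y) \<bullet> (\<iota> (X \<otimes>\<^sub>o Y) \<otimes>\<^sub>a h) \<bullet> inv_arr C (asc C X Y A) \<bullet> (\<iota> X \<otimes>\<^sub>a \<sigma> Y)
      \<bullet> asc C X A Y \<bullet> (\<sigma> X \<otimes>\<^sub>a \<iota> Y)"
    by (simp add: half_braid_tensor)
  also have "\<dots> = run C (X \<otimes>\<^sub>o Y) \<bullet> inv_arr C (asc C X Y \<one>\<^sub>o) \<bullet> (\<iota> X \<otimes>\<^sub>a (\<iota> Y \<otimes>\<^sub>a h)) \<bullet> (\<iota> X \<otimes>\<^sub>a \<sigma> Y)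
      \<bullet> asc C X A Y \<bullet> (\<sigma> X \<otimes>\<^sub>a \<iota> Y)"
    using asc_inv_nat[THEN cmp_extend, of "\<iota> X" "\<iota> Y" h X Y "\<one>\<^sub>o" "(\<iota> X \<otimes>\<^sub>a \<sigma> Y) \<bullet> asc C X A Y \<bullet> (\<sigma> X \<otimes>\<^sub>a \<iota> Y)"]
    by simp
  also have "\<dots> = (\<iota> X \<otimes>\<^sub>a run C Y) \<bullet> (\<iota> X \<otimes>\<^sub>a (\<iota> Y \<otimes>\<^sub>a h)) \<bullet> (\<iota> X \<otimes>\<^sub>a \<sigma> Y) \<bullet> asc C X A Y \<bullet> (\<sigma> X \<otimes>\<^sub>a \<iota> Y)"
    by (simp add: run_tensor_inv[THEN cmp_extend])
  finally show "?e ((\<iota> X \<otimes>\<^sub>a lift h) \<bullet> \<sigma> X) = ?e (\<tau> X \<bullet> (lift h \<otimes>\<^sub>a \<iota> X))"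
    by (simp only: l)
qed (use assms in simp_all)

abbreviation action_star where "action_star \<equiv> star C M ih ie A p Z pz"

lemma star_lift: "action_star f h = f \<bullet> lift h"
  by (simp add: star_def lift_def)

lemma star_hom:
  assumes "f \<in> Hom C (Z \<one>\<^sub>o) \<one>\<^sub>o" "h \<in> Hom C A \<one>\<^sub>o"
  shows "action_star f h \<in> Hom C A \<one>\<^sub>o"
  using assms by (auto simp: star_lift Hom_def)

lemma lift_hom: "h \<in> Hom C A \<one>\<^sub>o \<Longrightarrow> lift h \<in> Hom C A (Z \<one>\<^sub>o)"
  by (auto simp: Hom_def)

lemma lift_eqI:
  assumes "u \<in> Hom C A (Z \<one>\<^sub>o)" "h \<in> Hom C A \<one>\<^sub>o"
    and "\<And>X. X \<in> obj C \<Longrightarrow> unit_swap X \<bullet> (u \<otimes>\<^sub>a \<iota> X) = run C X \<bullet> (\<iota> X \<otimes>\<^sub>a h) \<bullet> \<sigma> X"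
  shows "lift h = u"
  by (rule unit_swap_cancel) (use assms in \<open>auto simp: Hom_def lift_swap\<close>)

lemma lift_add:
  assumes g: "g \<in> Hom C A \<one>\<^sub>o" and h: "h \<in> Hom C A \<one>\<^sub>o"
  shows "lift (addA C g h) = addA C (lift g) (lift h)"
proof (rule lift_eqI)
  fix X assume X [simp]: "X \<in> obj C"
  have s: "\<sigma> X \<in> Hom C (A \<otimes>\<^sub>o X) (X \<otimes>\<^sub>o A)" and r: "run C X \<in> Hom C (X \<otimes>\<^sub>o \<one>\<^sub>o) X" and u: "unit_swap X \<in> Hom C (Z \<one>\<^sub>o \<otimes>\<^sub>o X) X"
    and i: "\<iota> X \<in> Hom C X X"
    by (simp_all add: Hom_def)
  note gh = tensor.bi_hom[OF i g] tensor.bi_hom[OF i h]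
  note l = tensor.bi_hom[OF lift_hom[OF g] i] tensor.bi_hom[OF lift_hom[OF h] i]
  have "unit_swap X \<bullet> (addA C (lift g) (lift h) \<otimes>\<^sub>a \<iota> X)
    = addA C (unit_swap X \<bullet> (lift g \<otimes>\<^sub>a \<iota> X)) (unit_swap X \<bullet> (lift h \<otimes>\<^sub>a \<iota> X))"
    by (simp only: tensor.bi_add_left[OF lift_hom[OF g] lift_hom[OF h] i] cmp_add_right[OF u l])
  also have "\<dots> = addA C (run C X \<bullet> (\<iota> X \<otimes>\<^sub>a g) \<bullet> \<sigma> X) (run C X \<bullet> (\<iota> X \<otimes>\<^sub>a h) \<bullet> \<sigma> X)"
    using g h by (simp add: Hom_def lift_swap)
  also have "\<dots> = run C X \<bullet> (\<iota> X \<otimes>\<^sub>a addA C g h) \<bullet> \<sigma> X"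
    by (simp only: tensor.bi_add_right[OF i g h] cmp_add_left[OF gh s]
        cmp_add_right[OF r cmp_hom[OF gh(1) s] cmp_hom[OF gh(2) s]])
  finally show "unit_swap X \<bullet> (addA C (lift g) (lift h) \<otimes>\<^sub>a \<iota> X) = run C X \<bullet> (\<iota> X \<otimes>\<^sub>a addA C g h) \<bullet> \<sigma> X" .
qed (use add_hom lift_hom g h in auto)

lemma lift_scal:
  assumes c: "c \<in> carrier K" and h: "h \<in> Hom C A \<one>\<^sub>o"
  shows "lift (scalA C c h) = scalA C c (lift h)"
proof (rule lift_eqI)
  fix X assume X [simp]: "X \<in> obj C"
  have s: "\<sigma> X \<in> Hom C (A \<otimes>\<^sub>o X) (X \<otimes>\<^sub>o A)" and r: "run C X \<in> Hom C (X \<otimes>\<^sub>o \<one>\<^sub>o) X" and u: "unit_swap X \<in> Hom C (Z \<one>\<^sub>o \<otimes>\<^sub>o X) X"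
    and i: "\<iota> X \<in> Hom C X X"
    by (simp_all add: Hom_def)
  note h' = tensor.bi_hom[OF i h]
  note l = tensor.bi_hom[OF lift_hom[OF h] i]
  have "unit_swap X \<bullet> (scalA C c (lift h) \<otimes>\<^sub>a \<iota> X) = scalA C c (unit_swap X \<bullet> (lift h \<otimes>\<^sub>a \<iota> X))"
    by (simp only: tensor.bi_scal_left[OF c lift_hom[OF h] i] cmp_scal_right[OF c u l])
  also have "\<dots> = scalA C c (run C X \<bullet> (\<iota> X \<otimes>\<^sub>a h) \<bullet> \<sigma> X)"
    using h by (simp add: Hom_def lift_swap)
  also have "\<dots> = run C X \<bullet> (\<iota> X \<otimes>\<^sub>a scalA C c h) \<bullet> \<sigma> X"
    by (simp only: tensor.bi_scal_right[OF c i h] cmp_scal_left[OF c h' s] cmp_scal_right[OF c r cmp_hom[OF h' s]])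
  finally show "unit_swap X \<bullet> (scalA C c (lift h) \<otimes>\<^sub>a \<iota> X) = run C X \<bullet> (\<iota> X \<otimes>\<^sub>a scalA C c h) \<bullet> \<sigma> X" .
qed (use scal_hom lift_hom c h in auto)

end

context central_comonad
begin

lemma regular_class_functions:
  "class_functions K C (regular_module C) (regular_ihom C) (regular_iev C) (Z \<one>\<^sub>o) (regular_proj C pz) Z pz"
  by (intro class_functions.intro regular_universal_action central_comonad_axioms)

abbreviation unit_star where
  "unit_star \<equiv> star C (regular_module C) (regular_ihom C) (regular_iev C) (Z \<one>\<^sub>o) (regular_proj C pz) Z pz"

text \<open>The map \<open>lift\<close> for the regular module category, as an operation on the arrows of \<open>C\<close>.\<close>

definition unit_lift :: "'e \<Rightarrow> 'e" where
  "unit_lift g = Z_map C Z pz g \<bullet>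
     delta C (regular_module C) (regular_ihom C) (regular_iev C) (Z \<one>\<^sub>o) (regular_proj C pz) Z pz"

text \<open>The unit of the algebra; as a morphism \<open>Z \<one> \<rightarrow> \<one>\<close> it is the counit of the comonad at \<open>\<one>\<close>.\<close>

definition counit :: "'e" where
  "counit = lev C \<one>\<^sub>o \<bullet> inv_arr C (run C (ldual C \<one>\<^sub>o)) \<bullet> lun C (ldual C \<one>\<^sub>o) \<bullet> regular_proj C pz \<one>\<^sub>o"

text \<open>The unit is given by the end projection at \<open>\<one>\<close>, while the calculus works with the bent projection. The
two agree up to unit constraints; this is where \<open>lun \<one> = run \<one>\<close> enters, through \<open>regular_iev_unit\<close>.\<close>

lemma counit_eq: "counit = unit_swap \<one>\<^sub>o \<bullet> inv_arr C (run C (Z \<one>\<^sub>o))"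
proof -
  let ?D = "ldual C \<one>\<^sub>o" and ?q = "regular_proj C pz \<one>\<^sub>o"
  have "unit_swap \<one>\<^sub>o \<bullet> inv_arr C (run C (Z \<one>\<^sub>o))
    = regular_iev C \<one>\<^sub>o \<one>\<^sub>o \<bullet> (?q \<otimes>\<^sub>a idt C \<one>\<^sub>o) \<bullet> inv_arr C (run C (Z \<one>\<^sub>o))"
    by (simp add: regular_proj_bend[symmetric])
  also have "\<dots> = regular_iev C \<one>\<^sub>o \<one>\<^sub>o \<bullet> inv_arr C (run C (\<one>\<^sub>o \<otimes>\<^sub>o ?D)) \<bullet> ?q"
    by (simp add: run_inv_nat[of ?q])
  also have "\<dots> = lev C \<one>\<^sub>o \<bullet> (lun C ?D \<otimes>\<^sub>a idt C \<one>\<^sub>o) \<bullet> inv_arr C (run C (\<one>\<^sub>o \<otimes>\<^sub>o ?D)) \<bullet> ?q"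
    by (simp add: regular_iev_unit)
  also have "\<dots> = lev C \<one>\<^sub>o \<bullet> inv_arr C (run C ?D) \<bullet> lun C ?D \<bullet> ?q"
    by (simp add: run_inv_nat[of "lun C ?D" ?D, THEN cmp_extend])
  finally show ?thesis by (simp add: counit_def)
qed

lemma counit_hom: "counit \<in> Hom C (Z \<one>\<^sub>o) \<one>\<^sub>o"
  by (simp add: counit_eq Hom_def)

lemma counit_arr [simp]: "counit \<in> arr C" "src C counit = Z \<one>\<^sub>o" "tgt C counit = \<one>\<^sub>o"
  using counit_hom by (auto simp: Hom_def)

lemma unit_star_lift: "unit_star f g = f \<bullet> unit_lift g"
  by (simp add: star_def unit_lift_def)

lemma unit_lift_hom:
  assumes "g \<in> Hom C (Z \<one>\<^sub>o) \<one>\<^sub>o"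
  shows "unit_lift g \<in> Hom C (Z \<one>\<^sub>o) (Z \<one>\<^sub>o)"
proof -
  interpret regular: class_functions K C "regular_module C" "regular_ihom C" "regular_iev C" "Z \<one>\<^sub>o" "regular_proj C pz" Z pz
    by (rule regular_class_functions)
  show ?thesis using regular.lift_hom[OF assms] by (simp add: regular.lift_def unit_lift_def)
qed

lemma unit_lift_swap:
  assumes "g \<in> arr C" "src C g = Z \<one>\<^sub>o" "tgt C g = \<one>\<^sub>o" "X \<in> obj C"
  shows "unit_swap X \<bullet> (unit_lift g \<otimes>\<^sub>a idt C X) = run C X \<bullet> (idt C X \<otimes>\<^sub>a g) \<bullet> \<tau> X"
proof -
  interpret regular: class_functions K C "regular_module C" "regular_ihom C" "regular_iev C" "Z \<one>\<^sub>o" "regular_proj C pz" Z pz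
    by (rule regular_class_functions)
  show ?thesis using regular.lift_swap[OF assms] by (simp add: regular.lift_def unit_lift_def)
qed

text \<open>Both sides represent \<open>unit_swap\<close>: the left-hand side represents the action on \<open>\<one>\<close> after
braiding past \<open>X\<close>, which is the action on \<open>X \<otimes> \<one>\<close>, hence on \<open>X\<close> by naturality.\<close>

lemma unit_lift_counit: "unit_lift counit = idt C (Z \<one>\<^sub>o)"
proof (rule unit_swap_cancel)
  fix X assume [simp]: "X \<in> obj C"
  have "unit_swap X \<bullet> (unit_lift counit \<otimes>\<^sub>a idt C X)
    = run C X \<bullet> (idt C X \<otimes>\<^sub>a unit_swap \<one>\<^sub>o) \<bullet> (idt C X \<otimes>\<^sub>a inv_arr C (run C (Z \<one>\<^sub>o))) \<bullet> \<tau> X"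
    by (simp add: unit_lift_swap) (simp add: counit_eq merge_tensor)
  also have "\<dots> = run C X \<bullet> (idt C X \<otimes>\<^sub>a unit_swap \<one>\<^sub>o) \<bullet> asc C X (Z \<one>\<^sub>o) \<one>\<^sub>o \<bullet> inv_arr C (run C (X \<otimes>\<^sub>o Z \<one>\<^sub>o)) \<bullet> \<tau> X"
    by (simp add: run_tensor_inv[THEN cmp_extend])
  also have "\<dots> = run C X \<bullet> ((idt C X \<otimes>\<^sub>a unit_swap \<one>\<^sub>o) \<bullet> asc C X (Z \<one>\<^sub>o) \<one>\<^sub>o \<bullet> (\<tau> X \<otimes>\<^sub>a idt C \<one>\<^sub>o))
      \<bullet> inv_arr C (run C (Z \<one>\<^sub>o \<otimes>\<^sub>o X))"
    by (simp add: run_inv_nat[of "\<tau> X"])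
  also have "\<dots> = run C X \<bullet> unit_swap (X \<otimes>\<^sub>o \<one>\<^sub>o) \<bullet> asc C (Z \<one>\<^sub>o) X \<one>\<^sub>o \<bullet> inv_arr C (run C (Z \<one>\<^sub>o \<otimes>\<^sub>o X))"
    by (subst unit_half_braid_swap) simp_all
  also have "\<dots> = run C X \<bullet> unit_swap (X \<otimes>\<^sub>o \<one>\<^sub>o) \<bullet> (idt C (Z \<one>\<^sub>o) \<otimes>\<^sub>a inv_arr C (run C X))"
    by (simp add: run_tensor_inv)
  also have "\<dots> = unit_swap X \<bullet> (idt C (Z \<one>\<^sub>o) \<otimes>\<^sub>a idt C X)"
    by (simp add: unit_swap_nat)
  finally show "unit_swap X \<bullet> (unit_lift counit \<otimes>\<^sub>a idt C X) = unit_swap X \<bullet> (idt C (Z \<one>\<^sub>o) \<otimes>\<^sub>a idt C X)" .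
qed (use unit_lift_hom[OF counit_hom] in \<open>auto simp: Hom_def\<close>)

lemma unit_star_counit: "f \<in> Hom C (Z \<one>\<^sub>o) \<one>\<^sub>o \<Longrightarrow> unit_star f counit = f"
  by (auto simp: unit_star_lift unit_lift_counit Hom_def)

end

context class_functions
begin

text \<open>Since \<open>f\<close> is only composed on the left, the claim is \<open>lift (g \<circ> lift h) = unit_lift g \<circ> lift h\<close>.
Both represent the family \<open>X \<mapsto> (X \<otimes> g) \<circ> (X \<otimes> lift h) \<circ> \<sigma> X\<close>, by \<open>lift_central\<close>.\<close>

lemma star_assoc:
  assumes f: "f \<in> Hom C (Z \<one>\<^sub>o) \<one>\<^sub>o" and g: "g \<in> Hom C (Z \<one>\<^sub>o) \<one>\<^sub>o" and h: "h \<in> Hom C A \<one>\<^sub>o"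
  shows "action_star (unit_star f g) h = action_star f (action_star g h)"
proof -
  have [simp]: "f \<in> arr C" "src C f = Z \<one>\<^sub>o" "tgt C f = \<one>\<^sub>o" "g \<in> arr C" "src C g = Z \<one>\<^sub>o" "tgt C g = \<one>\<^sub>o"
    "h \<in> arr C" "src C h = A" "tgt C h = \<one>\<^sub>o" using f g h by (auto simp: Hom_def)
  have [simp]: "unit_lift g \<in> arr C" "src C (unit_lift g) = Z \<one>\<^sub>o" "tgt C (unit_lift g) = Z \<one>\<^sub>o"
    using unit_lift_hom[OF g] by (auto simp: Hom_def)
  have "lift (g \<bullet> lift h) = unit_lift g \<bullet> lift h"
  proof (rule lift_eqI)
    fix X assume [simp]: "X \<in> obj C"
    have "unit_swap X \<bullet> ((unit_lift g \<bullet> lift h) \<otimes>\<^sub>a \<iota> X) = unit_swap X \<bullet> (unit_lift g \<otimes>\<^sub>a \<iota> X) \<bullet> (lift h \<otimes>\<^sub>a \<iota> X)"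
      by (simp add: merge_tensor)
    also have "\<dots> = run C X \<bullet> (\<iota> X \<otimes>\<^sub>a g) \<bullet> \<tau> X \<bullet> (lift h \<otimes>\<^sub>a \<iota> X)"
      by (simp add: unit_lift_swap[THEN cmp_extend])
    also have "\<dots> = run C X \<bullet> (\<iota> X \<otimes>\<^sub>a g) \<bullet> (\<iota> X \<otimes>\<^sub>a lift h) \<bullet> \<sigma> X"
      by (simp add: lift_central)
    also have "\<dots> = run C X \<bullet> (\<iota> X \<otimes>\<^sub>a (g \<bullet> lift h)) \<bullet> \<sigma> X"
      by (simp add: merge_tensor)
    finally show "unit_swap X \<bullet> ((unit_lift g \<bullet> lift h) \<otimes>\<^sub>a \<iota> X) = run C X \<bullet> (\<iota> X \<otimes>\<^sub>a (g \<bullet> lift h)) \<bullet> \<sigma> X" .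
  qed (simp_all add: Hom_def)
  then show ?thesis by (simp add: star_lift unit_star_lift)
qed

text \<open>The counit evaluates the family represented by \<open>lift h\<close> at \<open>\<one>\<close>, where \<open>\<sigma>\<close> is canonical.\<close>

lemma star_counit:
  assumes h: "h \<in> Hom C A \<one>\<^sub>o"
  shows "action_star counit h = h"
proof -
  have [simp]: "h \<in> arr C" "src C h = A" "tgt C h = \<one>\<^sub>o" using h by (auto simp: Hom_def)
  have "action_star counit h = unit_swap \<one>\<^sub>o \<bullet> inv_arr C (run C (Z \<one>\<^sub>o)) \<bullet> lift h"
    by (simp add: star_lift counit_eq)
  also have "\<dots> = unit_swap \<one>\<^sub>o \<bullet> (lift h \<otimes>\<^sub>a \<iota> \<one>\<^sub>o) \<bullet> inv_arr C (run C A)"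
    by (simp add: run_inv_nat)
  also have "\<dots> = run C \<one>\<^sub>o \<bullet> (\<iota> \<one>\<^sub>o \<otimes>\<^sub>a h) \<bullet> inv_arr C (lun C A)"
    by (simp add: lift_swap[THEN cmp_extend] half_braid_unit)
  also have "\<dots> = h"
    by (simp add: lun_unit[symmetric] lun_nat[THEN cmp_extend])
  finally show ?thesis .
qed

lemma star_bilinear:
  assumes f: "f \<in> Hom C (Z \<one>\<^sub>o) \<one>\<^sub>o" and f': "f' \<in> Hom C (Z \<one>\<^sub>o) \<one>\<^sub>o" and h: "h \<in> Hom C A \<one>\<^sub>o" and h': "h' \<in> Hom C A \<one>\<^sub>o"
  shows "action_star (addA C f f') h = addA C (action_star f h) (action_star f' h)"
    and "action_star f (addA C h h') = addA C (action_star f h) (action_star f h')"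
    and "c \<in> carrier K \<Longrightarrow> action_star (scalA C c f) h = scalA C c (action_star f h)"
    and "c \<in> carrier K \<Longrightarrow> action_star f (scalA C c h) = scalA C c (action_star f h)"
  using cmp_add_left[OF f f' lift_hom[OF h]] cmp_add_right[OF f lift_hom[OF h] lift_hom[OF h']]
    cmp_scal_left[OF _ f lift_hom[OF h]] cmp_scal_right[OF _ f lift_hom[OF h]]
  by (simp_all add: star_lift lift_add[OF h h'] lift_scal[OF _ h])

end

context central_comonad
begin

lemma CF_algebra_simps:
  "carrier (CF_algebra C Z pz) = Hom C (Z \<one>\<^sub>o) \<one>\<^sub>o" "add (CF_algebra C Z pz) = addA C"
  "ring.zero (CF_algebra C Z pz) = zeroA C (Z \<one>\<^sub>o) \<one>\<^sub>o" "smult (CF_algebra C Z pz) = scalA C"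
  "monoid.mult (CF_algebra C Z pz) = unit_star" "one (CF_algebra C Z pz) = counit"
  by (simp_all add: CF_algebra_def CF_space_def counit_def)

lemma CF_algebra_unital: "unital_algebra K (CF_algebra C Z pz)"
proof -
  interpret regular: class_functions K C "regular_module C" "regular_ihom C" "regular_iev C" "Z \<one>\<^sub>o" "regular_proj C pz" Z pz
    by (rule regular_class_functions)
  have H: "module K (hom_space C (Z \<one>\<^sub>o) \<one>\<^sub>o)" by (rule hom_module) simp_all
  have add_monoid: "add_monoid (CF_algebra C Z pz) = add_monoid (hom_space C (Z \<one>\<^sub>o) \<one>\<^sub>o)"
    by (simp add: CF_algebra_simps)
  interpret H: module K "hom_space C (Z \<one>\<^sub>o) \<one>\<^sub>o" by (rule H)
  have grp: "abelian_group (CF_algebra C Z pz)"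
    using H.M.abelian_group_axioms
    by (simp add: abelian_group_def abelian_monoid_def abelian_group_axioms_def add_monoid)
  have mod: "module K (CF_algebra C Z pz)"
    using H grp by (simp add: module_def module_axioms_def CF_algebra_simps)
  have ring: "ring (CF_algebra C Z pz)"
    by (intro ringI monoidI grp)
       (simp_all add: CF_algebra_simps counit_hom regular.star_hom regular.star_assoc regular.star_counit
         regular.star_bilinear unit_star_counit)
  show ?thesis
    by (intro unital_algebra.intro mod ring unital_algebra_axioms.intro)
       (simp_all add: CF_algebra_simps regular.star_bilinear)
qed

end

lemma (in class_functions) CF_left_module:
  "left_module K (CF_algebra C Z pz) (CF_space C A) action_star"
proof -
  have V: "module K (CF_space C A)" unfolding CF_space_def by (rule hom_module) simp_all
  show ?thesis
    by (intro left_module.intro CF_algebra_unital V left_module_axioms.intro)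
       (simp_all add: CF_algebra_simps CF_space_def star_hom star_bilinear star_counit star_assoc)
qed

lemma module_category_of_finite:
  assumes "finite_tensor_category K C" "finite_module_category K C M"
  shows "module_category K C M"
proof -
  interpret C: finite_tensor_category K C by fact
  interpret M: finite_module_category K C M by fact
  show ?thesis
    by unfold_locales
       (fact M.masc_iso M.masc_natural M.mun_natural M.module_pentagon M.module_triangle)+
qed

theorem lemma5p3:
  fixes K :: "'k ring"
    and C :: "('c, 'e, 'k) tensor_cat"
    and M :: "('c, 'e, 'o, 'a, 'k) mod_cat"
    and ih :: "'o \<Rightarrow> 'o \<Rightarrow> 'c" and ie :: "'o \<Rightarrow> 'o \<Rightarrow> 'a"
    and A :: 'c and p :: "'o \<Rightarrow> 'e"
    and Z :: "'c \<Rightarrow> 'c" and pz :: "'c \<Rightarrow> 'c \<Rightarrow> 'e"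
  assumes "algebraically_closed K"
    and "finite_tensor_category K C"
    and "finite_module_category K C M"
    and "is_internal_hom C M ih ie"
    and "is_end C M ih (ihom_arr C M ih ie) A p"
    and "is_Z C Z pz"
  shows "left_module K (CF_algebra C Z pz) (CF_space C A) (star C M ih ie A p Z pz)"
proof -
  interpret internal_hom_module K C M ih ie
    by (intro internal_hom_module.intro module_category_of_finite internal_hom_module_axioms.intro) fact+
  interpret class_functions K C M ih ie A p Z pz
    by (intro class_functions.intro universal_action_of_end central_comonad.intro central_comonad_axioms.intro) fact+
  show ?thesis by (rule CF_left_module)
qed

end
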